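(* Let $k,s\in\mathbb{N}$, $p_1>0,\dots,p_k>0$ with $p_1+\dots+p_k<1$, and put $p_0=1-p_1-\dots-p_k$. Let $(Y_{1t},\dots,Y_{kt})\sim NMn(s;p_1,\dots,p_k)$, $t=1,2,\dots$, be independent random vectors, and let $N$ be a non-negative integer-valued random variable independent of them. Put $X_{lN}=I_{\{N>0\}}\sum_{t=1}^NY_{lt}$, $l=1,\dots,k$, so that $(X_{1N},\dots,X_{kN})\sim C\,N\,NMn(\vec a_N;s,p_1,\dots,p_k)$. Then the following hold (indices $i,j\in\{1,\dots,k\}$, with $i\neq j$ where both index coordinates). 1. $$G_{X_{1N},\dots,X_{kN}}(z_1,\dots,z_k)=G_{sN}\left(\frac{p_0}{1-p_1z_1-\dots-p_kz_k}\right).$$ 2. $P(X_{1N}=0,\dots,X_{kN}=0)=G_{sN}(p_0)$, and for non-negative integers $x_1,\dots,x_k$ with $(x_1,\dots,x_k)\neq(0,\dots,0)$, $$P(X_{1N}=x_1,\dots,X_{kN}=x_k)=p_1^{x_1}\cdots p_k^{x_k}\sum_{n=1}^\infty\binom{sn+x_1+\dots+x_k-1}{x_1,\dots,x_k,sn-1}p_0^{ns}P(N=n).$$ 3. For all $r=1,\dots,k$ and all $X_{i_1N},\dots,X_{i_rN}$ (distinct indices), with $$\rho_{i_m}=\frac{p_{i_m}}{p_0+\sum_{l=1}^rp_{i_l}}\ (m=1,\dots,r),\qquad\rho_{0r}=1-\rho_{i_1}-\dots-\rho_{i_r},$$ one has $$G_{X_{i_1N},\dots,X_{i_rN}}(z_{i_1},\dots,z_{i_r})=G_{sN}\left(\frac{\rho_{0r}}{1-\rho_{i_1}z_{i_1}-\dots-\rho_{i_r}z_{i_r}}\right),$$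 i.e. $(X_{i_1N},\dots,X_{i_rN})\sim C\,N\,NMn(\vec a_N;s,\rho_{i_1},\dots,\rho_{i_r})$; moreover $P(X_{i_1N}=0,\dots,X_{i_rN}=0)=G_{sN}(\rho_{0r})$, and for non-negative integers with $(x_{i_1},\dots,x_{i_r})\neq(0,\dots,0)$, $$P(X_{i_1N}=x_{i_1},\dots,X_{i_rN}=x_{i_r})=\rho_{i_1}^{x_{i_1}}\cdots\rho_{i_r}^{x_{i_r}}\sum_{n=1}^\infty\binom{sn+x_{i_1}+\dots+x_{i_r}-1}{x_{i_1},\dots,x_{i_r},sn-1}\rho_{0r}^{ns}P(N=n).$$ 4. If $EN<\infty$, then $EX_{iN}=s\frac{p_i}{p_0}EN$. If $E(N^2)<\infty$, then $$Var\,X_{iN}=s\frac{p_i^2}{p_0^2}\left[s\,Var\,N+\left(1+\frac{p_0}{p_i}\right)EN\right],\qquad FI\,X_{iN}=1+\frac{p_i}{p_0}[s\,FI\,N+1].$$ 5. $$cor(X_{iN},X_{jN})=\sqrt{\frac{(FI\,X_{iN}-1)(FI\,X_{jN}-1)}{FI\,X_{iN}\,FI\,X_{jN}}}.$$ 6. For integers $x_j\geq 1$ and $x_i=0,1,\dots$, $$P(X_{iN}=x_i\mid X_{jN}=x_j)=\frac{1}{x_i!}\left(\frac{p_0+p_j}{p_0+p_i+p_j}\right)^{x_j}\left(\frac{p_i}{p_0+p_i+p_j}\right)^{x_i}\frac{\sum_{n=1}^\infty\frac{(sn+x_i+x_j-1)!}{(sn-1)!}\left(\frac{p_0}{p_0+p_i+p_j}\right)^{sn}P(N=n)}{\sum_{n=1}^\infty\frac{(sn+x_j-1)!}{(sn-1)!}\left(\frac{p_0}{p_0+p_j}\right)^{sn}P(N=n)}.$$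 For $x_i=1,2,\dots$, $$P(X_{iN}=x_i\mid X_{jN}=0)=\frac{\left(\frac{p_i}{p_0+p_i+p_j}\right)^{x_i}}{G_{sN}\left(\frac{p_0}{p_0+p_j}\right)}\sum_{n=1}^\infty\frac{(sn+x_i-1)!}{x_i!(sn-1)!}\left(\frac{p_0}{p_0+p_i+p_j}\right)^{sn}P(N=n),$$ and $$P(X_{iN}=0\mid X_{jN}=0)=\frac{G_{sN}\left(\frac{p_0}{p_0+p_i+p_j}\right)}{G_{sN}\left(\frac{p_0}{p_0+p_j}\right)}.$$ 7. For $x_j=1,2,\dots$, $$E(X_{iN}\mid X_{jN}=x_j)=\frac{p_i}{p_j}(x_j+1)\frac{P(X_{jN}=x_j+1)}{P(X_{jN}=x_j)}.$$ 8. $X_{1N}+\dots+X_{kN}\sim C\,N\,NMn(\vec a_N;s,1-p_0)$. 9. For $j=1,2,\dots$ and $i=1,\dots,k$, the conditional distribution of $X_{iN}$ given $X_{1N}+\dots+X_{kN}=j$ is $Bi\left(j;\frac{p_i}{1-p_0}\right)$.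
   Context: A random vector $(\xi_1,\dots,\xi_k)$ is negative multinomially distributed, $(\xi_1,\dots,\xi_k)\sim NMn(n;p_1,\dots,p_k)$ with $n\in\mathbb N$, $p_i>0$, $p_1+\dots+p_k<1$, if for all non-negative integers $i_1,\dots,i_k$, $P(\xi_1=i_1,\dots,\xi_k=i_k)=\binom{n+i_1+\dots+i_k-1}{i_1,\dots,i_k,n-1}p_1^{i_1}\cdots p_k^{i_k}(1-p_1-\dots-p_k)^n$, where $\binom{a_1+\dots+a_d}{a_1,\dots,a_d}=\frac{(a_1+\dots+a_d)!}{a_1!\cdots a_d!}$. For $k=1$ this is the negative binomial distribution (number of successes, each of probability $p_1$, before the $n$-th failure). $Bi(n;p)$ is the binomial distribution with $n$ trials and success probability $p$. In general, $C\,N\,NMn(\vec a_N;s,q_1,\dots,q_d)$ denotes the distribution of the random sum, over $N$ i.i.d. $NMn(s;q_1,\dots,q_d)$ vectors independent of $N$ (equal to the zero vector if $N=0$), where $\vec a_N$ is the vector of parameters of the distribution of $N$. The p.g.f. of a non-negative integer random vector is $G_{\xi_1,\dots,\xi_r}(z_1,\dots,z_r)=E(z_1^{\xi_1}\cdots z_r^{\xi_r})$; in particular $G_{sN}(z)=E(z^{sN})$. $FI\,X=Var\,X/EX$ is the Fisher index of dispersion; $cor$ is the correlation coefficient. Each formula is asserted whenever the quantities in it are defined (conditioning events of positive probability, denominators nonzero, p.g.f.s existing at the argument, moments and conditional expectations finite). *)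

theory Defs
  imports "HOL-Probability.Probability"
begin

text \<open>
  A non-negative integer random vector is a family \<open>X i\<close> of random variables indexed by a
  finite set \<open>I\<close>; its values live in the countable set \<open>I \<rightarrow>\<^sub>E UNIV\<close>.
\<close>

abbreviation nat_vectors :: "'i set \<Rightarrow> ('i \<Rightarrow> nat) measure" where
  "nat_vectors I \<equiv> count_space (I \<rightarrow>\<^sub>E (UNIV :: nat set))"

definition rvec :: "'i set \<Rightarrow> ('i \<Rightarrow> 'a \<Rightarrow> nat) \<Rightarrow> 'a \<Rightarrow> ('i \<Rightarrow> nat)" where
  "rvec I X \<omega> = (\<lambda>i\<in>I. X i \<omega>)"

text \<open>The multinomial coefficient with lower entries \<open>x i\<close> (for \<open>i \<in> I\<close>) and \<open>m\<close>.\<close>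

definition multinom :: "'i set \<Rightarrow> ('i \<Rightarrow> nat) \<Rightarrow> nat \<Rightarrow> real" where
  "multinom I x m = fact ((\<Sum>i\<in>I. x i) + m) / ((\<Prod>i\<in>I. fact (x i)) * fact m)"

text \<open>
  The negative multinomial law. It is meant for \<open>n \<ge> 1\<close>, \<open>p i > 0\<close> and \<open>(\<Sum>i\<in>I. p i) < 1\<close>.
\<close>

definition NMn :: "'i set \<Rightarrow> nat \<Rightarrow> ('i \<Rightarrow> real) \<Rightarrow> ('i \<Rightarrow> nat) measure" where
  "NMn I n p = point_measure (I \<rightarrow>\<^sub>E UNIV)
     (\<lambda>x. ennreal (multinom I x (n - 1) * (\<Prod>i\<in>I. p i ^ x i) * (1 - (\<Sum>i\<in>I. p i)) ^ n))"

text \<open>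
  The law of the sum of \<open>N\<close> i.i.d. \<open>NMn I s q\<close> vectors independent of \<open>N\<close>, where \<open>\<mu>\<close> is the
  law of \<open>N\<close>; it is realised on the canonical product space.
\<close>

definition CNNMn :: "nat measure \<Rightarrow> 'i set \<Rightarrow> nat \<Rightarrow> ('i \<Rightarrow> real) \<Rightarrow> ('i \<Rightarrow> nat) measure" where
  "CNNMn \<mu> I s q =
     distr (\<mu> \<Otimes>\<^sub>M (\<Pi>\<^sub>M t\<in>{1::nat..}. NMn I s q)) (nat_vectors I)
       (\<lambda>(n, y). \<lambda>i\<in>I. \<Sum>t=1..n. y t i)"

text \<open>
  Probability generating functions at real arguments. They exist at an argument if the
  expectation converges absolutely there, which always holds if no coordinate exceeds 1 in
  absolute value.
\<close>

definition pgf_exists :: "'a measure \<Rightarrow> 'i set \<Rightarrow> ('i \<Rightarrow> 'a \<Rightarrow> nat) \<Rightarrow> ('i \<Rightarrow> real) \<Rightarrow> bool" where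
  "pgf_exists M I X z \<longleftrightarrow> integrable M (\<lambda>\<omega>. \<Prod>i\<in>I. z i ^ X i \<omega>)"

definition pgf :: "'a measure \<Rightarrow> 'i set \<Rightarrow> ('i \<Rightarrow> 'a \<Rightarrow> nat) \<Rightarrow> ('i \<Rightarrow> real) \<Rightarrow> real" where
  "pgf M I X z = (\<integral>\<omega>. (\<Prod>i\<in>I. z i ^ X i \<omega>) \<partial>M)"

definition pgf1_exists :: "'a measure \<Rightarrow> ('a \<Rightarrow> nat) \<Rightarrow> real \<Rightarrow> bool" where
  "pgf1_exists M X z \<longleftrightarrow> integrable M (\<lambda>\<omega>. z ^ X \<omega>)"

definition pgf1 :: "'a measure \<Rightarrow> ('a \<Rightarrow> nat) \<Rightarrow> real \<Rightarrow> real" where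
  "pgf1 M X z = (\<integral>\<omega>. z ^ X \<omega> \<partial>M)"

definition mean :: "'a measure \<Rightarrow> ('a \<Rightarrow> nat) \<Rightarrow> real" where
  "mean M X = (\<integral>\<omega>. real (X \<omega>) \<partial>M)"

definition cov :: "'a measure \<Rightarrow> ('a \<Rightarrow> nat) \<Rightarrow> ('a \<Rightarrow> nat) \<Rightarrow> real" where
  "cov M X Y = (\<integral>\<omega>. (real (X \<omega>) - mean M X) * (real (Y \<omega>) - mean M Y) \<partial>M)"

definition var :: "'a measure \<Rightarrow> ('a \<Rightarrow> nat) \<Rightarrow> real" where
  "var M X = (\<integral>\<omega>. (real (X \<omega>) - mean M X)\<^sup>2 \<partial>M)"

definition cor :: "'a measure \<Rightarrow> ('a \<Rightarrow> nat) \<Rightarrow> ('a \<Rightarrow> nat) \<Rightarrow> real" where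
  "cor M X Y = cov M X Y / sqrt (var M X * var M Y)"

definition FI :: "'a measure \<Rightarrow> ('a \<Rightarrow> nat) \<Rightarrow> real" where
  "FI M X = var M X / mean M X"

text \<open>\<open>uniform_measure M A\<close> is the conditional probability measure given the event \<open>A\<close>.\<close>

definition cond_mean :: "'a measure \<Rightarrow> ('a \<Rightarrow> nat) \<Rightarrow> ('a \<Rightarrow> bool) \<Rightarrow> real" where
  "cond_mean M X Q = mean (uniform_measure M {\<omega>\<in>space M. Q \<omega>}) X"

definition cond_law :: "'a measure \<Rightarrow> ('a \<Rightarrow> nat) \<Rightarrow> ('a \<Rightarrow> bool) \<Rightarrow> nat measure" where
  "cond_law M X Q = distr (uniform_measure M {\<omega>\<in>space M. Q \<omega>}) (count_space UNIV) X"

end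

theory Submission
  imports Defs
begin

text \<open>
  Write \<open>p0\<close> for one minus the sum of the \<open>p i\<close> and \<open>|x|\<close> for the total of a vector \<open>x\<close>. The
  negative multinomial point mass is a rising factorial of length \<open>|x|\<close> starting at \<open>n\<close>, times the
  product of the \<open>p i ^ x i / x i!\<close>, times \<open>p0 ^ n\<close>. In this form it makes sense for \<open>n = 0\<close> as
  well, where it is the point mass at the origin, and the resulting laws \<open>negmult I n p\<close> form a
  convolution semigroup in \<open>n\<close>: this is the Vandermonde identity for rising factorials
  (\<open>nn_integral_negmult_add\<close>). Hence a random sum of \<open>N\<close> independent vectors with parameter \<open>s\<close>
  has, given \<open>N\<close>, the law with parameter \<open>s N\<close>, also when \<open>N = 0\<close>. The locale
  \<open>compound_negmult\<close> records exactly this as a tower property for expectations of non-negative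
  functions, and all assertions follow from it by an integration over \<open>N\<close> of a fact about one
  negative multinomial law.

  Only three such facts are needed. The first is the multinomial theorem
  (\<open>multinomial_theorem\<close>): integrating against the weights \<open>q i ^ x i / x i!\<close> a function that
  depends on the total only replaces the vector by one variable with parameter \<open>\<Sum> q i\<close>. With the
  negative binomial series this gives the normalisation, the generating function, the law of the
  total, and the marginals, which are negative multinomial with rescaled parameters; so marginals
  and the total of a compound vector are again compound. The second is that, given its total, a
  negative multinomial vector is multinomial whatever \<open>n\<close> is, so that mixing over \<open>N\<close> leaves the
  conditional law of a coordinate binomial. The third is the size-bias identity
  (\<open>nn_integral_negmult_size_bias\<close>): multiplying the point mass with parameter \<open>n\<close> by \<open>x i\<close> gives
  \<open>n p i / p0\<close> times the point mass with parameter \<open>n + 1\<close> at \<open>x\<close> with coordinate \<open>i\<close> lowered by one.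
  Iterating it computes all first and second moments. Used once for \<open>i\<close> on \<open>X j = b\<close> and once for
  \<open>j\<close> on \<open>X j = b + 1\<close>, it produces the same integral up to the factor \<open>p i / p j\<close>, which is the
  regression formula.
\<close>

section \<open>Multinomial and Vandermonde identities\<close>

text \<open>
  Extensional functions, so that compositions are points of \<^term>\<open>nat_vectors I\<close>.
\<close>

definition compositions :: "'i set \<Rightarrow> nat \<Rightarrow> ('i \<Rightarrow> nat) set" where
  "compositions I m = {x \<in> I \<rightarrow>\<^sub>E UNIV. (\<Sum>i\<in>I. x i) = m}"

text \<open>
  Splitting off the value at one index gives sums over compositions by induction on the index set.
\<close>

lemma compositions_insert:
  assumes "finite I" "i \<notin> I"
  shows "compositions (insert i I) m =
    (\<lambda>(a, x). x(i := a)) ` (SIGMA a:{..m}. compositions I (m - a))"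
proof (intro equalityI subsetI)
  fix x assume x: "x \<in> compositions (insert i I) m"
  have "(\<Sum>j\<in>I. (x(i := undefined)) j) = (\<Sum>j\<in>I. x j)"
    using assms by (intro sum.cong) auto
  then have "(x i, x(i := undefined)) \<in> (SIGMA a:{..m}. compositions I (m - a))"
    using x assms by (auto simp: compositions_def PiE_def extensional_def)
  then show "x \<in> (\<lambda>(a, x). x(i := a)) ` (SIGMA a:{..m}. compositions I (m - a))"
    by (rule rev_image_eqI) simp
next
  fix y assume "y \<in> (\<lambda>(a, x). x(i := a)) ` (SIGMA a:{..m}. compositions I (m - a))"
  then obtain a x where ax: "a \<le> m" "x \<in> compositions I (m - a)" "y = x(i := a)" by auto
  have "(\<Sum>j\<in>I. y j) = (\<Sum>j\<in>I. x j)"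
    using ax assms by (intro sum.cong) auto
  then show "y \<in> compositions (insert i I) m"
    using ax assms by (auto simp: compositions_def PiE_def extensional_def)
qed

lemma inj_on_fun_upd_compositions:
  assumes "i \<notin> I"
  shows "inj_on (\<lambda>(a, x). x(i := a)) (SIGMA a:A. compositions I (c a))"
proof (rule inj_onI, clarify)
  fix a b and x y :: "'a \<Rightarrow> nat"
  assume *: "x \<in> compositions I (c a)" "y \<in> compositions I (c b)" "x(i := a) = y(i := b)"
  then have "a = b" by (metis fun_upd_same)
  moreover have "x j = y j" for j
    using * assms
    by (cases "j = i") (auto simp: compositions_def PiE_def extensional_def dest: fun_cong[of _ _ j])
  ultimately show "a = b \<and> x = y" by auto
qed

lemma finite_compositions: "finite I \<Longrightarrow> finite (compositions I m)"
proof (induction I arbitrary: m rule: finite_induct)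
  case empty
  show ?case by (rule finite_subset[of _ "{\<lambda>_. undefined}"]) (auto simp: compositions_def)
next
  case (insert i I)
  then show ?case by (auto simp: compositions_insert)
qed

lemma sum_compositions_insert:
  fixes f :: "('i \<Rightarrow> nat) \<Rightarrow> real"
  assumes "finite I" "i \<notin> I"
  shows "(\<Sum>x\<in>compositions (insert i I) m. f x)
       = (\<Sum>a\<le>m. \<Sum>x\<in>compositions I (m - a). f (x(i := a)))"
proof -
  have "(\<Sum>x\<in>compositions (insert i I) m. f x)
      = (\<Sum>(a, x)\<in>(SIGMA a:{..m}. compositions I (m - a)). f (x(i := a)))"
    unfolding compositions_insert[OF assms]
    by (subst sum.reindex) (auto intro!: inj_on_fun_upd_compositions assms simp: case_prod_beta)
  also have "\<dots> = (\<Sum>a\<le>m. \<Sum>x\<in>compositions I (m - a). f (x(i := a)))"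
    using assms by (intro sum.Sigma[symmetric]) (auto simp: finite_compositions)
  finally show ?thesis .
qed

lemma prod_fun_upd_insert:
  fixes q :: "'i \<Rightarrow> real"
  assumes "finite I" "i \<notin> I"
  shows "(\<Prod>j\<in>insert i I. q j ^ (x(i := a)) j / fact ((x(i := a)) j))
       = q i ^ a / fact a * (\<Prod>j\<in>I. q j ^ x j / fact (x j))"
proof -
  have "(\<Prod>j\<in>I. q j ^ (x(i := a)) j / fact ((x(i := a)) j)) = (\<Prod>j\<in>I. q j ^ x j / fact (x j))"
    using assms by (intro prod.cong) auto
  then show ?thesis using assms by simp
qed

text \<open>
  In this normalisation (each power divided by a factorial) the theorem says that exponential
  generating functions multiply. The arguments may be negative; this is what makes generating
  functions accessible at negative arguments.
\<close>

theorem multinomial_theorem: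
  fixes q :: "'i \<Rightarrow> real"
  assumes "finite I"
  shows "(\<Sum>x\<in>compositions I m. \<Prod>i\<in>I. q i ^ x i / fact (x i)) = (\<Sum>i\<in>I. q i) ^ m / fact m"
  using assms
proof (induction I arbitrary: m rule: finite_induct)
  case empty
  have "compositions ({} :: 'i set) m = (if m = 0 then {\<lambda>_. undefined} else {})"
    by (auto simp: compositions_def)
  then show ?case by (cases m) simp_all
next
  case (insert i I)
  define Q where "Q = (\<Sum>i\<in>I. q i)"
  have "(\<Sum>x\<in>compositions (insert i I) m. \<Prod>j\<in>insert i I. q j ^ x j / fact (x j))
      = (\<Sum>a\<le>m. q i ^ a / fact a * (Q ^ (m - a) / fact (m - a)))"
    unfolding sum_compositions_insert[OF insert.hyps] prod_fun_upd_insert[OF insert.hyps]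
    by (simp only: sum_distrib_left[symmetric] insert.IH Q_def)
  also have "\<dots> = (\<Sum>a\<le>m. of_nat (m choose a) * q i ^ a * Q ^ (m - a)) / fact m"
    unfolding sum_divide_distrib by (intro sum.cong) (auto simp: binomial_fact)
  also have "\<dots> = (q i + Q) ^ m / fact m"
    by (simp add: binomial_ring)
  finally show ?case using insert.hyps by (simp add: Q_def)
qed

text \<open>
  The part of the multinomial theorem with \<open>x i = a\<close>: the other indices have total \<open>m - a\<close>, and the
  theorem applies to them. It makes coordinates binomial once the total is given.
\<close>

lemma multinomial_theorem_coordinate:
  fixes q :: "'i \<Rightarrow> real"
  assumes "finite I" "i \<in> I"
  shows "(\<Sum>x\<in>compositions I m. (if x i = a then 1 else 0) * (\<Prod>j\<in>I. q j ^ x j / fact (x j)))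
       = real (m choose a) * q i ^ a * ((\<Sum>j\<in>I. q j) - q i) ^ (m - a) / fact m"
proof -
  define K where "K = I - {i}"
  have K: "finite K" "i \<notin> K" "I = insert i K" using assms by (auto simp: K_def)
  have "(\<Sum>x\<in>compositions I m. (if x i = a then 1 else 0) * (\<Prod>j\<in>I. q j ^ x j / fact (x j)))
      = (\<Sum>b\<le>m. \<Sum>x\<in>compositions K (m - b). (if b = a then 1 else 0) *
            (q i ^ b / fact b * (\<Prod>j\<in>K. q j ^ x j / fact (x j))))"
    unfolding K(3) sum_compositions_insert[OF K(1,2)] prod_fun_upd_insert[OF K(1,2)] by simp
  also have "\<dots> = (\<Sum>b\<le>m. (if b = a then 1 else 0) *
            (q i ^ b / fact b * ((\<Sum>j\<in>K. q j) ^ (m - b) / fact (m - b))))"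
    by (simp only: sum_distrib_left[symmetric] multinomial_theorem[OF K(1)])
  also have "\<dots> = (\<Sum>b\<le>m. if b = a then
            q i ^ b / fact b * ((\<Sum>j\<in>K. q j) ^ (m - b) / fact (m - b)) else 0)"
    by (intro sum.cong) auto
  also have "\<dots> = real (m choose a) * q i ^ a * (\<Sum>j\<in>K. q j) ^ (m - a) / fact m"
    by (auto simp: sum.delta' binomial_fact)
  also have "(\<Sum>j\<in>K. q j) = (\<Sum>j\<in>I. q j) - q i" using K by simp
  finally show ?thesis .
qed

lemma sum_binomial_Suc:
  fixes g :: "nat \<Rightarrow> real"
  shows "(\<Sum>a\<le>Suc n. real (Suc n choose a) * g a) = (\<Sum>a\<le>n. real (n choose a) * (g a + g (Suc a)))"
proof -
  have "(\<Sum>a\<le>Suc n. real (Suc n choose a) * g a)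
      = g 0 + (\<Sum>a\<le>n. real (Suc n choose Suc a) * g (Suc a))"
    by (subst sum.atMost_Suc_shift) simp
  also have "\<dots> = (g 0 + (\<Sum>a\<le>n. real (n choose Suc a) * g (Suc a)))
      + (\<Sum>a\<le>n. real (n choose a) * g (Suc a))"
    by (simp add: algebra_simps sum.distrib)
  also have "g 0 + (\<Sum>a\<le>n. real (n choose Suc a) * g (Suc a))
      = (\<Sum>a\<le>Suc n. real (n choose a) * g a)"
    by (subst sum.atMost_Suc_shift) simp
  also have "\<dots> = (\<Sum>a\<le>n. real (n choose a) * g a)" by simp
  finally show ?thesis by (simp add: algebra_simps sum.distrib)
qed

text \<open>
  Vandermonde's identity tested against an arbitrary function of the sum. The function is arbitrary
  because that is the form in which Pascal's rule passes through the induction.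
\<close>

lemma sum_binomial_convolution:
  fixes g :: "nat \<Rightarrow> real"
  shows "(\<Sum>a\<le>A. \<Sum>b\<le>B. real (A choose a) * real (B choose b) * g (a + b))
       = (\<Sum>t\<le>A + B. real ((A + B) choose t) * g t)"
proof (induction A arbitrary: g)
  case (Suc A)
  have "(\<Sum>a\<le>Suc A. \<Sum>b\<le>B. real (Suc A choose a) * real (B choose b) * g (a + b))
      = (\<Sum>a\<le>Suc A. real (Suc A choose a) * (\<Sum>b\<le>B. real (B choose b) * g (a + b)))"
    by (simp add: sum_distrib_left mult.assoc del: binomial_Suc_Suc sum.atMost_Suc)
  also have "\<dots> = (\<Sum>a\<le>A. \<Sum>b\<le>B. real (A choose a) * real (B choose b) * (g (a + b) + g (Suc (a + b))))"
    by (subst sum_binomial_Suc)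
       (simp add: sum_distrib_left mult.assoc sum.distrib algebra_simps)
  also have "\<dots> = (\<Sum>t\<le>A + B. real ((A + B) choose t) * (g t + g (Suc t)))"
    by (rule Suc.IH)
  finally show ?case by (simp only: sum_binomial_Suc[symmetric] add_Suc)
qed simp

text \<open>
  The number of ways to choose \<open>m\<close> objects out of the union of blocks of sizes \<open>x i\<close>, counted by the
  numbers \<open>y i\<close> chosen from each block. This reduces the convolution of negative multinomial laws
  to a sum over one variable.
\<close>

lemma sum_PiE_binomial:
  fixes g :: "nat \<Rightarrow> real"
  assumes "finite I"
  shows "(\<Sum>y\<in>Pi\<^sub>E I (\<lambda>i. {..x i}). (\<Prod>i\<in>I. real (x i choose y i)) * g (\<Sum>i\<in>I. y i))
       = (\<Sum>m\<le>(\<Sum>i\<in>I. x i). real ((\<Sum>i\<in>I. x i) choose m) * g m)"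
  using assms
proof (induction I arbitrary: g rule: finite_induct)
  case (insert i I)
  have eq: "(\<Prod>j\<in>insert i I. real (x j choose (y(i := a)) j)) * g (\<Sum>j\<in>insert i I. (y(i := a)) j)
     = real (x i choose a) * ((\<Prod>j\<in>I. real (x j choose y j)) * g (a + (\<Sum>j\<in>I. y j)))" for y a
  proof -
    have "(\<Prod>j\<in>I. real (x j choose (y(i := a)) j)) = (\<Prod>j\<in>I. real (x j choose y j))"
      "(\<Sum>j\<in>I. (y(i := a)) j) = (\<Sum>j\<in>I. y j)"
      using insert.hyps by (auto intro!: prod.cong sum.cong)
    then show ?thesis using insert.hyps by simp
  qed
  have "(\<Sum>y\<in>Pi\<^sub>E (insert i I) (\<lambda>i. {..x i}).
          (\<Prod>j\<in>insert i I. real (x j choose y j)) * g (\<Sum>j\<in>insert i I. y j))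
      = (\<Sum>(a, y)\<in>{..x i} \<times> Pi\<^sub>E I (\<lambda>i. {..x i}).
          (\<Prod>j\<in>insert i I. real (x j choose (y(i := a)) j)) * g (\<Sum>j\<in>insert i I. (y(i := a)) j))"
    unfolding PiE_insert_eq
    by (subst sum.reindex) (auto intro!: inj_combinator insert.hyps simp: case_prod_beta)
  also have "\<dots> = (\<Sum>a\<le>x i. real (x i choose a) *
      (\<Sum>y\<in>Pi\<^sub>E I (\<lambda>i. {..x i}). (\<Prod>j\<in>I. real (x j choose y j)) * g (a + (\<Sum>j\<in>I. y j))))"
    unfolding eq by (simp add: sum.cartesian_product[symmetric] sum_distrib_left)
  also have "\<dots> = (\<Sum>a\<le>x i. real (x i choose a) *
      (\<Sum>m\<le>(\<Sum>j\<in>I. x j). real ((\<Sum>j\<in>I. x j) choose m) * g (a + m)))"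
    by (simp only: insert.IH[of "\<lambda>m. g (_ + m)"])
  also have "\<dots> = (\<Sum>m\<le>x i + (\<Sum>j\<in>I. x j). real ((x i + (\<Sum>j\<in>I. x j)) choose m) * g m)"
    by (subst sum_binomial_convolution[symmetric]) (simp add: sum_distrib_left mult.assoc)
  finally show ?case using insert.hyps by simp
qed simp

section \<open>Integration over vectors of natural numbers\<close>

lemma countable_nat_vectors: "finite I \<Longrightarrow> countable (I \<rightarrow>\<^sub>E (UNIV :: nat set))"
  by (intro countable_PiE) auto

lemma nn_integral_nat_vectors_union:
  fixes f :: "('i \<Rightarrow> nat) \<Rightarrow> ennreal"
  assumes "finite J" "finite K" "J \<inter> K = {}"
  shows "(\<integral>\<^sup>+x. f x \<partial>nat_vectors (J \<union> K))
    = (\<integral>\<^sup>+y. \<integral>\<^sup>+z. f (merge J K (y, z)) \<partial>nat_vectors K \<partial>nat_vectors J)"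
proof -
  have bij: "bij_betw (merge J K) ((J \<rightarrow>\<^sub>E UNIV) \<times> (K \<rightarrow>\<^sub>E UNIV)) (J \<union> K \<rightarrow>\<^sub>E (UNIV :: nat set))"
    by (rule bij_betwI[where g = "\<lambda>x. (restrict x J, restrict x K)"])
       (use assms in \<open>auto simp: merge_def PiE_def extensional_def restrict_def fun_eq_iff\<close>)
  have "(\<integral>\<^sup>+x. f x \<partial>nat_vectors (J \<union> K))
      = (\<integral>\<^sup>+yz. f (merge J K yz) \<partial>count_space ((J \<rightarrow>\<^sub>E UNIV) \<times> (K \<rightarrow>\<^sub>E UNIV)))"
    by (rule nn_integral_bij_count_space[OF bij, symmetric])
  also have "\<dots> = (\<integral>\<^sup>+yz. f (merge J K yz) \<partial>(nat_vectors J \<Otimes>\<^sub>M nat_vectors K))"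
    using assms by (simp add: pair_measure_countable countable_nat_vectors)
  also have "\<dots> = (\<integral>\<^sup>+y. \<integral>\<^sup>+z. f (merge J K (y, z)) \<partial>nat_vectors K \<partial>nat_vectors J)"
    using assms
    by (intro sigma_finite_measure.nn_integral_fst[symmetric]
          sigma_finite_measure_count_space_countable countable_nat_vectors)
       (simp_all add: pair_measure_countable countable_nat_vectors)
  finally show ?thesis .
qed

lemma nn_integral_nat_vectors_by_total:
  fixes f :: "('i \<Rightarrow> nat) \<Rightarrow> ennreal"
  assumes "finite I"
  shows "(\<integral>\<^sup>+x. f x \<partial>nat_vectors I) = (\<Sum>m. \<Sum>x\<in>compositions I m. f x)"
proof -
  have "(\<integral>\<^sup>+x. f x \<partial>nat_vectors I)
      = (\<integral>\<^sup>+x. (\<Sum>m. f x * indicator {m} (\<Sum>i\<in>I. x i)) \<partial>nat_vectors I)"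
  proof (rule nn_integral_cong)
    fix x
    show "f x = (\<Sum>m. f x * indicator {m} (\<Sum>i\<in>I. x i))"
      by (subst suminf_finite[of "{\<Sum>i\<in>I. x i}"]) (auto simp: indicator_def)
  qed
  also have "\<dots> = (\<Sum>m. \<integral>\<^sup>+x. f x * indicator {m} (\<Sum>i\<in>I. x i) \<partial>nat_vectors I)"
    by (rule nn_integral_suminf) simp
  also have "\<dots> = (\<Sum>m. \<Sum>x\<in>compositions I m. f x)"
  proof (rule suminf_cong)
    fix m
    have "(\<integral>\<^sup>+x. f x * indicator {m} (\<Sum>i\<in>I. x i) \<partial>nat_vectors I)
        = (\<Sum>x\<in>compositions I m. f x * indicator {m} (\<Sum>i\<in>I. x i))"
      using assms
      by (intro nn_integral_count_space') (use finite_compositions[OF assms] in \<open>auto simp: compositions_def\<close>)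
    also have "\<dots> = (\<Sum>x\<in>compositions I m. f x)"
      by (intro sum.cong) (auto simp: compositions_def)
    finally show "(\<integral>\<^sup>+x. f x * indicator {m} (\<Sum>i\<in>I. x i) \<partial>nat_vectors I)
        = (\<Sum>x\<in>compositions I m. f x)" .
  qed
  finally show ?thesis .
qed

text \<open>
  A function of the total sees the vector only through the sum of the parameters. This is the
  integrated form of the multinomial theorem.
\<close>

lemma nn_integral_nat_vectors_total:
  fixes q :: "'i \<Rightarrow> real" and f :: "nat \<Rightarrow> ennreal"
  assumes "finite I" "\<And>i. i \<in> I \<Longrightarrow> 0 \<le> q i"
  shows "(\<integral>\<^sup>+x. f (\<Sum>i\<in>I. x i) * ennreal (\<Prod>i\<in>I. q i ^ x i / fact (x i)) \<partial>nat_vectors I)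
       = (\<Sum>m. f m * ennreal ((\<Sum>i\<in>I. q i) ^ m / fact m))"
  unfolding nn_integral_nat_vectors_by_total[OF assms(1)]
proof (rule suminf_cong)
  fix m
  have "(\<Sum>x\<in>compositions I m. f (\<Sum>i\<in>I. x i) * ennreal (\<Prod>i\<in>I. q i ^ x i / fact (x i)))
      = (\<Sum>x\<in>compositions I m. f m * ennreal (\<Prod>i\<in>I. q i ^ x i / fact (x i)))"
    by (intro sum.cong) (auto simp: compositions_def)
  also have "\<dots> = f m * ennreal (\<Sum>x\<in>compositions I m. \<Prod>i\<in>I. q i ^ x i / fact (x i))"
    using assms by (simp add: sum_distrib_left[symmetric] sum_ennreal prod_nonneg)
  also have "\<dots> = f m * ennreal ((\<Sum>i\<in>I. q i) ^ m / fact m)"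
    by (simp add: multinomial_theorem assms(1))
  finally show "(\<Sum>x\<in>compositions I m. f (\<Sum>i\<in>I. x i) * ennreal (\<Prod>i\<in>I. q i ^ x i / fact (x i)))
      = f m * ennreal ((\<Sum>i\<in>I. q i) ^ m / fact m)" .
qed

text \<open>
  Newton's binomial series with exponent \<open>- n\<close>, written with rising factorials.
\<close>

lemma negative_binomial_series:
  fixes u :: real
  assumes "\<bar>u\<bar> < 1"
  shows "(\<lambda>m. pochhammer (real n) m * (u ^ m / fact m)) sums (1 / (1 - u) ^ n)"
proof -
  have "(\<lambda>m. ((- real n) gchoose m) * (- u) ^ m) sums (1 + (- u)) powr (- real n)"
    using assms by (intro gen_binomial_real) simp
  moreover have "((- real n) gchoose m) * (- u) ^ m = pochhammer (real n) m * (u ^ m / fact m)" for m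
  proof -
    have "(- 1) ^ m * (- u) ^ m = u ^ m" by (simp flip: power_mult_distrib)
    then show ?thesis by (simp add: gbinomial_pochhammer mult_ac)
  qed
  moreover have "(1 + (- u)) powr (- real n) = 1 / (1 - u) ^ n"
    using assms by (simp add: powr_minus powr_realpow divide_inverse)
  ultimately show ?thesis by simp
qed

section \<open>Negative multinomial laws\<close>

definition success_probs :: "'i set \<Rightarrow> ('i \<Rightarrow> real) \<Rightarrow> bool" where
  "success_probs I p \<longleftrightarrow> finite I \<and> (\<forall>i\<in>I. 0 \<le> p i) \<and> (\<Sum>i\<in>I. p i) < 1"

lemma success_probsD:
  assumes "success_probs I p"
  shows "finite I" "\<And>i. i \<in> I \<Longrightarrow> 0 \<le> p i" "(\<Sum>i\<in>I. p i) < 1" "0 \<le> (\<Sum>i\<in>I. p i)"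
    "0 < 1 - (\<Sum>i\<in>I. p i)" "countable (I \<rightarrow>\<^sub>E (UNIV :: nat set))"
  using assms by (auto simp: success_probs_def intro: sum_nonneg countable_nat_vectors)

text \<open>
  The multinomial coefficient is written as a rising factorial divided by factorials. For \<open>n \<ge> 1\<close>
  the two agree, and for \<open>n = 0\<close> the rising factorial vanishes off the origin, so the empty
  sum of independent vectors needs no separate treatment.
\<close>

definition negmult_weight :: "'i set \<Rightarrow> nat \<Rightarrow> ('i \<Rightarrow> real) \<Rightarrow> ('i \<Rightarrow> nat) \<Rightarrow> real" where
  "negmult_weight I n p x = pochhammer (real n) (\<Sum>i\<in>I. x i)
     * (\<Prod>i\<in>I. p i ^ x i / fact (x i)) * (1 - (\<Sum>i\<in>I. p i)) ^ n"

definition negmult :: "'i set \<Rightarrow> nat \<Rightarrow> ('i \<Rightarrow> real) \<Rightarrow> ('i \<Rightarrow> nat) measure" where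
  "negmult I n p = density (nat_vectors I) (\<lambda>x. ennreal (negmult_weight I n p x))"

lemma sets_negmult [simp, measurable_cong]: "sets (negmult I n p) = sets (nat_vectors I)"
  and space_negmult [simp]: "space (negmult I n p) = I \<rightarrow>\<^sub>E UNIV"
  by (simp_all add: negmult_def)

lemma pochhammer_of_nat_nonneg [simp]: "0 \<le> pochhammer (real n) m"
  by (cases n) (auto simp: pochhammer_0_left intro!: pochhammer_pos less_imp_le)

lemma negmult_weight_nonneg:
  "success_probs I p \<Longrightarrow> 0 \<le> negmult_weight I n p x"
  unfolding negmult_weight_def
  by (intro mult_nonneg_nonneg prod_nonneg) (auto simp: success_probs_def)

lemma pochhammer_eq_fact_quotient:
  assumes "n \<ge> 1"
  shows "pochhammer (real n) m = fact (n + m - 1) / fact (n - 1)"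
proof -
  obtain k where k: "n = Suc k" using assms by (cases n) auto
  have "fact (k + m) = (pochhammer 1 (k + m) :: real)" by (simp add: pochhammer_fact)
  also have "\<dots> = fact k * pochhammer (1 + real k) m"
    by (subst pochhammer_product') (simp add: pochhammer_fact[symmetric])
  finally show ?thesis using k by (simp add: field_simps)
qed

lemma pochhammer_eq_multinom:
  assumes "n \<ge> 1"
  shows "pochhammer (real n) (\<Sum>i\<in>I. x i) * (\<Prod>i\<in>I. p i ^ x i / fact (x i))
       = multinom I x (n - 1) * (\<Prod>i\<in>I. p i ^ x i)"
proof -
  have "(\<Sum>i\<in>I. x i) + (n - 1) = n + (\<Sum>i\<in>I. x i) - 1" using assms by simp
  then show ?thesis
    using assms by (simp add: pochhammer_eq_fact_quotient multinom_def prod_dividef)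
qed

lemma NMn_eq_negmult:
  assumes "n \<ge> 1"
  shows "NMn I n p = negmult I n p"
  unfolding NMn_def negmult_def point_measure_def negmult_weight_def
    pochhammer_eq_multinom[OF assms] ..

lemma nn_integral_negmult:
  "(\<integral>\<^sup>+x. f x \<partial>negmult I n p) = (\<integral>\<^sup>+x. ennreal (negmult_weight I n p x) * f x \<partial>nat_vectors I)"
  unfolding negmult_def by (rule nn_integral_density) auto

lemma emeasure_negmult_singleton:
  assumes "x \<in> I \<rightarrow>\<^sub>E UNIV"
  shows "emeasure (negmult I n p) {x} = ennreal (negmult_weight I n p x)"
proof -
  have "emeasure (negmult I n p) {x}
      = (\<integral>\<^sup>+y. ennreal (negmult_weight I n p y) * indicator {x} y \<partial>nat_vectors I)"
    unfolding negmult_def using assms by (intro emeasure_density) auto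
  also have "\<dots> = (\<Sum>y\<in>{x}. ennreal (negmult_weight I n p y) * indicator {x} y)"
    using assms by (intro nn_integral_count_space') auto
  finally show ?thesis by simp
qed

lemma nn_integral_negmult_total:
  assumes "success_probs I p"
  shows "(\<integral>\<^sup>+x. f (\<Sum>i\<in>I. x i) \<partial>negmult I n p)
    = (\<Sum>m. f m * ennreal (pochhammer (real n) m * ((\<Sum>i\<in>I. p i) ^ m / fact m) * (1 - (\<Sum>i\<in>I. p i)) ^ n))"
proof -
  note p = success_probsD[OF assms]
  have "(\<integral>\<^sup>+x. f (\<Sum>i\<in>I. x i) \<partial>negmult I n p)
    = (\<integral>\<^sup>+x. (\<lambda>m. f m * ennreal (pochhammer (real n) m * (1 - (\<Sum>i\<in>I. p i)) ^ n)) (\<Sum>i\<in>I. x i)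
        * ennreal (\<Prod>i\<in>I. p i ^ x i / fact (x i)) \<partial>nat_vectors I)"
    unfolding nn_integral_negmult
    by (intro nn_integral_cong)
       (use p in \<open>simp add: negmult_weight_def ennreal_mult prod_nonneg mult_ac\<close>)
  also have "\<dots> = (\<Sum>m. f m * ennreal (pochhammer (real n) m * (1 - (\<Sum>i\<in>I. p i)) ^ n)
        * ennreal ((\<Sum>i\<in>I. p i) ^ m / fact m))"
    using p by (intro nn_integral_nat_vectors_total)
  also have "\<dots> = (\<Sum>m. f m * ennreal (pochhammer (real n) m * ((\<Sum>i\<in>I. p i) ^ m / fact m) * (1 - (\<Sum>i\<in>I. p i)) ^ n))"
    using p by (intro suminf_cong) (simp add: ennreal_mult[symmetric] mult_ac)
  finally show ?thesis .
qed

lemma prob_space_negmult: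
  assumes "success_probs I p"
  shows "prob_space (negmult I n p)"
proof (rule prob_spaceI)
  note p = success_probsD[OF assms]
  define P where "P = (\<Sum>i\<in>I. p i)"
  have P: "0 \<le> P" "P < 1" using p by (auto simp: P_def)
  have "(\<lambda>m. pochhammer (real n) m * (P ^ m / fact m) * (1 - P) ^ n) sums (1 / (1 - P) ^ n * (1 - P) ^ n)"
    using P by (intro sums_mult2 negative_binomial_series) auto
  then have "(\<Sum>m. ennreal (pochhammer (real n) m * (P ^ m / fact m) * (1 - P) ^ n))
      = ennreal (1 / (1 - P) ^ n * (1 - P) ^ n)"
    using P by (intro suminf_ennreal_eq) auto
  then have "(\<integral>\<^sup>+x. 1 \<partial>negmult I n p) = 1"
    using nn_integral_negmult_total[OF assms, where f = "\<lambda>_. 1" and n = n] P unfolding P_def[symmetric] by simp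
  then show "emeasure (negmult I n p) (space (negmult I n p)) = 1" by simp
qed

lemma nn_integral_negmult_0:
  assumes "finite I"
  shows "(\<integral>\<^sup>+x. f x \<partial>negmult I 0 p) = f (\<lambda>i\<in>I. 0)"
proof -
  have "(\<integral>\<^sup>+x. f x \<partial>negmult I 0 p)
      = (\<Sum>x\<in>{\<lambda>i\<in>I. 0}. ennreal (negmult_weight I 0 p x) * f x)"
    unfolding nn_integral_negmult
  proof (rule nn_integral_count_space')
    fix x :: "'a \<Rightarrow> nat" assume x: "x \<in> I \<rightarrow>\<^sub>E UNIV" "x \<notin> {\<lambda>i\<in>I. 0}"
    have "\<exists>i\<in>I. x i \<noteq> 0"
      using x by (auto simp: fun_eq_iff PiE_def extensional_def split: if_splits)
    then have "(\<Sum>i\<in>I. x i) \<noteq> 0" using assms by simp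
    then show "ennreal (negmult_weight I 0 p x) * f x = 0"
      by (simp add: negmult_weight_def pochhammer_0_left)
  qed auto
  then show ?thesis by (simp add: negmult_weight_def)
qed

text \<open>
  Binomial coefficients turn the product of the two weights into a function of \<open>|y|\<close>, the sum over
  \<open>y\<close> collapses to one over \<open>|y|\<close>, and what is left is the Vandermonde identity for
  \<^term>\<open>pochhammer\<close>.
\<close>

lemma negmult_weight_add:
  assumes "finite I"
  shows "negmult_weight I (a + b) p x
    = (\<Sum>y\<in>Pi\<^sub>E I (\<lambda>i. {..x i}). negmult_weight I a p y * negmult_weight I b p (\<lambda>i\<in>I. x i - y i))"
proof -
  define C where "C = (\<Prod>i\<in>I. p i ^ x i / fact (x i)) * (1 - (\<Sum>i\<in>I. p i)) ^ (a + b)"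
  define S where "S = (\<Sum>i\<in>I. x i)"
  \<comment> \<open>the part of the product that depends on \<open>y\<close> through its total only\<close>
  define g where "g m = pochhammer (real a) m * pochhammer (real b) (S - m)" for m
  have "negmult_weight I a p y * negmult_weight I b p (\<lambda>i\<in>I. x i - y i)
      = C * ((\<Prod>i\<in>I. real (x i choose y i)) * g (\<Sum>i\<in>I. y i))"
    if y: "y \<in> Pi\<^sub>E I (\<lambda>i. {..x i})" for y
  proof -
    have le: "y i \<le> x i" if "i \<in> I" for i using y that by auto
    have "(\<Sum>i\<in>I. (\<lambda>i\<in>I. x i - y i) i) = S - (\<Sum>i\<in>I. y i)"
      using le by (simp add: S_def sum_subtractf_nat)
    moreover have "(\<Prod>i\<in>I. p i ^ y i / fact (y i)) *
        (\<Prod>i\<in>I. p i ^ ((\<lambda>i\<in>I. x i - y i) i) / fact ((\<lambda>i\<in>I. x i - y i) i))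
      = (\<Prod>i\<in>I. p i ^ x i / fact (x i)) * (\<Prod>i\<in>I. real (x i choose y i))"
      unfolding prod.distrib[symmetric]
    proof (rule prod.cong[OF refl])
      fix i assume i: "i \<in> I"
      have "p i ^ x i = p i ^ y i * p i ^ (x i - y i)"
        using le[OF i] by (simp flip: power_add)
      then show "p i ^ y i / fact (y i) * (p i ^ ((\<lambda>i\<in>I. x i - y i) i) / fact ((\<lambda>i\<in>I. x i - y i) i))
         = p i ^ x i / fact (x i) * real (x i choose y i)"
        using i le[OF i] by (simp add: binomial_fact)
    qed
    ultimately show ?thesis
      unfolding negmult_weight_def C_def g_def by (simp add: power_add mult_ac)
  qed
  then have "(\<Sum>y\<in>Pi\<^sub>E I (\<lambda>i. {..x i}). negmult_weight I a p y * negmult_weight I b p (\<lambda>i\<in>I. x i - y i))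
      = C * (\<Sum>y\<in>Pi\<^sub>E I (\<lambda>i. {..x i}). (\<Prod>i\<in>I. real (x i choose y i)) * g (\<Sum>i\<in>I. y i))"
    by (simp add: sum_distrib_left)
  also have "\<dots> = C * (\<Sum>m\<le>S. real (S choose m) * g m)"
    unfolding S_def by (simp only: sum_PiE_binomial[OF assms])
  also have "\<dots> = C * pochhammer (real (a + b)) S"
    by (simp add: pochhammer_binomial_sum g_def mult.assoc)
  finally show ?thesis by (simp add: negmult_weight_def C_def S_def mult_ac)
qed

text \<open>
  The laws form a convolution semigroup in the first parameter.
\<close>

lemma nn_integral_negmult_add:
  fixes f :: "('i \<Rightarrow> nat) \<Rightarrow> ennreal"
  assumes "success_probs I p"
  shows "(\<integral>\<^sup>+y. \<integral>\<^sup>+z. f (\<lambda>i\<in>I. y i + z i) \<partial>negmult I b p \<partial>negmult I a p)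
       = (\<integral>\<^sup>+x. f x \<partial>negmult I (a + b) p)"
proof -
  note p = success_probsD[OF assms] and nonneg = negmult_weight_nonneg[OF assms]
  let ?A = "I \<rightarrow>\<^sub>E (UNIV :: nat set)"
  let ?W = "\<lambda>n x. ennreal (negmult_weight I n p x)"
  have "(\<integral>\<^sup>+z. f (\<lambda>i\<in>I. y i + z i) \<partial>negmult I b p)
      = (\<integral>\<^sup>+x. ?W b (\<lambda>i\<in>I. x i - y i) * f x * indicator {x. \<forall>i\<in>I. y i \<le> x i} x \<partial>nat_vectors I)" for y
  proof -
    \<comment> \<open>substitute \<open>x = y + z\<close>; the range of the substitution is the set of \<open>x\<close> above \<open>y\<close>\<close>
    have bij: "bij_betw (\<lambda>z. \<lambda>i\<in>I. y i + z i) ?A {x \<in> ?A. \<forall>i\<in>I. y i \<le> x i}"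
      by (rule bij_betwI[where g = "\<lambda>x. \<lambda>i\<in>I. x i - y i"])
         (auto simp: fun_eq_iff PiE_def extensional_def)
    have "(\<integral>\<^sup>+z. f (\<lambda>i\<in>I. y i + z i) \<partial>negmult I b p)
        = (\<integral>\<^sup>+z. (\<lambda>x. ?W b (\<lambda>i\<in>I. x i - y i) * f x) (\<lambda>i\<in>I. y i + z i) \<partial>nat_vectors I)"
      unfolding nn_integral_negmult
    proof (rule nn_integral_cong)
      fix z assume "z \<in> space (nat_vectors I)"
      then have "(\<lambda>i\<in>I. (\<lambda>i\<in>I. y i + z i) i - y i) = z"
        by (auto simp: fun_eq_iff PiE_def extensional_def)
      then show "?W b z * f (\<lambda>i\<in>I. y i + z i)
          = ?W b (\<lambda>i\<in>I. (\<lambda>i\<in>I. y i + z i) i - y i) * f (\<lambda>i\<in>I. y i + z i)" by simp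
    qed
    also have "\<dots> = (\<integral>\<^sup>+x. ?W b (\<lambda>i\<in>I. x i - y i) * f x \<partial>count_space {x \<in> ?A. \<forall>i\<in>I. y i \<le> x i})"
      by (rule nn_integral_bij_count_space[OF bij])
    also have "\<dots> = (\<integral>\<^sup>+x. ?W b (\<lambda>i\<in>I. x i - y i) * f x * indicator {x. \<forall>i\<in>I. y i \<le> x i} x
        \<partial>nat_vectors I)"
      by (subst (1 2) nn_integral_count_space_indicator) (auto intro!: nn_integral_cong simp: indicator_def)
    finally show ?thesis .
  qed
  then have "(\<integral>\<^sup>+y. \<integral>\<^sup>+z. f (\<lambda>i\<in>I. y i + z i) \<partial>negmult I b p \<partial>negmult I a p)
      = (\<integral>\<^sup>+y. \<integral>\<^sup>+x. ?W a y * (?W b (\<lambda>i\<in>I. x i - y i) * f x * indicator {x. \<forall>i\<in>I. y i \<le> x i} x)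
           \<partial>nat_vectors I \<partial>nat_vectors I)"
    by (simp add: nn_integral_negmult[where n = a] nn_integral_cmult)
  also have "\<dots> = (\<integral>\<^sup>+x. \<integral>\<^sup>+y. ?W a y * (?W b (\<lambda>i\<in>I. x i - y i) * f x * indicator {x. \<forall>i\<in>I. y i \<le> x i} x)
           \<partial>nat_vectors I \<partial>nat_vectors I)"
  proof -
    interpret pair_sigma_finite "nat_vectors I" "nat_vectors I"
      unfolding pair_sigma_finite_def
      using p by (auto intro: sigma_finite_measure_count_space_countable)
    show ?thesis
      by (rule Fubini'[symmetric]) (simp add: pair_measure_countable p)
  qed
  also have "\<dots> = (\<integral>\<^sup>+x. ?W (a + b) x * f x \<partial>nat_vectors I)"
  proof (rule nn_integral_cong)
    fix x
    have "(\<integral>\<^sup>+y. ?W a y * (?W b (\<lambda>i\<in>I. x i - y i) * f x * indicator {x. \<forall>i\<in>I. y i \<le> x i} x) \<partial>nat_vectors I)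
        = (\<Sum>y\<in>Pi\<^sub>E I (\<lambda>i. {..x i}).
            ?W a y * (?W b (\<lambda>i\<in>I. x i - y i) * f x * indicator {x. \<forall>i\<in>I. y i \<le> x i} x))"
      using p by (intro nn_integral_count_space' finite_PiE) (auto simp: indicator_def PiE_def Pi_def)
    also have "\<dots> = (\<Sum>y\<in>Pi\<^sub>E I (\<lambda>i. {..x i}).
            ennreal (negmult_weight I a p y * negmult_weight I b p (\<lambda>i\<in>I. x i - y i))) * f x"
      unfolding sum_distrib_right
      by (rule sum.cong)
         (auto simp: indicator_def PiE_def Pi_def ennreal_mult nonneg mult_ac)
    also have "\<dots> = ?W (a + b) x * f x"
      using nonneg by (subst sum_ennreal) (auto simp: negmult_weight_add p)
    finally show "(\<integral>\<^sup>+y. ?W a y * (?W b (\<lambda>i\<in>I. x i - y i) * f x * indicator {x. \<forall>i\<in>I. y i \<le> x i} x)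
        \<partial>nat_vectors I) = ?W (a + b) x * f x" .
  qed
  finally show ?thesis by (simp add: nn_integral_negmult)
qed

text \<open>
  Integrating out the coordinates outside \<open>J\<close>, with total \<open>m\<close>, splits the rising factorial at
  \<open>S = |y|\<close> and leaves a negative binomial series with exponent \<open>n + S\<close>. Its value
  \<open>1 / D ^ (n + S)\<close> is absorbed by dividing each remaining parameter, and \<open>p0\<close>, by \<open>D\<close>.
\<close>

lemma nn_integral_negmult_marginal_subset:
  assumes "success_probs I p" "J \<subseteq> I"
  defines "D \<equiv> 1 - (\<Sum>i\<in>I. p i) + (\<Sum>i\<in>J. p i)"
  shows "(\<integral>\<^sup>+x. f (restrict x J) \<partial>negmult I n p) = (\<integral>\<^sup>+x. f x \<partial>negmult J n (\<lambda>i. p i / D))"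
proof -
  note p = success_probsD[OF assms(1)]
  define K where "K = I - J"
  define p0 where "p0 = 1 - (\<Sum>i\<in>I. p i)"
  have JK: "finite J" "finite K" "J \<inter> K = {}" "I = J \<union> K"
    using assms(2) p(1) by (auto simp: K_def intro: finite_subset)
  have sum_union: "(\<Sum>i\<in>I. g i) = (\<Sum>i\<in>J. g i) + (\<Sum>i\<in>K. g i)" for g :: "'a \<Rightarrow> 'b::comm_monoid_add"
    unfolding JK(4) using JK by (intro sum.union_disjoint)
  define Q where "Q = (\<Sum>i\<in>K. p i)"
  have D: "D = 1 - Q" unfolding D_def sum_union Q_def by simp
  have p0: "0 < p0" using p by (simp add: p0_def)
  have Jnn: "0 \<le> (\<Sum>i\<in>J. p i)" using p JK by (intro sum_nonneg) auto
  have Q: "0 \<le> Q" "Q < 1"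
    using p(3) Jnn p JK unfolding sum_union Q_def by (auto intro: sum_nonneg)
  have D0: "0 < D" using Q D by simp
  have rho0: "1 - (\<Sum>i\<in>J. p i / D) = p0 / D"
    using D0 by (simp add: sum_divide_distrib[symmetric] p0_def D_def field_simps)
  have inner: "(\<integral>\<^sup>+z. ennreal (negmult_weight I n p (merge J K (y, z))) \<partial>nat_vectors K)
      = ennreal (negmult_weight J n (\<lambda>i. p i / D) y)" for y
  proof -
    define S where "S = (\<Sum>i\<in>J. y i)"
    define c where "c = (\<Prod>i\<in>J. p i ^ y i / fact (y i)) * p0 ^ n"
    have c: "0 \<le> c" using p JK p0 by (auto simp: c_def intro!: mult_nonneg_nonneg prod_nonneg)
    have "negmult_weight I n p (merge J K (y, z))
        = c * pochhammer (real n) (S + (\<Sum>i\<in>K. z i)) * (\<Prod>i\<in>K. p i ^ z i / fact (z i))" for z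
    proof -
      have "(\<Sum>i\<in>I. merge J K (y, z) i) = S + (\<Sum>i\<in>K. z i)"
        unfolding sum_union S_def using JK(3)
        by (intro arg_cong2[of _ _ _ _ "(+)"] sum.cong) (auto simp: merge_def)
      moreover have "(\<Prod>i\<in>I. p i ^ merge J K (y, z) i / fact (merge J K (y, z) i))
          = (\<Prod>i\<in>J. p i ^ y i / fact (y i)) * (\<Prod>i\<in>K. p i ^ z i / fact (z i))"
        unfolding JK(4) prod.union_disjoint[OF JK(1-3)] using JK(3)
        by (intro arg_cong2[of _ _ _ _ "(*)"] prod.cong) (auto simp: merge_def)
      ultimately show ?thesis by (simp add: negmult_weight_def c_def p0_def mult_ac)
    qed
    then have "(\<integral>\<^sup>+z. ennreal (negmult_weight I n p (merge J K (y, z))) \<partial>nat_vectors K)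
        = (\<integral>\<^sup>+z. (\<lambda>m. ennreal (c * pochhammer (real n) (S + m))) (\<Sum>i\<in>K. z i)
            * ennreal (\<Prod>i\<in>K. p i ^ z i / fact (z i)) \<partial>nat_vectors K)"
      using c p JK by (simp add: ennreal_mult prod_nonneg)
    also have "\<dots> = (\<Sum>m. ennreal (c * pochhammer (real n) (S + m)) * ennreal (Q ^ m / fact m))"
      unfolding Q_def using p JK by (intro nn_integral_nat_vectors_total) auto
    also have "\<dots> = (\<Sum>m. ennreal (c * pochhammer (real n) S * (pochhammer (real (n + S)) m * (Q ^ m / fact m))))"
    proof (rule suminf_cong)
      fix m
      show "ennreal (c * pochhammer (real n) (S + m)) * ennreal (Q ^ m / fact m)
          = ennreal (c * pochhammer (real n) S * (pochhammer (real (n + S)) m * (Q ^ m / fact m)))"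
      proof (subst ennreal_mult[symmetric])
        show "0 \<le> c * pochhammer (real n) (S + m)" "0 \<le> Q ^ m / fact m"
          using c Q by simp_all
      qed (simp add: pochhammer_product' mult.assoc)
    qed
    also have "\<dots> = ennreal (c * pochhammer (real n) S * (1 / (1 - Q) ^ (n + S)))"
      using c Q by (intro suminf_ennreal_eq sums_mult negative_binomial_series mult_nonneg_nonneg)
         (auto simp del: of_nat_add)
    also have "c * pochhammer (real n) S * (1 / (1 - Q) ^ (n + S)) = negmult_weight J n (\<lambda>i. p i / D) y"
      unfolding negmult_weight_def rho0 c_def S_def D[symmetric]
      by (simp add: power_divide prod_dividef prod.distrib power_add power_sum field_simps)
    finally show ?thesis .
  qed
  have "(\<integral>\<^sup>+x. f (restrict x J) \<partial>negmult I n p)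
      = (\<integral>\<^sup>+y. \<integral>\<^sup>+z. ennreal (negmult_weight I n p (merge J K (y, z))) * f (restrict (merge J K (y, z)) J)
          \<partial>nat_vectors K \<partial>nat_vectors J)"
    unfolding nn_integral_negmult
    using nn_integral_nat_vectors_union[OF JK(1-3)] JK(4) by simp
  also have "\<dots> = (\<integral>\<^sup>+y. (\<integral>\<^sup>+z. ennreal (negmult_weight I n p (merge J K (y, z))) \<partial>nat_vectors K) * f y
          \<partial>nat_vectors J)"
  proof (rule nn_integral_cong)
    fix y assume "y \<in> space (nat_vectors J)"
    then have "restrict (merge J K (y, z)) J = y" for z
      by (auto simp: fun_eq_iff merge_def PiE_def extensional_def)
    then show "(\<integral>\<^sup>+z. ennreal (negmult_weight I n p (merge J K (y, z))) * f (restrict (merge J K (y, z)) J) \<partial>nat_vectors K)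
      = (\<integral>\<^sup>+z. ennreal (negmult_weight I n p (merge J K (y, z))) \<partial>nat_vectors K) * f y"
      by (simp add: nn_integral_multc)
  qed
  finally show ?thesis unfolding inner by (simp add: nn_integral_negmult)
qed

lemma nn_integral_negmult_reindex:
  assumes "inj_on \<iota> J"
  shows "(\<integral>\<^sup>+x. f (\<lambda>m\<in>J. x (\<iota> m)) \<partial>negmult (\<iota> ` J) n p) = (\<integral>\<^sup>+x. f x \<partial>negmult J n (\<lambda>m. p (\<iota> m)))"
proof -
  have bij: "bij_betw (\<lambda>x. \<lambda>m\<in>J. x (\<iota> m)) (\<iota> ` J \<rightarrow>\<^sub>E (UNIV :: nat set)) (J \<rightarrow>\<^sub>E UNIV)"
    by (rule bij_betwI[where g = "\<lambda>x. \<lambda>i\<in>\<iota> ` J. x (the_inv_into J \<iota> i)"])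
       (use assms in \<open>auto simp: fun_eq_iff PiE_def extensional_def the_inv_into_f_f\<close>)
  have "negmult_weight (\<iota> ` J) n p x = negmult_weight J n (\<lambda>m. p (\<iota> m)) (\<lambda>m\<in>J. x (\<iota> m))" for x
    using assms by (simp add: negmult_weight_def sum.reindex prod.reindex cong: prod.cong)
  then show ?thesis
    unfolding nn_integral_negmult nn_integral_bij_count_space[OF bij, symmetric] by simp
qed

lemma nn_integral_negmult_marginal:
  assumes "success_probs I p" "inj_on \<iota> J" "\<iota> ` J \<subseteq> I"
  defines "D \<equiv> 1 - (\<Sum>i\<in>I. p i) + (\<Sum>m\<in>J. p (\<iota> m))"
  shows "(\<integral>\<^sup>+x. f (\<lambda>m\<in>J. x (\<iota> m)) \<partial>negmult I n p) = (\<integral>\<^sup>+x. f x \<partial>negmult J n (\<lambda>m. p (\<iota> m) / D))"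
proof -
  have D: "D = 1 - (\<Sum>i\<in>I. p i) + (\<Sum>i\<in>\<iota> ` J. p i)"
    using assms(2) by (simp add: D_def sum.reindex)
  have "(\<lambda>m\<in>J. restrict x (\<iota> ` J) (\<iota> m)) = (\<lambda>m\<in>J. x (\<iota> m))" for x :: "'a \<Rightarrow> nat"
    by (simp add: fun_eq_iff)
  then have "(\<integral>\<^sup>+x. f (\<lambda>m\<in>J. x (\<iota> m)) \<partial>negmult I n p)
      = (\<integral>\<^sup>+x. (\<lambda>x. f (\<lambda>m\<in>J. x (\<iota> m))) (restrict x (\<iota> ` J)) \<partial>negmult I n p)" by simp
  also have "\<dots> = (\<integral>\<^sup>+x. f (\<lambda>m\<in>J. x (\<iota> m)) \<partial>negmult (\<iota> ` J) n (\<lambda>i. p i / D))"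
    unfolding D by (rule nn_integral_negmult_marginal_subset[OF assms(1,3)])
  also have "\<dots> = (\<integral>\<^sup>+x. f x \<partial>negmult J n (\<lambda>m. p (\<iota> m) / D))"
    by (rule nn_integral_negmult_reindex[OF assms(2)])
  finally show ?thesis .
qed

lemma success_probs_marginal:
  assumes "success_probs I p" "inj_on \<iota> J" "\<iota> ` J \<subseteq> I"
  defines "D \<equiv> 1 - (\<Sum>i\<in>I. p i) + (\<Sum>m\<in>J. p (\<iota> m))"
  shows "success_probs J (\<lambda>m. p (\<iota> m) / D)"
    and "1 - (\<Sum>m\<in>J. p (\<iota> m) / D) = (1 - (\<Sum>i\<in>I. p i)) / D"
    and "0 < D"
proof -
  note p = success_probsD[OF assms(1)]
  have fin: "finite J" using assms(2,3) p(1) finite_imageD finite_subset by metis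
  have nn: "0 \<le> p (\<iota> m)" if "m \<in> J" for m using p(2) assms(3) that by auto
  then have D0: "0 < D" using p(5) by (auto simp: D_def intro!: add_pos_nonneg sum_nonneg)
  show "0 < D" by fact
  show *: "1 - (\<Sum>m\<in>J. p (\<iota> m) / D) = (1 - (\<Sum>i\<in>I. p i)) / D"
    using D0 by (simp add: sum_divide_distrib[symmetric] D_def field_simps)
  have "0 < (1 - (\<Sum>i\<in>I. p i)) / D" using D0 p(5) by simp
  then have "(\<Sum>m\<in>J. p (\<iota> m) / D) < 1" using * by linarith
  then show "success_probs J (\<lambda>m. p (\<iota> m) / D)"
    using fin nn D0 by (simp add: success_probs_def)
qed

lemma success_probs_total:
  "success_probs I p \<Longrightarrow> success_probs {a} (\<lambda>_. \<Sum>i\<in>I. p i)"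
  by (auto simp: success_probs_def intro: sum_nonneg)

text \<open>
  Both sides integrate a function of the total, and both laws have the same sum of parameters.
\<close>

lemma nn_integral_negmult_sum:
  assumes "success_probs I p"
  shows "(\<integral>\<^sup>+x. f (\<lambda>_\<in>{a}. \<Sum>i\<in>I. x i) \<partial>negmult I n p)
       = (\<integral>\<^sup>+x. f x \<partial>negmult {a} n (\<lambda>_. \<Sum>i\<in>I. p i))"
proof -
  have "(\<integral>\<^sup>+x. f x \<partial>negmult {a} n (\<lambda>_. \<Sum>i\<in>I. p i))
      = (\<integral>\<^sup>+x. f (\<lambda>_\<in>{a}. \<Sum>i\<in>{a}. x i) \<partial>negmult {a} n (\<lambda>_. \<Sum>i\<in>I. p i))"
    by (intro nn_integral_cong arg_cong[of _ _ f]) (auto simp: fun_eq_iff PiE_def extensional_def)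
  then show ?thesis
    using nn_integral_negmult_total[OF assms, where f = "\<lambda>m. f (\<lambda>_\<in>{a}. m)" and n = n]
      nn_integral_negmult_total[OF success_probs_total[OF assms, of a], where f = "\<lambda>m. f (\<lambda>_\<in>{a}. m)" and n = n]
    by simp
qed

text \<open>
  Grouping by the total leaves finite sums, in which real identities such as
  \<open>multinomial_theorem\<close> can be used for signed terms.
\<close>

lemma nn_integral_negmult_compositions:
  assumes "success_probs I p" "\<And>x. 0 \<le> f x"
  shows "(\<integral>\<^sup>+x. ennreal (f x) \<partial>negmult I n p)
    = (\<Sum>j. ennreal (pochhammer (real n) j * (1 - (\<Sum>i\<in>I. p i)) ^ n
        * (\<Sum>x\<in>compositions I j. f x * (\<Prod>i\<in>I. p i ^ x i / fact (x i)))))"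
  unfolding nn_integral_negmult nn_integral_nat_vectors_by_total[OF success_probsD(1)[OF assms(1)]]
proof (rule suminf_cong)
  note p = success_probsD[OF assms(1)]
  fix j
  have "(\<Sum>x\<in>compositions I j. ennreal (negmult_weight I n p x) * ennreal (f x))
      = (\<Sum>x\<in>compositions I j. ennreal (pochhammer (real n) j * (1 - (\<Sum>i\<in>I. p i)) ^ n *
       (f x * (\<Prod>i\<in>I. p i ^ x i / fact (x i)))))"
  proof (rule sum.cong[OF refl])
    fix x assume "x \<in> compositions I j"
    then have j: "(\<Sum>i\<in>I. x i) = j" by (simp add: compositions_def)
    have "ennreal (negmult_weight I n p x) * ennreal (f x) = ennreal (negmult_weight I n p x * f x)"
      using negmult_weight_nonneg[OF assms(1)] assms(2) by (simp add: ennreal_mult)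
    also have "negmult_weight I n p x * f x = pochhammer (real n) j * (1 - (\<Sum>i\<in>I. p i)) ^ n *
       (f x * (\<Prod>i\<in>I. p i ^ x i / fact (x i)))"
      by (simp add: negmult_weight_def j mult_ac)
    finally show "ennreal (negmult_weight I n p x) * ennreal (f x)
      = ennreal (pochhammer (real n) j * (1 - (\<Sum>i\<in>I. p i)) ^ n *
       (f x * (\<Prod>i\<in>I. p i ^ x i / fact (x i))))" .
  qed
  also have "\<dots> = ennreal (\<Sum>x\<in>compositions I j. pochhammer (real n) j * (1 - (\<Sum>i\<in>I. p i)) ^ n *
       (f x * (\<Prod>i\<in>I. p i ^ x i / fact (x i))))"
    using assms p by (intro sum_ennreal mult_nonneg_nonneg prod_nonneg) auto
  finally show "(\<Sum>x\<in>compositions I j. ennreal (negmult_weight I n p x) * ennreal (f x))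
      = ennreal (pochhammer (real n) j * (1 - (\<Sum>i\<in>I. p i)) ^ n
        * (\<Sum>x\<in>compositions I j. f x * (\<Prod>i\<in>I. p i ^ x i / fact (x i))))"
    by (simp add: sum_distrib_left)
qed

text \<open>
  The factor \<open>x i\<close> cancels one factor of \<open>fact (x i)\<close>, and the first factor \<open>n\<close> of the rising
  factorial comes out; what remains is the weight with parameter \<open>n + 1\<close> at the vector with
  coordinate \<open>i\<close> lowered by one. This identity replaces all moment computations.
\<close>

lemma nn_integral_negmult_size_bias:
  assumes "success_probs I p" "i \<in> I"
  shows "(\<integral>\<^sup>+x. of_nat (x i) * f x \<partial>negmult I n p)
    = ennreal (real n * (p i / (1 - (\<Sum>i\<in>I. p i)))) * (\<integral>\<^sup>+x. f (x(i := Suc (x i))) \<partial>negmult I (Suc n) p)"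
proof -
  note p = success_probsD[OF assms(1)] and nonneg = negmult_weight_nonneg[OF assms(1)]
  let ?A = "I \<rightarrow>\<^sub>E (UNIV :: nat set)"
  define p0 where "p0 = 1 - (\<Sum>i\<in>I. p i)"
  define K where "K = I - {i}"
  have K: "finite K" "i \<notin> K" "I = insert i K" using assms p(1) by (auto simp: K_def)
  have bij: "bij_betw (\<lambda>x. x(i := Suc (x i))) ?A {x \<in> ?A. 1 \<le> x i}"
    by (rule bij_betwI[where g = "\<lambda>x. x(i := x i - 1)"])
       (use assms(2) in \<open>auto simp: fun_eq_iff PiE_def extensional_def\<close>)
  have step: "real (Suc (x i)) * negmult_weight I n p (x(i := Suc (x i)))
      = real n * (p i / p0) * negmult_weight I (Suc n) p x" for x
  proof -
    have s: "(\<Sum>j\<in>K. (x(i := Suc (x i))) j) = (\<Sum>j\<in>K. x j)"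
      using K by (intro sum.cong) auto
    have pr: "(\<Prod>j\<in>I. p j ^ (x(i := Suc (x i))) j / fact ((x(i := Suc (x i))) j))
        = p i ^ Suc (x i) / fact (Suc (x i)) * (\<Prod>j\<in>K. p j ^ x j / fact (x j))"
      unfolding K(3) by (rule prod_fun_upd_insert[OF K(1,2)])
    have pr': "(\<Prod>j\<in>I. p j ^ x j / fact (x j)) = p i ^ x i / fact (x i) * (\<Prod>j\<in>K. p j ^ x j / fact (x j))"
      using K by simp
    have tot: "(\<Sum>j\<in>I. (x(i := Suc (x i))) j) = Suc (\<Sum>j\<in>I. x j)"
      using K s by simp
    have po: "pochhammer (real n) (Suc (\<Sum>j\<in>I. x j)) = real n * pochhammer (real (Suc n)) (\<Sum>j\<in>I. x j)"
      by (simp add: pochhammer_rec add.commute)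
    have p0: "p0 \<noteq> 0" using p(5) by (simp add: p0_def)
    show ?thesis
      unfolding negmult_weight_def tot po pr pr' p0_def[symmetric]
      using p0 by (simp add: field_simps del: of_nat_Suc)
  qed
  have "(\<integral>\<^sup>+x. of_nat (x i) * f x \<partial>negmult I n p)
      = (\<integral>\<^sup>+x. ennreal (negmult_weight I n p x) * (of_nat (x i) * f x) \<partial>count_space {x \<in> ?A. 1 \<le> x i})"
    unfolding nn_integral_negmult
    by (subst (1 2) nn_integral_count_space_indicator) (auto intro!: nn_integral_cong simp: indicator_def)
  also have "\<dots> = (\<integral>\<^sup>+x. ennreal (negmult_weight I n p (x(i := Suc (x i)))) * (of_nat (Suc (x i)) * f (x(i := Suc (x i)))) \<partial>nat_vectors I)"
    using nn_integral_bij_count_space[OF bij, symmetric] by simp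
  also have "\<dots> = (\<integral>\<^sup>+x. ennreal (real n * (p i / p0)) * (ennreal (negmult_weight I (Suc n) p x) * f (x(i := Suc (x i)))) \<partial>nat_vectors I)"
  proof (rule nn_integral_cong)
    fix x
    have "ennreal (negmult_weight I n p (x(i := Suc (x i)))) * of_nat (Suc (x i))
        = ennreal (real (Suc (x i)) * negmult_weight I n p (x(i := Suc (x i))))"
      by (simp only: ennreal_mult[OF of_nat_0_le_iff nonneg] ennreal_of_nat_eq_real_of_nat mult.commute)
    also have "\<dots> = ennreal (real n * (p i / p0)) * ennreal (negmult_weight I (Suc n) p x)"
      unfolding step using nonneg p assms(2) by (intro ennreal_mult) (auto simp: p0_def)
    finally show "ennreal (negmult_weight I n p (x(i := Suc (x i)))) * (of_nat (Suc (x i)) * f (x(i := Suc (x i))))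
        = ennreal (real n * (p i / p0)) * (ennreal (negmult_weight I (Suc n) p x) * f (x(i := Suc (x i))))"
      by (simp only: mult.assoc[symmetric])
  qed
  also have "\<dots> = ennreal (real n * (p i / p0)) * (\<integral>\<^sup>+x. f (x(i := Suc (x i))) \<partial>negmult I (Suc n) p)"
    unfolding nn_integral_negmult by (rule nn_integral_cmult) simp
  finally show ?thesis by (simp add: p0_def)
qed

text \<open>
  Given the total \<open>j\<close>, a coordinate is binomial, with a success probability that does not involve \<open>n\<close>.
  It is stated as a product, so that it stays true when the total has probability zero, and
  so that it can be integrated over \<open>n\<close>.
\<close>

lemma nn_integral_negmult_coordinate_total:
  assumes "success_probs I p" "i \<in> I" "0 < (\<Sum>i\<in>I. p i)"
  defines "P \<equiv> \<Sum>i\<in>I. p i"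
  shows "(\<integral>\<^sup>+x. (if x i = a \<and> (\<Sum>i\<in>I. x i) = j then 1 else 0) \<partial>negmult I n p)
    = ennreal (pmf (binomial_pmf j (p i / P)) a)
      * (\<integral>\<^sup>+x. (if (\<Sum>i\<in>I. x i) = j then 1 else 0) \<partial>negmult I n p)"
proof -
  note p = success_probsD[OF assms(1)]
  have le: "p i \<le> P" unfolding P_def using p assms(2) by (intro member_le_sum) auto
  have P0: "0 < P" using assms(3) by (simp add: P_def)
  define c where "c = pochhammer (real n) j * (1 - P) ^ n"
  have c: "0 \<le> c" using p by (auto simp: c_def P_def intro!: mult_nonneg_nonneg)
  have sep: "(\<integral>\<^sup>+x. (if Q x \<and> (\<Sum>i\<in>I. x i) = j then 1 else 0) \<partial>negmult I n p)
      = ennreal (c * (\<Sum>x\<in>compositions I j. (if Q x then 1 else 0) * (\<Prod>i\<in>I. p i ^ x i / fact (x i))))"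
    for Q :: "('a \<Rightarrow> nat) \<Rightarrow> bool"
  proof -
    let ?f = "\<lambda>x. if Q x \<and> (\<Sum>i\<in>I. x i) = j then 1 else (0 :: real)"
    let ?w = "\<lambda>x. \<Prod>i\<in>I. p i ^ x i / fact (x i)"
    have "(\<integral>\<^sup>+x. (if Q x \<and> (\<Sum>i\<in>I. x i) = j then 1 else 0) \<partial>negmult I n p)
        = (\<integral>\<^sup>+x. ennreal (?f x) \<partial>negmult I n p)"
      by (intro nn_integral_cong) auto
    also have "\<dots> = (\<Sum>l. ennreal (pochhammer (real n) l * (1 - P) ^ n * (\<Sum>x\<in>compositions I l. ?f x * ?w x)))"
      unfolding P_def by (rule nn_integral_negmult_compositions[OF assms(1)]) simp
    also have "\<dots> = (\<Sum>l\<in>{j}. ennreal (pochhammer (real n) l * (1 - P) ^ n * (\<Sum>x\<in>compositions I l. ?f x * ?w x)))"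
    proof (rule suminf_finite)
      fix l assume "l \<notin> {j}"
      then have "(\<Sum>x\<in>compositions I l. ?f x * ?w x) = 0"
        by (intro sum.neutral) (auto simp: compositions_def)
      then show "ennreal (pochhammer (real n) l * (1 - P) ^ n * (\<Sum>x\<in>compositions I l. ?f x * ?w x)) = 0"
        by (simp only: mult_zero_right ennreal_0)
    qed simp
    also have "\<dots> = ennreal (c * (\<Sum>x\<in>compositions I j. ?f x * ?w x))"
      by (simp add: c_def)
    also have "(\<Sum>x\<in>compositions I j. ?f x * ?w x) = (\<Sum>x\<in>compositions I j. (if Q x then 1 else 0) * ?w x)"
      by (intro sum.cong) (auto simp: compositions_def)
    finally show ?thesis .
  qed
  have total: "(\<integral>\<^sup>+x. (if (\<Sum>i\<in>I. x i) = j then 1 else 0) \<partial>negmult I n p) = ennreal (c * (P ^ j / fact j))"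
    using sep[of "\<lambda>_. True"] by (simp add: multinomial_theorem[OF p(1)] P_def)
  \<comment> \<open>for \<open>a > j\<close> both sides vanish\<close>
  have eq: "c * (real (j choose a) * p i ^ a * (P - p i) ^ (j - a) / fact j)
      = pmf (binomial_pmf j (p i / P)) a * (c * (P ^ j / fact j))"
  proof (cases "a \<le> j")
    case True
    have "P ^ j = P ^ a * P ^ (j - a)" using True by (simp flip: power_add)
    moreover have "1 - p i / P = (P - p i) / P" using P0 by (simp add: field_simps)
    ultimately show ?thesis
      using P0 le p(2)[OF assms(2)] by (simp add: pmf_binomial power_divide)
  next
    case False
    then show ?thesis using P0 le p(2)[OF assms(2)] by (simp add: pmf_binomial)
  qed
  show ?thesis
    unfolding total sep multinomial_theorem_coordinate[OF p(1) assms(2)] P_def[symmetric]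
    using eq by (simp only: ennreal_mult'[OF pmf_nonneg])
qed

text \<open>
  The function \<open>h\<close> sending \<open>x\<close> to the product of the \<open>z i ^ x i\<close> may be negative, whereas
  \<open>h + \<bar>h\<bar>\<close> is not. So the generating function at signed arguments is obtained from non-negative
  integrals only, as the integral of \<open>h + \<bar>h\<bar>\<close> minus that of \<open>\<bar>h\<bar>\<close>.
\<close>

lemma nn_integral_negmult_pgf:
  assumes "success_probs I p" "(\<Sum>i\<in>I. p i * \<bar>z i\<bar>) < 1"
  defines "p0 \<equiv> 1 - (\<Sum>i\<in>I. p i)"
  shows "(\<integral>\<^sup>+x. ennreal ((\<Prod>i\<in>I. z i ^ x i) + (\<Prod>i\<in>I. \<bar>z i\<bar> ^ x i)) \<partial>negmult I n p)
    = ennreal ((p0 / (1 - (\<Sum>i\<in>I. p i * z i))) ^ n + (p0 / (1 - (\<Sum>i\<in>I. p i * \<bar>z i\<bar>))) ^ n)"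
proof -
  note p = success_probsD[OF assms(1)]
  define v w where "v = (\<Sum>i\<in>I. p i * z i)" and "w = (\<Sum>i\<in>I. p i * \<bar>z i\<bar>)"
  have vw: "\<bar>v\<bar> \<le> w" unfolding v_def w_def
    using p by (intro order.trans[OF sum_abs] sum_mono) (simp add: abs_mult)
  have w: "0 \<le> w" "w < 1" using vw assms(2) by (auto simp: w_def)
  have p0: "0 < p0" using p by (simp add: p0_def)
  have nonneg: "0 \<le> (\<Prod>i\<in>I. z i ^ x i) + (\<Prod>i\<in>I. \<bar>z i\<bar> ^ x i)" for x
    using abs_ge_minus_self[of "\<Prod>i\<in>I. z i ^ x i"] by (simp add: abs_prod power_abs)
  have "(\<Sum>x\<in>compositions I j. ((\<Prod>i\<in>I. z i ^ x i) + (\<Prod>i\<in>I. \<bar>z i\<bar> ^ x i)) * (\<Prod>i\<in>I. p i ^ x i / fact (x i)))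
      = (v ^ j + w ^ j) / fact j" for j
  proof -
    have "((\<Prod>i\<in>I. z i ^ x i) + (\<Prod>i\<in>I. \<bar>z i\<bar> ^ x i)) * (\<Prod>i\<in>I. p i ^ x i / fact (x i))
        = (\<Prod>i\<in>I. (p i * z i) ^ x i / fact (x i)) + (\<Prod>i\<in>I. (p i * \<bar>z i\<bar>) ^ x i / fact (x i))" for x
      by (simp add: power_mult_distrib prod.distrib prod_dividef algebra_simps add_divide_distrib)
    then show ?thesis
      by (simp add: sum.distrib multinomial_theorem[OF p(1)] v_def w_def add_divide_distrib)
  qed
  then have "(\<integral>\<^sup>+x. ennreal ((\<Prod>i\<in>I. z i ^ x i) + (\<Prod>i\<in>I. \<bar>z i\<bar> ^ x i)) \<partial>negmult I n p)
      = (\<Sum>j. ennreal (p0 ^ n * (pochhammer (real n) j * (v ^ j / fact j) + pochhammer (real n) j * (w ^ j / fact j))))"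
    by (simp add: nn_integral_negmult_compositions[OF assms(1) nonneg] p0_def algebra_simps add_divide_distrib)
  also have "\<dots> = ennreal (p0 ^ n * (1 / (1 - v) ^ n + 1 / (1 - w) ^ n))"
  proof (intro suminf_ennreal_eq sums_mult sums_add negative_binomial_series)
    fix j
    have "- (v ^ j) \<le> \<bar>v\<bar> ^ j" using abs_ge_minus_self[of "v ^ j"] by (simp add: power_abs)
    also have "\<dots> \<le> w ^ j" using vw by (intro power_mono) auto
    finally have "0 \<le> v ^ j + w ^ j" by simp
    then have "0 \<le> p0 ^ n * (pochhammer (real n) j * ((v ^ j + w ^ j) / fact j))"
      using p0 by (intro mult_nonneg_nonneg divide_nonneg_nonneg) auto
    then show "0 \<le> p0 ^ n * (pochhammer (real n) j * (v ^ j / fact j) + pochhammer (real n) j * (w ^ j / fact j))"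
      by (simp add: algebra_simps add_divide_distrib)
  qed (use vw w in auto)
  finally show ?thesis
    by (simp add: v_def w_def power_divide algebra_simps)
qed

text \<open>
  The generating function is a power series in \<open>w = \<Sum> p i * z i\<close> with coefficients at least
  \<open>p0 ^ n\<close>, because \<open>pochhammer n j \<ge> fact j\<close> for \<open>n \<ge> 1\<close>. Its terms tend to zero only if \<open>w < 1\<close>.
\<close>

lemma negmult_pgf_radius:
  assumes "success_probs I p" "n \<ge> 1" "\<And>i. i \<in> I \<Longrightarrow> 0 \<le> z i"
    and "(\<integral>\<^sup>+x. ennreal (\<Prod>i\<in>I. z i ^ x i) \<partial>negmult I n p) \<noteq> \<infinity>"
  shows "(\<Sum>i\<in>I. p i * z i) < 1"
proof (rule ccontr)
  note p = success_probsD[OF assms(1)]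
  define w where "w = (\<Sum>i\<in>I. p i * z i)"
  define p0 where "p0 = 1 - (\<Sum>i\<in>I. p i)"
  assume "\<not> (\<Sum>i\<in>I. p i * z i) < 1"
  then have w: "1 \<le> w" by (simp add: w_def)
  have p0: "0 < p0" using p by (simp add: p0_def)
  \<comment> \<open>agrees with \<open>z\<close> on \<open>I\<close> and is non-negative everywhere, as a non-negative integrand must be\<close>
  define z' where "z' i = \<bar>z i\<bar>" for i
  have "(\<integral>\<^sup>+x. ennreal (\<Prod>i\<in>I. z i ^ x i) \<partial>negmult I n p)
      = (\<integral>\<^sup>+x. ennreal (\<Prod>i\<in>I. z' i ^ x i) \<partial>negmult I n p)"
    using assms(3) by (simp add: z'_def)
  also have "\<dots> = (\<Sum>j. ennreal (pochhammer (real n) j * p0 ^ n *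
        (\<Sum>x\<in>compositions I j. (\<Prod>i\<in>I. z' i ^ x i) * (\<Prod>i\<in>I. p i ^ x i / fact (x i)))))"
    unfolding p0_def
    by (rule nn_integral_negmult_compositions[OF assms(1)]) (auto simp: z'_def intro!: prod_nonneg)
  also have "\<dots> = (\<Sum>j. ennreal (pochhammer (real n) j * p0 ^ n * (w ^ j / fact j)))"
  proof -
    have "(\<Sum>i\<in>I. p i * z' i) = w" using assms(3) by (simp add: w_def z'_def)
    moreover have "(\<Prod>i\<in>I. z' i ^ x i) * (\<Prod>i\<in>I. p i ^ x i / fact (x i))
        = (\<Prod>i\<in>I. (p i * z' i) ^ x i / fact (x i))" for x
      by (simp add: power_mult_distrib prod.distrib prod_dividef mult_ac)
    ultimately show ?thesis by (simp add: multinomial_theorem[OF p(1)])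
  qed
  finally have "(\<Sum>j. ennreal (pochhammer (real n) j * p0 ^ n * (w ^ j / fact j))) \<noteq> \<top>"
    using assms(4) by simp
  then have "summable (\<lambda>j. pochhammer (real n) j * p0 ^ n * (w ^ j / fact j))"
    using w p0 by (intro summable_suminf_not_top) auto
  then have lim: "(\<lambda>j. pochhammer (real n) j * p0 ^ n * (w ^ j / fact j)) \<longlonglongrightarrow> 0"
    by (rule summable_LIMSEQ_zero)
  have "p0 ^ n \<le> pochhammer (real n) j * p0 ^ n * (w ^ j / fact j)" for j
  proof -
    have "(fact j :: real) = pochhammer 1 j" by (rule pochhammer_fact)
    also have "\<dots> \<le> pochhammer (real n) j"
      unfolding pochhammer_prod using assms(2) by (intro prod_mono) auto
    finally have "1 \<le> pochhammer (real n) j / fact j" by simp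
    moreover have "1 \<le> w ^ j" using w by simp
    ultimately have "1 * 1 \<le> (pochhammer (real n) j / fact j) * w ^ j"
      by (intro mult_mono) auto
    then have "p0 ^ n * 1 \<le> p0 ^ n * (pochhammer (real n) j / fact j * w ^ j)"
      using p0 by (intro mult_left_mono) auto
    then show ?thesis by (simp add: mult_ac)
  qed
  then have "p0 ^ n \<le> 0" by (intro LIMSEQ_le_const[OF lim]) auto
  then show False using zero_less_power[OF p0, of n] by linarith
qed

lemma emeasure_negmult_space:
  "success_probs I p \<Longrightarrow> emeasure (negmult I n p) (I \<rightarrow>\<^sub>E UNIV) = 1"
  using prob_space.emeasure_space_1[OF prob_space_negmult] by force

lemma borel_measurable_negmult [simp]: "f \<in> borel_measurable (negmult I n p)"
  by (simp add: negmult_def)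

lemma nn_integral_negmult_mean:
  assumes "success_probs I p" "i \<in> I"
  shows "(\<integral>\<^sup>+x. ennreal (real (x i)) \<partial>negmult I n p) = ennreal (real n * (p i / (1 - (\<Sum>i\<in>I. p i))))"
  using nn_integral_negmult_size_bias[OF assms, where f = "\<lambda>_. 1" and n = n]
  by (simp add: ennreal_of_nat_eq_real_of_nat emeasure_negmult_space[OF assms(1)])

lemma nn_integral_negmult_product:
  assumes "success_probs I p" "i \<in> I" "j \<in> I" "i \<noteq> j"
  defines "p0 \<equiv> 1 - (\<Sum>i\<in>I. p i)"
  shows "(\<integral>\<^sup>+x. ennreal (real (x i) * real (x j)) \<partial>negmult I n p)
    = ennreal (real n * (p i / p0) * (real (Suc n) * (p j / p0)))"
proof -
  note p = success_probsD[OF assms(1)]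
  have nonneg: "0 \<le> p i / p0" "0 \<le> p j / p0" using p assms by (auto simp: p0_def)
  have "(\<integral>\<^sup>+x. ennreal (real (x i) * real (x j)) \<partial>negmult I n p)
      = (\<integral>\<^sup>+x. of_nat (x i) * ennreal (real (x j)) \<partial>negmult I n p)"
    by (simp add: ennreal_mult ennreal_of_nat_eq_real_of_nat)
  also have "\<dots> = ennreal (real n * (p i / p0)) * (\<integral>\<^sup>+x. ennreal (real (x j)) \<partial>negmult I (Suc n) p)"
    using assms(4) nn_integral_negmult_size_bias[OF assms(1,2), where f = "\<lambda>x. ennreal (real (x j))" and n = n]
    by (simp add: p0_def)
  also have "\<dots> = ennreal (real n * (p i / p0) * (real (Suc n) * (p j / p0)))"
    unfolding nn_integral_negmult_mean[OF assms(1,3)] p0_def[symmetric]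
    using nonneg by (intro ennreal_mult[symmetric] mult_nonneg_nonneg) auto
  finally show ?thesis .
qed

lemma nn_integral_negmult_square:
  assumes "success_probs I p" "i \<in> I"
  defines "a \<equiv> p i / (1 - (\<Sum>i\<in>I. p i))"
  shows "(\<integral>\<^sup>+x. ennreal ((real (x i))\<^sup>2) \<partial>negmult I n p)
    = ennreal (real n * a * (1 + real (Suc n) * a))"
proof -
  note p = success_probsD[OF assms(1)]
  have nonneg: "0 \<le> a" using p assms by (auto simp: a_def)
  have "(\<integral>\<^sup>+x. ennreal ((real (x i))\<^sup>2) \<partial>negmult I n p)
      = (\<integral>\<^sup>+x. of_nat (x i) * ennreal (real (x i)) \<partial>negmult I n p)"
    by (simp add: power2_eq_square ennreal_mult ennreal_of_nat_eq_real_of_nat)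
  also have "\<dots> = ennreal (real n * a) * (\<integral>\<^sup>+x. 1 + ennreal (real (x i)) \<partial>negmult I (Suc n) p)"
    using nn_integral_negmult_size_bias[OF assms(1,2), where f = "\<lambda>x. ennreal (real (x i))" and n = n]
    by (simp add: a_def ennreal_plus)
  also have "\<dots> = ennreal (real n * a) * (1 + ennreal (real (Suc n) * a))"
    using nn_integral_negmult_mean[OF assms(1,2), where n = "Suc n"]
    by (subst nn_integral_add) (simp_all add: a_def emeasure_negmult_space[OF assms(1)])
  also have "\<dots> = ennreal (real n * a * (1 + real (Suc n) * a))"
    using nonneg by (simp add: ennreal_mult ennreal_plus flip: ennreal_1 del: of_nat_Suc)
  finally show ?thesis .
qed

section \<open>Random sums of independent negative multinomial vectors\<close>

lemma measurable_nat_vectors: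
  assumes "finite I" "\<And>i. i \<in> I \<Longrightarrow> X i \<in> measurable M (count_space UNIV)"
  shows "(\<lambda>\<omega>. \<lambda>i\<in>I. X i \<omega>) \<in> measurable M (nat_vectors I)"
proof -
  have "(\<lambda>\<omega>. \<lambda>i\<in>I. X i \<omega>) -` {a} \<inter> space M \<in> sets M" if "a \<in> I \<rightarrow>\<^sub>E UNIV" for a
  proof -
    have "(\<lambda>\<omega>. \<lambda>i\<in>I. X i \<omega>) -` {a} \<inter> space M = {\<omega> \<in> space M. \<forall>i\<in>I. X i \<omega> = a i}"
      using that by (auto simp: fun_eq_iff PiE_def extensional_def)
    also have "\<dots> \<in> sets M"
    proof (rule sets.sets_Collect_finite_All[OF _ assms(1)])
      fix i assume "i \<in> I"
      then have [measurable]: "X i \<in> measurable M (count_space UNIV)" by (rule assms(2))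
      show "{\<omega> \<in> space M. X i \<omega> = a i} \<in> sets M" by measurable
    qed
    finally show ?thesis .
  qed
  then show ?thesis
    by (subst measurable_count_space_eq_countable[OF countable_nat_vectors[OF assms(1)]]) auto
qed

lemma measurable_nat_vectors_component:
  "i \<in> I \<Longrightarrow> (\<lambda>x. x i) \<in> measurable (nat_vectors I) (count_space UNIV)"
  by simp

lemma measurable_sum_PiM_nat_vectors:
  assumes "finite I" "T \<subseteq> A" "\<And>t. t \<in> A \<Longrightarrow> sets (L t) = sets (nat_vectors I)"
  shows "(\<lambda>y. \<lambda>i\<in>I. \<Sum>t\<in>T. y t i) \<in> measurable (Pi\<^sub>M A L) (nat_vectors I)"
proof (rule measurable_nat_vectors[OF assms(1)])
  fix i assume "i \<in> I"
  have "(\<lambda>y. y t i) \<in> measurable (Pi\<^sub>M A L) (count_space UNIV)" if "t \<in> T" for t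
  proof (rule measurable_compose[where g = "\<lambda>x. x i"])
    show "(\<lambda>y. y t) \<in> measurable (Pi\<^sub>M A L) (L t)"
      using that assms(2) by (intro measurable_component_singleton) auto
    show "(\<lambda>x. x i) \<in> measurable (L t) (count_space UNIV)"
      using that assms(2,3) by (subst measurable_cong_sets[OF assms(3) refl]) auto
  qed
  then show "(\<lambda>y. \<Sum>t\<in>T. y t i) \<in> measurable (Pi\<^sub>M A L) (count_space UNIV)"
    by measurable
qed

lemma nn_integral_PiM_negmult_sum_finite:
  fixes f :: "('i \<Rightarrow> nat) \<Rightarrow> ennreal" and T :: "'t set"
  assumes "success_probs I p" "finite T"
  shows "(\<integral>\<^sup>+y. f (\<lambda>i\<in>I. \<Sum>t\<in>T. y t i) \<partial>Pi\<^sub>M T (\<lambda>_. negmult I s p))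
       = (\<integral>\<^sup>+x. f x \<partial>negmult I (s * card T) p)"
  using assms(2)
proof (induction T arbitrary: f rule: finite_induct)
  case empty
  interpret product_sigma_finite "\<lambda>_ :: 't. negmult I s p"
    by (intro product_sigma_finite.intro prob_space_imp_sigma_finite prob_space_negmult assms)
  show ?case
    using success_probsD(1)[OF assms(1)] by (simp add: nn_integral_negmult_0 PiM_empty nn_integral_count_space_finite restrict_def)
next
  case (insert t T)
  interpret product_sigma_finite "\<lambda>_ :: 't. negmult I s p"
    by (intro product_sigma_finite.intro prob_space_imp_sigma_finite prob_space_negmult assms)
  have "(\<integral>\<^sup>+y. f (\<lambda>i\<in>I. \<Sum>t\<in>insert t T. y t i) \<partial>Pi\<^sub>M (insert t T) (\<lambda>_. negmult I s p))
      = (\<integral>\<^sup>+y. \<integral>\<^sup>+z. f (\<lambda>i\<in>I. \<Sum>u\<in>insert t T. (y(t := z)) u i) \<partial>negmult I s p \<partial>Pi\<^sub>M T (\<lambda>_. negmult I s p))"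
    using insert.hyps success_probsD(1)[OF assms(1)]
    by (intro product_nn_integral_insert measurable_compose[OF measurable_sum_PiM_nat_vectors]) auto
  also have "\<dots> = (\<integral>\<^sup>+y. (\<lambda>x. \<integral>\<^sup>+z. f (\<lambda>i\<in>I. x i + z i) \<partial>negmult I s p) (\<lambda>i\<in>I. \<Sum>u\<in>T. y u i)
      \<partial>Pi\<^sub>M T (\<lambda>_. negmult I s p))"
  proof -
    have "(\<Sum>u\<in>insert t T. (y(t := z)) u i) = (\<Sum>u\<in>T. y u i) + z i" for y :: "'t \<Rightarrow> 'i \<Rightarrow> nat" and z i
    proof -
      have "(\<Sum>u\<in>T. (y(t := z)) u i) = (\<Sum>u\<in>T. y u i)"
        using insert.hyps by (intro sum.cong) auto
      then show ?thesis using insert.hyps by simp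
    qed
    then show ?thesis by (simp cong: restrict_cong)
  qed
  also have "\<dots> = (\<integral>\<^sup>+x. \<integral>\<^sup>+z. f (\<lambda>i\<in>I. x i + z i) \<partial>negmult I s p \<partial>negmult I (s * card T) p)"
    by (rule insert.IH)
  also have "\<dots> = (\<integral>\<^sup>+x. f x \<partial>negmult I (s * card T + s) p)"
    by (rule nn_integral_negmult_add[OF assms(1)])
  finally show ?case
    by (simp only: card_insert_disjoint[OF insert.hyps] mult_Suc_right add.commute)
qed

text \<open>
  The sum involves only the first \<open>n\<close> factors of the infinite product, so the semigroup property
  gives its law by induction.
\<close>

lemma nn_integral_PiM_negmult_sum:
  fixes f :: "('i \<Rightarrow> nat) \<Rightarrow> ennreal"
  assumes "success_probs I p"
  shows "(\<integral>\<^sup>+y. f (\<lambda>i\<in>I. \<Sum>t=1..n. y t i) \<partial>Pi\<^sub>M {1::nat..} (\<lambda>_. negmult I s p))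
       = (\<integral>\<^sup>+x. f x \<partial>negmult I (s * n) p)"
proof -
  interpret product_prob_space "\<lambda>_ :: nat. negmult I s p" "{1..}"
    by (intro product_prob_spaceI prob_space_negmult assms)
  have meas: "(\<lambda>y. f (\<lambda>i\<in>I. \<Sum>t=1..n. y t i)) \<in> borel_measurable (Pi\<^sub>M {1..n} (\<lambda>_. negmult I s p))"
    using success_probsD(1)[OF assms(1)]
    by (rule measurable_compose[OF measurable_sum_PiM_nat_vectors]) auto
  have "(\<integral>\<^sup>+y. f (\<lambda>i\<in>I. \<Sum>t=1..n. y t i) \<partial>Pi\<^sub>M {1::nat..} (\<lambda>_. negmult I s p))
      = (\<integral>\<^sup>+y. (\<lambda>y. f (\<lambda>i\<in>I. \<Sum>t=1..n. y t i)) (restrict y {1..n}) \<partial>Pi\<^sub>M {1::nat..} (\<lambda>_. negmult I s p))"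
    by (simp cong: restrict_cong)
  also have "\<dots> = (\<integral>\<^sup>+y. f (\<lambda>i\<in>I. \<Sum>t=1..n. y t i)
      \<partial>distr (Pi\<^sub>M {1::nat..} (\<lambda>_. negmult I s p)) (Pi\<^sub>M {1..n} (\<lambda>_. negmult I s p)) (\<lambda>y. restrict y {1..n}))"
    using meas by (intro nn_integral_distr[symmetric] measurable_restrict_subset) auto
  also have "\<dots> = (\<integral>\<^sup>+y. f (\<lambda>i\<in>I. \<Sum>t=1..n. y t i) \<partial>Pi\<^sub>M {1..n} (\<lambda>_. negmult I s p))"
    by (subst distr_PiM_restrict_finite) auto
  finally show ?thesis by (simp add: nn_integral_PiM_negmult_sum_finite[OF assms])
qed

lemma measurable_random_sum:
  assumes "finite I" "\<And>t. t \<ge> 1 \<Longrightarrow> sets (L t) = sets (nat_vectors I)"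
  shows "(\<lambda>(n, y). \<lambda>i\<in>I. \<Sum>t=1..n. y t i)
    \<in> measurable (count_space UNIV \<Otimes>\<^sub>M Pi\<^sub>M {1::nat..} L) (nat_vectors I)"
  using assms
  by (intro measurable_pair_measure_countable1) (auto intro!: measurable_sum_PiM_nat_vectors)

lemma nn_integral_random_sum:
  fixes h :: "nat \<Rightarrow> ('i \<Rightarrow> nat) \<Rightarrow> ennreal"
  assumes "success_probs I p" "sets \<mu> = UNIV"
  shows "(\<integral>\<^sup>+(n, y). h n (\<lambda>i\<in>I. \<Sum>t=1..n. y t i) \<partial>(\<mu> \<Otimes>\<^sub>M Pi\<^sub>M {1::nat..} (\<lambda>_. negmult I s p)))
       = (\<integral>\<^sup>+n. \<integral>\<^sup>+x. h n x \<partial>negmult I (s * n) p \<partial>\<mu>)"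
proof -
  interpret product_prob_space "\<lambda>_ :: nat. negmult I s p" "{1..}"
    by (intro product_prob_spaceI prob_space_negmult assms)
  have "(\<lambda>(n, y). h n (\<lambda>i\<in>I. \<Sum>t=1..n. y t i))
      \<in> borel_measurable (count_space UNIV \<Otimes>\<^sub>M Pi\<^sub>M {1::nat..} (\<lambda>_. negmult I s p))"
    using success_probsD(1)[OF assms(1)]
    by (intro measurable_pair_measure_countable1)
       (auto intro!: measurable_compose[OF measurable_sum_PiM_nat_vectors])
  also have "borel_measurable (count_space UNIV \<Otimes>\<^sub>M Pi\<^sub>M {1::nat..} (\<lambda>_. negmult I s p))
      = borel_measurable (\<mu> \<Otimes>\<^sub>M Pi\<^sub>M {1::nat..} (\<lambda>_. negmult I s p))"
    using assms(2) by (intro measurable_cong_sets sets_pair_measure_cong) auto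
  finally have meas: "(\<lambda>(n, y). h n (\<lambda>i\<in>I. \<Sum>t=1..n. y t i))
      \<in> borel_measurable (\<mu> \<Otimes>\<^sub>M Pi\<^sub>M {1::nat..} (\<lambda>_. negmult I s p))" .
  have "(\<integral>\<^sup>+(n, y). h n (\<lambda>i\<in>I. \<Sum>t=1..n. y t i) \<partial>(\<mu> \<Otimes>\<^sub>M Pi\<^sub>M {1::nat..} (\<lambda>_. negmult I s p)))
      = (\<integral>\<^sup>+n. \<integral>\<^sup>+y. h n (\<lambda>i\<in>I. \<Sum>t=1..n. y t i) \<partial>Pi\<^sub>M {1::nat..} (\<lambda>_. negmult I s p) \<partial>\<mu>)"
    using P.nn_integral_fst[OF meas] by (simp only: prod.case)
  then show ?thesis by (simp only: nn_integral_PiM_negmult_sum[OF assms(1)])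
qed

text \<open>
  A vector \<open>X\<close> whose conditional law given \<open>N\<close> is negative multinomial with parameter \<open>s N\<close>. The
  conditional law is expressed by the tower property for non-negative functions, a form that is
  that marginals and totals inherit without a return to the independent summands, and from which
  each quantity is read off by a choice of \<open>h\<close>.
\<close>

locale compound_negmult = prob_space M for M :: "'a measure" +
  fixes N :: "'a \<Rightarrow> nat" and I :: "'i set" and X :: "'i \<Rightarrow> 'a \<Rightarrow> nat" and s :: nat and p :: "'i \<Rightarrow> real"
  assumes N [measurable]: "N \<in> measurable M (count_space UNIV)"
    and X: "\<And>i. i \<in> I \<Longrightarrow> X i \<in> measurable M (count_space UNIV)"
    and probs: "success_probs I p"
    and tower: "\<And>h. (\<integral>\<^sup>+\<omega>. h (N \<omega>) (rvec I X \<omega>) \<partial>M)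
                  = (\<integral>\<^sup>+\<omega>. \<integral>\<^sup>+x. h (N \<omega>) x \<partial>negmult I (s * N \<omega>) p \<partial>M)"
begin

lemma finite_index: "finite I"
  using probs by (simp add: success_probs_def)

lemma measurable_rvec: "rvec I X \<in> measurable M (nat_vectors I)"
  unfolding rvec_def[abs_def] by (rule measurable_nat_vectors[OF finite_index X])

lemma marginal:
  fixes \<iota> :: "'j \<Rightarrow> 'i"
  assumes "inj_on \<iota> J" "\<iota> ` J \<subseteq> I"
  shows "compound_negmult M N J (\<lambda>m. X (\<iota> m)) s
    (\<lambda>m. p (\<iota> m) / (1 - (\<Sum>i\<in>I. p i) + (\<Sum>m\<in>J. p (\<iota> m))))"
proof unfold_locales
  show "X (\<iota> m) \<in> measurable M (count_space UNIV)" if "m \<in> J" for m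
    using assms that by (intro X) auto
  show "success_probs J (\<lambda>m. p (\<iota> m) / (1 - (\<Sum>i\<in>I. p i) + (\<Sum>m\<in>J. p (\<iota> m))))"
    by (rule success_probs_marginal[OF probs assms])
  fix h :: "nat \<Rightarrow> ('j \<Rightarrow> nat) \<Rightarrow> ennreal"
  have "rvec J (\<lambda>m. X (\<iota> m)) \<omega> = (\<lambda>m\<in>J. rvec I X \<omega> (\<iota> m))" for \<omega>
    using assms by (auto simp: rvec_def fun_eq_iff)
  then show "(\<integral>\<^sup>+\<omega>. h (N \<omega>) (rvec J (\<lambda>m. X (\<iota> m)) \<omega>) \<partial>M)
      = (\<integral>\<^sup>+\<omega>. \<integral>\<^sup>+x. h (N \<omega>) x \<partial>negmult J (s * N \<omega>)
          (\<lambda>m. p (\<iota> m) / (1 - (\<Sum>i\<in>I. p i) + (\<Sum>m\<in>J. p (\<iota> m)))) \<partial>M)"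
    using tower[of "\<lambda>n x. h n (\<lambda>m\<in>J. x (\<iota> m))"]
    by (simp add: nn_integral_negmult_marginal[OF probs assms])
qed simp

lemma total:
  fixes a :: 'j
  shows "compound_negmult M N {a} (\<lambda>_ \<omega>. \<Sum>i\<in>I. X i \<omega>) s (\<lambda>_. \<Sum>i\<in>I. p i)"
proof unfold_locales
  show "(\<lambda>\<omega>. \<Sum>i\<in>I. X i \<omega>) \<in> measurable M (count_space UNIV)"
    using X by measurable
  show "success_probs {a} (\<lambda>_. \<Sum>i\<in>I. p i)"
    by (rule success_probs_total[OF probs])
  fix h :: "nat \<Rightarrow> ('j \<Rightarrow> nat) \<Rightarrow> ennreal"
  have "rvec {a} (\<lambda>_ \<omega>. \<Sum>i\<in>I. X i \<omega>) \<omega> = (\<lambda>_\<in>{a}. \<Sum>i\<in>I. rvec I X \<omega> i)" for \<omega>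
    by (simp add: rvec_def)
  then show "(\<integral>\<^sup>+\<omega>. h (N \<omega>) (rvec {a} (\<lambda>_ \<omega>. \<Sum>i\<in>I. X i \<omega>) \<omega>) \<partial>M)
      = (\<integral>\<^sup>+\<omega>. \<integral>\<^sup>+x. h (N \<omega>) x \<partial>negmult {a} (s * N \<omega>) (\<lambda>_. \<Sum>i\<in>I. p i) \<partial>M)"
    using tower[of "\<lambda>n x. h n (\<lambda>_\<in>{a}. \<Sum>i\<in>I. x i)"]
    by (simp add: nn_integral_negmult_sum[OF probs])
qed simp

text \<open>
  The canonical random sum satisfies the same tower property, hence has the same law.
\<close>

lemma law:
  assumes "s \<ge> 1"
  shows "distr M (nat_vectors I) (rvec I X) = CNNMn (distr M (count_space UNIV) N) I s p"
proof (rule measure_eqI)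
  show "sets (distr M (nat_vectors I) (rvec I X)) = sets (CNNMn (distr M (count_space UNIV) N) I s p)"
    by (simp add: CNNMn_def)
  fix A assume "A \<in> sets (distr M (nat_vectors I) (rvec I X))"
  then have A: "A \<in> sets (nat_vectors I)" by simp
  let ?\<mu> = "distr M (count_space UNIV) N"
  let ?\<Pi> = "?\<mu> \<Otimes>\<^sub>M Pi\<^sub>M {1::nat..} (\<lambda>_. negmult I s p)"
  have meas: "(\<lambda>(n, y). \<lambda>i\<in>I. \<Sum>t=1..n. y t i) \<in> measurable ?\<Pi> (nat_vectors I)"
  proof -
    have "(\<lambda>(n, y). \<lambda>i\<in>I. \<Sum>t=1..n. y t i)
      \<in> measurable (count_space UNIV \<Otimes>\<^sub>M Pi\<^sub>M {1::nat..} (\<lambda>_. negmult I s p)) (nat_vectors I)"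
      by (rule measurable_random_sum[OF finite_index]) simp
    also have "measurable (count_space UNIV \<Otimes>\<^sub>M Pi\<^sub>M {1::nat..} (\<lambda>_. negmult I s p)) (nat_vectors I)
        = measurable ?\<Pi> (nat_vectors I)"
      by (intro measurable_cong_sets sets_pair_measure_cong) auto
    finally show ?thesis .
  qed
  have "emeasure (distr M (nat_vectors I) (rvec I X)) A = (\<integral>\<^sup>+\<omega>. indicator A (rvec I X \<omega>) \<partial>M)"
    using A measurable_rvec by (simp add: nn_integral_distr flip: nn_integral_indicator)
  also have "\<dots> = (\<integral>\<^sup>+\<omega>. \<integral>\<^sup>+x. indicator A x \<partial>negmult I (s * N \<omega>) p \<partial>M)"
    by (rule tower)
  also have "\<dots> = (\<integral>\<^sup>+n. \<integral>\<^sup>+x. indicator A x \<partial>negmult I (s * n) p \<partial>?\<mu>)"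
    by (simp add: nn_integral_distr)
  also have "\<dots> = (\<integral>\<^sup>+(n, y). indicator A (\<lambda>i\<in>I. \<Sum>t=1..n. y t i) \<partial>?\<Pi>)"
    by (rule nn_integral_random_sum[OF probs, symmetric]) simp
  also have "\<dots> = (\<integral>\<^sup>+ny. indicator A ((\<lambda>(n, y). \<lambda>i\<in>I. \<Sum>t=1..n. y t i) ny) \<partial>?\<Pi>)"
    by (intro nn_integral_cong) (simp add: case_prod_beta)
  also have "\<dots> = (\<integral>\<^sup>+x. indicator A x \<partial>CNNMn ?\<mu> I s p)"
    unfolding CNNMn_def NMn_eq_negmult[OF assms]
    using A by (intro nn_integral_distr[OF meas, symmetric]) simp
  also have "\<dots> = emeasure (CNNMn ?\<mu> I s p) A"
    using A by (intro nn_integral_indicator) (simp add: CNNMn_def)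
  finally show "emeasure (distr M (nat_vectors I) (rvec I X)) A = emeasure (CNNMn ?\<mu> I s p) A" .
qed

end

text \<open>
  Independence of \<open>N\<close> and the sequence \<open>V\<close> makes their joint law a product. The random sum is a
  measurable function of the pair, and Fubini's theorem gives the tower property.
\<close>

lemma compound_negmultI:
  fixes V :: "nat \<Rightarrow> 'a \<Rightarrow> 'i \<Rightarrow> nat"
  assumes "prob_space M" "success_probs I p"
    and V: "\<And>t. t \<ge> 1 \<Longrightarrow> V t \<in> measurable M (nat_vectors I)"
    and law_V: "\<And>t. t \<ge> 1 \<Longrightarrow> distr M (nat_vectors I) (V t) = negmult I s p"
    and indep: "prob_space.indep_vars M (\<lambda>_. nat_vectors I) V {1..}"
    and N: "N \<in> measurable M (count_space UNIV)"
    and indep_N: "prob_space.indep_set M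
           (sets (vimage_algebra (space M) N (count_space UNIV)))
           (sets (vimage_algebra (space M) (\<lambda>\<omega>. \<lambda>t\<in>{1..}. V t \<omega>) (\<Pi>\<^sub>M t\<in>{1..}. nat_vectors I)))"
    and X: "\<And>\<omega>. \<omega> \<in> space M \<Longrightarrow> rvec I X \<omega> = (\<lambda>i\<in>I. \<Sum>t=1..N \<omega>. V t \<omega> i)"
  shows "compound_negmult M N I X s p"
proof -
  interpret prob_space M by fact
  define W where "W = (\<lambda>\<omega>. \<lambda>t\<in>{1..}. V t \<omega>)"
  define F where "F = (\<lambda>(n, y). \<lambda>i\<in>I. \<Sum>t=1..(n::nat). (y :: nat \<Rightarrow> 'i \<Rightarrow> nat) t i)"
  let ?\<mu> = "distr M (count_space UNIV) N"
  let ?\<Pi> = "Pi\<^sub>M {1::nat..} (\<lambda>_. nat_vectors I)"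
  have fin: "finite I" using assms(2) by (simp add: success_probs_def)
  have W: "W \<in> measurable M ?\<Pi>" unfolding W_def using V by (intro measurable_restrict) auto
  have "distr M ?\<Pi> W = Pi\<^sub>M {1..} (\<lambda>t. distr M (nat_vectors I) (V t))"
    unfolding W_def using V indep
    by (intro indep_vars_iff_distr_eq_PiM'[THEN iffD1]) auto
  also have "\<dots> = Pi\<^sub>M {1..} (\<lambda>_. negmult I s p)"
    using law_V by (intro PiM_cong) auto
  finally have law_W: "distr M ?\<Pi> W = Pi\<^sub>M {1..} (\<lambda>_. negmult I s p)" .
  have NW: "(\<lambda>\<omega>. (N \<omega>, W \<omega>)) \<in> measurable M (count_space UNIV \<Otimes>\<^sub>M ?\<Pi>)"
    using N W by simp
  have "?\<mu> \<Otimes>\<^sub>M distr M ?\<Pi> W = distr M (count_space UNIV \<Otimes>\<^sub>M ?\<Pi>) (\<lambda>\<omega>. (N \<omega>, W \<omega>))"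
  proof (rule pair_measure_eqI)
    show "sigma_finite_measure ?\<mu>" "sigma_finite_measure (distr M ?\<Pi> W)"
      using N W by (auto intro: prob_space_imp_sigma_finite prob_space_distr)
    fix A B assume AB: "A \<in> sets ?\<mu>" "B \<in> sets (distr M ?\<Pi> W)"
    have "prob ((N -` A \<inter> space M) \<inter> (W -` B \<inter> space M))
        = prob (N -` A \<inter> space M) * prob (W -` B \<inter> space M)"
      using AB W by (intro indep_setD[OF indep_N[folded W_def]] in_vimage_algebra) auto
    moreover have "(\<lambda>\<omega>. (N \<omega>, W \<omega>)) -` (A \<times> B) \<inter> space M
        = (N -` A \<inter> space M) \<inter> (W -` B \<inter> space M)" by auto
    ultimately show "emeasure ?\<mu> A * emeasure (distr M ?\<Pi> W) B
        = emeasure (distr M (count_space UNIV \<Otimes>\<^sub>M ?\<Pi>) (\<lambda>\<omega>. (N \<omega>, W \<omega>))) (A \<times> B)"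
      using AB N W NW by (simp add: emeasure_distr emeasure_eq_measure ennreal_mult)
  next
    show "sets (?\<mu> \<Otimes>\<^sub>M distr M ?\<Pi> W)
        = sets (distr M (count_space UNIV \<Otimes>\<^sub>M ?\<Pi>) (\<lambda>\<omega>. (N \<omega>, W \<omega>)))"
      unfolding sets_distr by (rule sets_pair_measure_cong) simp_all
  qed
  then have joint: "distr M (count_space UNIV \<Otimes>\<^sub>M ?\<Pi>) (\<lambda>\<omega>. (N \<omega>, W \<omega>))
      = ?\<mu> \<Otimes>\<^sub>M Pi\<^sub>M {1..} (\<lambda>_. negmult I s p)"
    unfolding law_W by (rule sym)
  have F_W: "rvec I X \<omega> = F (N \<omega>, W \<omega>)" if "\<omega> \<in> space M" for \<omega>
    using X[OF that] by (auto simp: F_def W_def fun_eq_iff intro!: sum.cong)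
  have F: "F \<in> measurable (count_space UNIV \<Otimes>\<^sub>M ?\<Pi>) (nat_vectors I)"
    unfolding F_def by (rule measurable_random_sum[OF fin]) simp
  have rvec: "rvec I X \<in> measurable M (nat_vectors I)"
    using measurable_compose[OF NW F] by (subst measurable_cong[OF F_W])
  show ?thesis
  proof unfold_locales
    show "X i \<in> measurable M (count_space UNIV)" if "i \<in> I" for i
    proof -
      have "(\<lambda>\<omega>. rvec I X \<omega> i) \<in> measurable M (count_space UNIV)"
        using rvec measurable_nat_vectors_component[OF that] by (rule measurable_compose)
      then show ?thesis using that by (simp add: rvec_def)
    qed
    fix h :: "nat \<Rightarrow> ('i \<Rightarrow> nat) \<Rightarrow> ennreal"
    have hF: "(\<lambda>(n, y). h n (F (n, y))) \<in> borel_measurable (count_space UNIV \<Otimes>\<^sub>M ?\<Pi>)"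
      by (intro measurable_pair_measure_countable1)
         (auto simp: F_def fin intro!: measurable_compose[OF measurable_sum_PiM_nat_vectors])
    have "(\<integral>\<^sup>+\<omega>. h (N \<omega>) (rvec I X \<omega>) \<partial>M) = (\<integral>\<^sup>+\<omega>. (\<lambda>(n, y). h n (F (n, y))) (N \<omega>, W \<omega>) \<partial>M)"
      by (intro nn_integral_cong) (simp add: F_W)
    also have "\<dots> = (\<integral>\<^sup>+(n, y). h n (F (n, y)) \<partial>(?\<mu> \<Otimes>\<^sub>M Pi\<^sub>M {1..} (\<lambda>_. negmult I s p)))"
      unfolding joint[symmetric] using nn_integral_distr[OF NW, symmetric] hF by (simp only: measurable_distr_eq1)
    also have "\<dots> = (\<integral>\<^sup>+n. \<integral>\<^sup>+x. h n x \<partial>negmult I (s * n) p \<partial>?\<mu>)"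
      unfolding F_def prod.case by (rule nn_integral_random_sum[OF assms(2)]) simp
    also have "\<dots> = (\<integral>\<^sup>+\<omega>. \<integral>\<^sup>+x. h (N \<omega>) x \<partial>negmult I (s * N \<omega>) p \<partial>M)"
      using N by (simp add: nn_integral_distr)
    finally show "(\<integral>\<^sup>+\<omega>. h (N \<omega>) (rvec I X \<omega>) \<partial>M)
      = (\<integral>\<^sup>+\<omega>. \<integral>\<^sup>+x. h (N \<omega>) x \<partial>negmult I (s * N \<omega>) p \<partial>M)" .
  qed (use assms N in auto)
qed

section \<open>Point probabilities of compound vectors\<close>

text \<open>
  The passage from non-negative integrals to expectations: integrability comes for free in both
  directions.
\<close>

lemma integral_transfer:
  fixes f g :: "'a \<Rightarrow> real"
  assumes "f \<in> borel_measurable M" "g \<in> borel_measurable M"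
    and "\<And>x. 0 \<le> f x" "\<And>x. 0 \<le> g x"
    and "(\<integral>\<^sup>+x. ennreal (f x) \<partial>M) = (\<integral>\<^sup>+x. ennreal (g x) \<partial>M)"
  shows "integrable M f \<longleftrightarrow> integrable M g" and "(\<integral>x. f x \<partial>M) = (\<integral>x. g x \<partial>M)"
  using assms by (simp_all add: integrable_iff_bounded integral_eq_nn_integral)

lemma (in prob_space) expectation_eq_infsum:
  fixes g :: "nat \<Rightarrow> real"
  assumes N [measurable]: "N \<in> measurable M (count_space UNIV)"
    and g: "\<And>n. 0 \<le> g n" "g 0 = 0" and int: "integrable M (\<lambda>\<omega>. g (N \<omega>))"
  shows "expectation (\<lambda>\<omega>. g (N \<omega>)) = (\<Sum>\<^sub>\<infinity>n\<in>{1..}. g n * \<P>(\<omega> in M. N \<omega> = n))"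
proof -
  define f where "f n = g n * \<P>(\<omega> in M. N \<omega> = n)" for n
  define L where "L = expectation (\<lambda>\<omega>. g (N \<omega>))"
  have f: "0 \<le> f n" for n using g by (simp add: f_def)
  have L: "0 \<le> L" using g by (simp add: L_def)
  have "ennreal L = (\<integral>\<^sup>+\<omega>. ennreal (g (N \<omega>)) \<partial>M)"
    using int g by (simp add: L_def nn_integral_eq_integral)
  also have "\<dots> = (\<integral>\<^sup>+\<omega>. (\<Sum>n. ennreal (g n) * indicator {\<omega>\<in>space M. N \<omega> = n} \<omega>) \<partial>M)"
  proof (rule nn_integral_cong)
    fix \<omega> assume "\<omega> \<in> space M"
    then show "ennreal (g (N \<omega>)) = (\<Sum>n. ennreal (g n) * indicator {\<omega>\<in>space M. N \<omega> = n} \<omega>)"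
      by (subst suminf_finite[of "{N \<omega>}"]) auto
  qed
  also have "\<dots> = (\<Sum>n. ennreal (g n) * emeasure M {\<omega>\<in>space M. N \<omega> = n})"
    by (subst nn_integral_suminf) (auto simp: nn_integral_cmult_indicator)
  also have "\<dots> = (\<Sum>n. ennreal (f n))"
    using g by (simp add: f_def emeasure_eq_measure ennreal_mult)
  finally have eq: "(\<Sum>n. ennreal (f n)) = ennreal L" by simp
  then have sum: "summable f" using f by (intro summable_suminf_not_top) auto
  then have "suminf f = L"
    using eq f L by (simp add: suminf_ennreal2 suminf_nonneg)
  then have "f sums L" using sum by (simp add: sums_iff)
  then have "(\<Sum>\<^sub>\<infinity>n. f n) = L"
    using f by (intro infsumI sums_nonneg_imp_has_sum)
  moreover have "(\<Sum>\<^sub>\<infinity>n. f n) = (\<Sum>\<^sub>\<infinity>n\<in>{1..}. f n)"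
    using g by (intro infsum_cong_neutral) (auto simp: f_def not_less_eq_eq)
  ultimately show ?thesis by (simp add: L_def f_def)
qed

context compound_negmult
begin

lemma integral_tower:
  fixes h :: "('i \<Rightarrow> nat) \<Rightarrow> real" and k :: "nat \<Rightarrow> real"
  assumes "\<And>x. 0 \<le> h x" "\<And>n. 0 \<le> k n"
    and "\<And>n. (\<integral>\<^sup>+x. ennreal (h x) \<partial>negmult I (s * n) p) = ennreal (k n)"
  shows "integrable M (\<lambda>\<omega>. h (rvec I X \<omega>)) \<longleftrightarrow> integrable M (\<lambda>\<omega>. k (N \<omega>))"
    and "expectation (\<lambda>\<omega>. h (rvec I X \<omega>)) = expectation (\<lambda>\<omega>. k (N \<omega>))"
proof -
  have meas: "(\<lambda>\<omega>. h (rvec I X \<omega>)) \<in> borel_measurable M"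
    by (rule measurable_compose[OF measurable_rvec]) simp
  have "(\<integral>\<^sup>+\<omega>. ennreal (h (rvec I X \<omega>)) \<partial>M) = (\<integral>\<^sup>+\<omega>. ennreal (k (N \<omega>)) \<partial>M)"
    using tower[of "\<lambda>_ x. ennreal (h x)"] by (simp add: assms(3))
  from integral_transfer[OF meas _ assms(1,2) this]
  show "integrable M (\<lambda>\<omega>. h (rvec I X \<omega>)) \<longleftrightarrow> integrable M (\<lambda>\<omega>. k (N \<omega>))"
    "expectation (\<lambda>\<omega>. h (rvec I X \<omega>)) = expectation (\<lambda>\<omega>. k (N \<omega>))" by simp_all
qed

lemma prob_point:
  shows "\<P>(\<omega> in M. \<forall>i\<in>I. X i \<omega> = x i) = expectation (\<lambda>\<omega>. negmult_weight I (s * N \<omega>) p x)"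
    and "integrable M (\<lambda>\<omega>. negmult_weight I (s * N \<omega>) p x)"
proof -
  \<comment> \<open>only the values of \<open>x\<close> on \<open>I\<close> matter, but singletons of \<open>nat_vectors I\<close> are extensional\<close>
  define y where "y = restrict x I"
  have y: "y \<in> I \<rightarrow>\<^sub>E UNIV" by (simp add: y_def)
  have w: "negmult_weight I n p y = negmult_weight I n p x" for n
    by (simp add: negmult_weight_def y_def cong: prod.cong)
  have mass: "(\<integral>\<^sup>+z. ennreal (indicator {y} z) \<partial>negmult I n p) = ennreal (negmult_weight I n p x)" for n
    using y emeasure_negmult_singleton[OF y, of n p] by (simp add: w ennreal_indicator)
  have nonneg: "0 \<le> negmult_weight I n p x" for n
    by (rule negmult_weight_nonneg[OF probs])
  have ev: "indicator {y} (rvec I X \<omega>) = (indicator {\<omega>\<in>space M. \<forall>i\<in>I. X i \<omega> = x i} \<omega> :: real)"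
    if "\<omega> \<in> space M" for \<omega>
    using that by (auto simp: indicator_def y_def rvec_def fun_eq_iff)
  have S: "{\<omega>\<in>space M. \<forall>i\<in>I. X i \<omega> = x i} \<in> sets M"
  proof (rule sets.sets_Collect_finite_All[OF _ finite_index])
    fix i assume "i \<in> I"
    then have [measurable]: "X i \<in> measurable M (count_space UNIV)" by (rule X)
    show "{\<omega> \<in> space M. X i \<omega> = x i} \<in> sets M" by measurable
  qed
  have "expectation (\<lambda>\<omega>. indicator {y} (rvec I X \<omega>)) = \<P>(\<omega> in M. \<forall>i\<in>I. X i \<omega> = x i)"
    using S by (simp add: ev cong: Bochner_Integration.integral_cong)
  then show "\<P>(\<omega> in M. \<forall>i\<in>I. X i \<omega> = x i) = expectation (\<lambda>\<omega>. negmult_weight I (s * N \<omega>) p x)"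
    using integral_tower(2)[of "indicator {y}" "\<lambda>n. negmult_weight I (s * n) p x"] nonneg
    by (simp add: mass)
  have "integrable M (\<lambda>\<omega>. indicator {y} (rvec I X \<omega>) :: real)"
    using S by (simp add: ev less_top[symmetric] cong: Bochner_Integration.integrable_cong)
  then show "integrable M (\<lambda>\<omega>. negmult_weight I (s * N \<omega>) p x)"
    using integral_tower(1)[of "indicator {y}" "\<lambda>n. negmult_weight I (s * n) p x"] nonneg
    by (simp add: mass)
qed

lemma prob_zero:
  "\<P>(\<omega> in M. \<forall>i\<in>I. X i \<omega> = 0) = pgf1 M (\<lambda>\<omega>. s * N \<omega>) (1 - (\<Sum>i\<in>I. p i))"
  using prob_point(1)[of "\<lambda>_. 0"] by (simp add: negmult_weight_def pgf1_def)

text \<open>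
  For \<open>x\<close> away from the origin the event forces \<open>N \<ge> 1\<close>, so that the sum starts at one.
\<close>

lemma prob_nonzero:
  assumes "s \<ge> 1" "\<exists>i\<in>I. x i \<noteq> 0"
  shows "\<P>(\<omega> in M. \<forall>i\<in>I. X i \<omega> = x i) = (\<Prod>i\<in>I. p i ^ x i)
    * (\<Sum>\<^sub>\<infinity>n\<in>{1..}. multinom I x (s * n - 1) * (1 - (\<Sum>i\<in>I. p i)) ^ (n * s) * \<P>(\<omega> in M. N \<omega> = n))"
proof -
  have "(\<Sum>i\<in>I. x i) \<noteq> 0" using assms(2) finite_index by simp
  then have "negmult_weight I (s * 0) p x = 0"
    by (simp add: negmult_weight_def pochhammer_0_left)
  then have "\<P>(\<omega> in M. \<forall>i\<in>I. X i \<omega> = x i)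
      = (\<Sum>\<^sub>\<infinity>n\<in>{1..}. negmult_weight I (s * n) p x * \<P>(\<omega> in M. N \<omega> = n))"
    unfolding prob_point(1)
    by (intro expectation_eq_infsum N negmult_weight_nonneg probs prob_point(2)) 
  also have "\<dots> = (\<Sum>\<^sub>\<infinity>n\<in>{1..}. (\<Prod>i\<in>I. p i ^ x i)
    * (multinom I x (s * n - 1) * (1 - (\<Sum>i\<in>I. p i)) ^ (n * s) * \<P>(\<omega> in M. N \<omega> = n)))"
  proof (rule infsum_cong)
    fix n :: nat assume "n \<in> {1..}"
    then have "s * n \<ge> 1" using assms(1) by simp
    then show "negmult_weight I (s * n) p x * \<P>(\<omega> in M. N \<omega> = n) = (\<Prod>i\<in>I. p i ^ x i)
      * (multinom I x (s * n - 1) * (1 - (\<Sum>i\<in>I. p i)) ^ (n * s) * \<P>(\<omega> in M. N \<omega> = n))"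
      unfolding negmult_weight_def by (subst pochhammer_eq_multinom) (simp_all add: mult_ac)
  qed
  finally show ?thesis by (simp only: infsum_cmult_right')
qed

lemma marginal_subset:
  assumes "J \<subseteq> I"
  shows "compound_negmult M N J X s (\<lambda>m. p m / (1 - (\<Sum>i\<in>I. p i) + (\<Sum>m\<in>J. p m)))"
  using marginal[of "\<lambda>m. m" J] assms by simp

lemma prob_pair:
  fixes i j defines "p0 \<equiv> 1 - (\<Sum>i\<in>I. p i)"
  defines "D \<equiv> p0 + p i + p j"
  assumes "i \<in> I" "j \<in> I" "i \<noteq> j" "s \<ge> 1"
  shows "\<P>(\<omega> in M. X i \<omega> = 0 \<and> X j \<omega> = 0) = pgf1 M (\<lambda>\<omega>. s * N \<omega>) (p0 / D)"
    and "x \<noteq> 0 \<or> y \<noteq> 0 \<Longrightarrow> \<P>(\<omega> in M. X i \<omega> = x \<and> X j \<omega> = y)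
      = (p i / D) ^ x * (p j / D) ^ y / (fact x * fact y)
        * (\<Sum>\<^sub>\<infinity>n\<in>{1..}. fact (s * n + x + y - 1) / fact (s * n - 1) * (p0 / D) ^ (s * n)
            * \<P>(\<omega> in M. N \<omega> = n))"
proof -
  have sub: "{i, j} \<subseteq> I" using assms by simp
  have D_eq: "p0 + (\<Sum>m\<in>{i, j}. p m) = D" using assms by (simp add: D_def)
  have rest: "1 - (\<Sum>m\<in>{i, j}. p m / D) = p0 / D"
    using success_probs_marginal(2)[OF probs, of "\<lambda>m. m" "{i, j}"] sub D_eq
    by (simp add: p0_def)
  interpret pair: compound_negmult M N "{i, j}" X s "\<lambda>m. p m / D"
    using marginal_subset[OF sub] D_eq by (simp only: p0_def)
  show "\<P>(\<omega> in M. X i \<omega> = 0 \<and> X j \<omega> = 0) = pgf1 M (\<lambda>\<omega>. s * N \<omega>) (p0 / D)"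
    using pair.prob_zero unfolding rest by simp
  assume xy: "x \<noteq> 0 \<or> y \<noteq> 0"
  define z where "z = (\<lambda>_. y)(i := x)"
  have z: "z i = x" "z j = y" using assms by (auto simp: z_def)
  have "\<P>(\<omega> in M. X i \<omega> = x \<and> X j \<omega> = y) = (p i / D) ^ x * (p j / D) ^ y
      * (\<Sum>\<^sub>\<infinity>n\<in>{1..}. multinom {i, j} z (s * n - 1) * (p0 / D) ^ (n * s) * \<P>(\<omega> in M. N \<omega> = n))"
    using pair.prob_nonzero[OF assms(6), of z] xy assms(5) z unfolding rest by auto
  also have "(\<Sum>\<^sub>\<infinity>n\<in>{1..}. multinom {i, j} z (s * n - 1) * (p0 / D) ^ (n * s) * \<P>(\<omega> in M. N \<omega> = n))
      = (\<Sum>\<^sub>\<infinity>n\<in>{1..}. 1 / (fact x * fact y) * (fact (s * n + x + y - 1) / fact (s * n - 1)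
          * (p0 / D) ^ (s * n) * \<P>(\<omega> in M. N \<omega> = n)))"
  proof (rule infsum_cong)
    fix n :: nat assume "n \<in> {1..}"
    then have "1 \<le> s * n" using assms(6) by simp
    then have "x + y + (s * n - 1) = s * n + x + y - 1" by simp
    then show "multinom {i, j} z (s * n - 1) * (p0 / D) ^ (n * s) * \<P>(\<omega> in M. N \<omega> = n)
        = 1 / (fact x * fact y) * (fact (s * n + x + y - 1) / fact (s * n - 1)
          * (p0 / D) ^ (s * n) * \<P>(\<omega> in M. N \<omega> = n))"
      using assms(5) by (simp add: multinom_def z mult.commute)
  qed
  finally show "\<P>(\<omega> in M. X i \<omega> = x \<and> X j \<omega> = y)
      = (p i / D) ^ x * (p j / D) ^ y / (fact x * fact y)
        * (\<Sum>\<^sub>\<infinity>n\<in>{1..}. fact (s * n + x + y - 1) / fact (s * n - 1) * (p0 / D) ^ (s * n)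
            * \<P>(\<omega> in M. N \<omega> = n))"
    unfolding infsum_cmult_right' by simp
qed

lemma prob_single:
  fixes j defines "p0 \<equiv> 1 - (\<Sum>i\<in>I. p i)"
  defines "D \<equiv> p0 + p j"
  assumes "j \<in> I" "s \<ge> 1"
  shows "\<P>(\<omega> in M. X j \<omega> = 0) = pgf1 M (\<lambda>\<omega>. s * N \<omega>) (p0 / D)"
    and "y \<noteq> 0 \<Longrightarrow> \<P>(\<omega> in M. X j \<omega> = y)
      = (p j / D) ^ y / fact y
        * (\<Sum>\<^sub>\<infinity>n\<in>{1..}. fact (s * n + y - 1) / fact (s * n - 1) * (p0 / D) ^ (s * n)
            * \<P>(\<omega> in M. N \<omega> = n))"
proof -
  have sub: "{j} \<subseteq> I" using assms by simp
  have D_eq: "p0 + (\<Sum>m\<in>{j}. p m) = D" by (simp add: D_def)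
  have rest: "1 - (\<Sum>m\<in>{j}. p m / D) = p0 / D"
    using success_probs_marginal(2)[OF probs, of "\<lambda>m. m" "{j}"] sub D_eq
    by (simp add: p0_def)
  interpret single: compound_negmult M N "{j}" X s "\<lambda>m. p m / D"
    using marginal_subset[OF sub] D_eq by (simp only: p0_def)
  show "\<P>(\<omega> in M. X j \<omega> = 0) = pgf1 M (\<lambda>\<omega>. s * N \<omega>) (p0 / D)"
    using single.prob_zero unfolding rest by simp
  assume y: "y \<noteq> 0"
  have "\<P>(\<omega> in M. X j \<omega> = y) = (p j / D) ^ y
      * (\<Sum>\<^sub>\<infinity>n\<in>{1..}. multinom {j} (\<lambda>_. y) (s * n - 1) * (p0 / D) ^ (n * s) * \<P>(\<omega> in M. N \<omega> = n))"
    using single.prob_nonzero[OF assms(4), of "\<lambda>_. y"] y unfolding rest by auto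
  also have "(\<Sum>\<^sub>\<infinity>n\<in>{1..}. multinom {j} (\<lambda>_. y) (s * n - 1) * (p0 / D) ^ (n * s) * \<P>(\<omega> in M. N \<omega> = n))
      = (\<Sum>\<^sub>\<infinity>n\<in>{1..}. 1 / fact y * (fact (s * n + y - 1) / fact (s * n - 1)
          * (p0 / D) ^ (s * n) * \<P>(\<omega> in M. N \<omega> = n)))"
  proof (rule infsum_cong)
    fix n :: nat assume "n \<in> {1..}"
    then have "1 \<le> s * n" using assms(4) by simp
    then have "y + (s * n - 1) = s * n + y - 1" by simp
    then show "multinom {j} (\<lambda>_. y) (s * n - 1) * (p0 / D) ^ (n * s) * \<P>(\<omega> in M. N \<omega> = n)
        = 1 / fact y * (fact (s * n + y - 1) / fact (s * n - 1)
          * (p0 / D) ^ (s * n) * \<P>(\<omega> in M. N \<omega> = n))"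
      by (simp add: multinom_def mult.commute)
  qed
  finally show "\<P>(\<omega> in M. X j \<omega> = y)
      = (p j / D) ^ y / fact y
        * (\<Sum>\<^sub>\<infinity>n\<in>{1..}. fact (s * n + y - 1) / fact (s * n - 1) * (p0 / D) ^ (s * n)
            * \<P>(\<omega> in M. N \<omega> = n))"
    unfolding infsum_cmult_right' by simp
qed

section \<open>Probability generating functions\<close>

text \<open>
  If \<open>N\<close> is not almost surely zero, existence of the generating function of \<open>X\<close> at \<open>z\<close> forces its
  existence for some negative multinomial law with positive parameter, and therefore
  \<open>\<Sum> p i * \<bar>z i\<bar> < 1\<close>. Then the formula holds conditionally on every value of \<open>N\<close>, and it
  can be integrated.
\<close>

lemma pgf_eq:
  assumes "s \<ge> 1" and ex: "pgf_exists M I X z"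
  shows "pgf M I X z
    = pgf1 M (\<lambda>\<omega>. s * N \<omega>) ((1 - (\<Sum>i\<in>I. p i)) / (1 - (\<Sum>i\<in>I. p i * z i)))"
proof -
  note p = success_probsD[OF probs]
  define p0 v w where "p0 = 1 - (\<Sum>i\<in>I. p i)"
    and "v = (\<Sum>i\<in>I. p i * z i)" and "w = (\<Sum>i\<in>I. p i * \<bar>z i\<bar>)"
  define h h' where "h x = (\<Prod>i\<in>I. z i ^ x i)" and "h' x = (\<Prod>i\<in>I. \<bar>z i\<bar> ^ x i)" for x :: "'i \<Rightarrow> nat"
  have p0: "0 < p0" using p by (simp add: p0_def)
  have h': "h' x = \<bar>h x\<bar>" for x by (simp add: h_def h'_def abs_prod power_abs)
  have hX: "(\<Prod>i\<in>I. z i ^ X i \<omega>) = h (rvec I X \<omega>)" for \<omega>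
    by (simp add: h_def rvec_def cong: prod.cong)
  have int: "integrable M (\<lambda>\<omega>. h (rvec I X \<omega>))"
    using ex by (simp add: pgf_exists_def hX)
  show ?thesis
  proof (cases "AE \<omega> in M. N \<omega> = 0")
    case True
    have "(\<integral>\<^sup>+\<omega>. indicator {x. x \<noteq> (\<lambda>i\<in>I. 0)} (rvec I X \<omega>) \<partial>M)
        = (\<integral>\<^sup>+\<omega>. \<integral>\<^sup>+x. indicator {x. x \<noteq> (\<lambda>i\<in>I. 0)} x \<partial>negmult I (s * N \<omega>) p \<partial>M)"
      by (rule tower)
    also have "\<dots> = (\<integral>\<^sup>+\<omega>. 0 \<partial>M)"
      using True by (intro nn_integral_cong_AE) (auto simp: nn_integral_negmult_0[OF p(1)] indicator_def)
    finally have "AE \<omega> in M. indicator {x. x \<noteq> (\<lambda>i\<in>I. 0)} (rvec I X \<omega>) = (0 :: ennreal)"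
      by (subst nn_integral_0_iff_AE[symmetric]) (auto intro: measurable_compose[OF measurable_rvec])
    then have "AE \<omega> in M. rvec I X \<omega> = (\<lambda>i\<in>I. 0)"
      by eventually_elim (simp add: indicator_eq_0_iff)
    then have "AE \<omega> in M. h (rvec I X \<omega>) = 1"
      by eventually_elim (simp add: h_def)
    then have "expectation (\<lambda>\<omega>. h (rvec I X \<omega>)) = expectation (\<lambda>_. 1)"
      using int by (intro integral_cong_AE) auto
    moreover have "expectation (\<lambda>\<omega>. (p0 / (1 - v)) ^ (s * N \<omega>)) = expectation (\<lambda>_. 1)"
      using True by (intro integral_cong_AE) auto
    ultimately show ?thesis by (simp add: pgf_def pgf1_def hX p0_def v_def)
  next
    case False
    have abs_tower: "(\<integral>\<^sup>+\<omega>. \<integral>\<^sup>+x. ennreal (h' x) \<partial>negmult I (s * N \<omega>) p \<partial>M) < \<infinity>"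
    proof -
      have "(\<integral>\<^sup>+\<omega>. ennreal (h' (rvec I X \<omega>)) \<partial>M) < \<infinity>"
        using int by (simp add: h' integrable_iff_bounded)
      then show ?thesis by (simp add: tower[of "\<lambda>_ x. ennreal (h' x)"])
    qed
    then have "AE \<omega> in M. (\<integral>\<^sup>+x. ennreal (h' x) \<partial>negmult I (s * N \<omega>) p) \<noteq> \<infinity>"
      by (intro nn_integral_PInf_AE) (auto intro: measurable_compose[OF N])
    then have "\<exists>n\<ge>1. (\<integral>\<^sup>+x. ennreal (h' x) \<partial>negmult I (s * n) p) \<noteq> \<infinity>"
    proof (rule contrapos_pp)
      assume "\<not> (\<exists>n\<ge>1. (\<integral>\<^sup>+x. ennreal (h' x) \<partial>negmult I (s * n) p) \<noteq> \<infinity>)"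
      then have N0: "N \<omega> = 0" if "(\<integral>\<^sup>+x. ennreal (h' x) \<partial>negmult I (s * N \<omega>) p) \<noteq> \<infinity>" for \<omega>
        using that by (metis less_one not_le)
      show "\<not> (AE \<omega> in M. (\<integral>\<^sup>+x. ennreal (h' x) \<partial>negmult I (s * N \<omega>) p) \<noteq> \<infinity>)"
      proof
        assume "AE \<omega> in M. (\<integral>\<^sup>+x. ennreal (h' x) \<partial>negmult I (s * N \<omega>) p) \<noteq> \<infinity>"
        then have "AE \<omega> in M. N \<omega> = 0" by eventually_elim (rule N0)
        with False show False by contradiction
      qed
    qed
    then obtain n where n: "n \<ge> 1" "(\<integral>\<^sup>+x. ennreal (h' x) \<partial>negmult I (s * n) p) \<noteq> \<infinity>" by blast
    have w1: "w < 1"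
      unfolding w_def using n assms(1) by (intro negmult_pgf_radius[OF probs, of "s * n"]) (auto simp: h'_def)
    have vw: "\<bar>v\<bar> \<le> w" unfolding v_def w_def
      using p by (intro order.trans[OF sum_abs] sum_mono) (simp add: abs_mult)
    \<comment> \<open>the arguments that belong to \<open>h\<close> and to \<open>\<bar>h\<bar>\<close>\<close>
    define a b where "a = p0 / (1 - v)" and "b = p0 / (1 - w)"
    have ab: "0 < a" "a \<le> b"
      using vw w1 p0 unfolding a_def b_def by (auto intro!: divide_left_mono mult_pos_pos)
    have sum_tower: "(\<integral>\<^sup>+x. ennreal (h x + h' x) \<partial>negmult I (s * n) p) = ennreal (a ^ (s * n) + b ^ (s * n))" for n
      using w1 unfolding h_def h'_def a_def b_def p0_def v_def w_def
      by (intro nn_integral_negmult_pgf[OF probs])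
    have abs_tower: "(\<integral>\<^sup>+x. ennreal (h' x) \<partial>negmult I (s * n) p) = ennreal (b ^ (s * n))" for n
    proof -
      have "2 * (\<integral>\<^sup>+x. ennreal (h' x) \<partial>negmult I (s * n) p)
          = (\<integral>\<^sup>+x. 2 * ennreal (h' x) \<partial>negmult I (s * n) p)"
        by (rule nn_integral_cmult[symmetric]) simp
      also have "\<dots> = (\<integral>\<^sup>+x. ennreal (h' x + h' x) \<partial>negmult I (s * n) p)"
        by (simp only: h' ennreal_plus[OF abs_ge_zero abs_ge_zero] mult_2)
      also have "\<dots> = ennreal (b ^ (s * n) + b ^ (s * n))"
        using w1 nn_integral_negmult_pgf[OF probs, of "\<lambda>i. \<bar>z i\<bar>" "s * n"]
        unfolding h'_def b_def p0_def w_def abs_idempotent by simp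
      also have "\<dots> = 2 * ennreal (b ^ (s * n))"
        using ab by (subst mult_2, subst ennreal_plus) simp_all
      finally show ?thesis
        by (simp add: ennreal_mult_cancel_left)
    qed
    have h'_nonneg: "0 \<le> h' x" and sum_nonneg: "0 \<le> h x + h' x" for x
      using abs_ge_minus_self[of "h x"] by (simp_all add: h')
    have b_nonneg: "0 \<le> b ^ (s * n)" and ab_nonneg: "0 \<le> a ^ (s * n) + b ^ (s * n)" for n
      using ab by simp_all
    have inth': "integrable M (\<lambda>\<omega>. h' (rvec I X \<omega>))"
      unfolding h' using int by (rule integrable_abs)
    then have intb: "integrable M (\<lambda>\<omega>. b ^ (s * N \<omega>))"
      using integral_tower(1)[OF h'_nonneg b_nonneg abs_tower] by simp
    have "\<bar>a ^ m\<bar> \<le> \<bar>b ^ m\<bar>" for m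
      using ab by (simp add: power_mono)
    then have inta: "integrable M (\<lambda>\<omega>. a ^ (s * N \<omega>))"
      by (intro Bochner_Integration.integrable_bound[OF intb]) auto
    have "expectation (\<lambda>\<omega>. h (rvec I X \<omega>)) + expectation (\<lambda>\<omega>. h' (rvec I X \<omega>))
        = expectation (\<lambda>\<omega>. h (rvec I X \<omega>) + h' (rvec I X \<omega>))"
      using int inth' by simp
    also have "\<dots> = expectation (\<lambda>\<omega>. a ^ (s * N \<omega>) + b ^ (s * N \<omega>))"
      by (rule integral_tower(2)[OF sum_nonneg ab_nonneg sum_tower])
    also have "\<dots> = expectation (\<lambda>\<omega>. a ^ (s * N \<omega>)) + expectation (\<lambda>\<omega>. b ^ (s * N \<omega>))"
      using inta intb by simp
    also have "expectation (\<lambda>\<omega>. b ^ (s * N \<omega>)) = expectation (\<lambda>\<omega>. h' (rvec I X \<omega>))"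
      by (rule integral_tower(2)[OF h'_nonneg b_nonneg abs_tower, symmetric])
    finally have "expectation (\<lambda>\<omega>. h (rvec I X \<omega>)) = expectation (\<lambda>\<omega>. a ^ (s * N \<omega>))"
      by simp
    then show ?thesis by (simp add: pgf_def pgf1_def hX a_def p0_def v_def)
  qed
qed

section \<open>Moments, dispersion and correlation\<close>

lemma mean_eq:
  assumes "i \<in> I"
  shows "mean M (X i) = real s * (p i / (1 - (\<Sum>i\<in>I. p i))) * mean M N"
proof -
  note p = success_probsD[OF probs]
  have "mean M (X i) = expectation (\<lambda>\<omega>. real (rvec I X \<omega> i))"
    using assms by (simp add: mean_def rvec_def)
  also have "\<dots> = expectation (\<lambda>\<omega>. real (s * N \<omega>) * (p i / (1 - (\<Sum>i\<in>I. p i))))"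
    using p assms by (intro integral_tower(2)) (auto simp: nn_integral_negmult_mean[OF probs])
  also have "\<dots> = expectation (\<lambda>\<omega>. real s * (p i / (1 - (\<Sum>i\<in>I. p i))) * real (N \<omega>))"
    by (intro Bochner_Integration.integral_cong) (auto simp: mult_ac)
  finally show ?thesis by (simp add: mean_def)
qed

lemma square_tower:
  fixes i defines "a \<equiv> p i / (1 - (\<Sum>i\<in>I. p i))"
  assumes "i \<in> I"
  shows "integrable M (\<lambda>\<omega>. (real (X i \<omega>))\<^sup>2)
      \<longleftrightarrow> integrable M (\<lambda>\<omega>. real (s * N \<omega>) * a * (1 + real (Suc (s * N \<omega>)) * a))"
    and "expectation (\<lambda>\<omega>. (real (X i \<omega>))\<^sup>2)
      = expectation (\<lambda>\<omega>. real (s * N \<omega>) * a * (1 + real (Suc (s * N \<omega>)) * a))"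
proof -
  note p = success_probsD[OF probs]
  have a: "0 \<le> a" using p assms by (simp add: a_def)
  have X_eq: "real (X i \<omega>) = real (rvec I X \<omega> i)" for \<omega>
    using assms by (simp add: rvec_def)
  have sq: "(\<integral>\<^sup>+x. ennreal ((real (x i))\<^sup>2) \<partial>negmult I (s * n) p)
      = ennreal (real (s * n) * a * (1 + real (Suc (s * n)) * a))" for n
    unfolding a_def by (rule nn_integral_negmult_square[OF probs assms(2)])
  have nonneg: "0 \<le> real (s * n) * a * (1 + real (Suc (s * n)) * a)" for n
    using a by (intro mult_nonneg_nonneg add_nonneg_nonneg) auto
  show "integrable M (\<lambda>\<omega>. (real (X i \<omega>))\<^sup>2)
      \<longleftrightarrow> integrable M (\<lambda>\<omega>. real (s * N \<omega>) * a * (1 + real (Suc (s * N \<omega>)) * a))"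
    unfolding X_eq by (rule integral_tower(1)[OF _ nonneg sq]) simp
  show "expectation (\<lambda>\<omega>. (real (X i \<omega>))\<^sup>2)
      = expectation (\<lambda>\<omega>. real (s * N \<omega>) * a * (1 + real (Suc (s * N \<omega>)) * a))"
    unfolding X_eq by (rule integral_tower(2)[OF _ nonneg sq]) simp
qed

lemma square_integrable_count:
  assumes "integrable M (\<lambda>\<omega>. (real (N \<omega>))\<^sup>2)"
  shows "integrable M (\<lambda>\<omega>. real (N \<omega>))"
  by (rule square_integrable_imp_integrable[OF _ assms]) measurable

lemma square_integrable_component:
  assumes "i \<in> I" "integrable M (\<lambda>\<omega>. (real (N \<omega>))\<^sup>2)"
  shows "integrable M (\<lambda>\<omega>. (real (X i \<omega>))\<^sup>2)"
proof -
  define a where "a = p i / (1 - (\<Sum>i\<in>I. p i))"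
  have "integrable M (\<lambda>\<omega>. real s * a * (1 + a) * real (N \<omega>) + (real s * a)\<^sup>2 * (real (N \<omega>))\<^sup>2)"
    using assms square_integrable_count by (intro Bochner_Integration.integrable_add integrable_mult_right)
  also have "(\<lambda>\<omega>. real s * a * (1 + a) * real (N \<omega>) + (real s * a)\<^sup>2 * (real (N \<omega>))\<^sup>2)
      = (\<lambda>\<omega>. real (s * N \<omega>) * a * (1 + real (Suc (s * N \<omega>)) * a))"
    by (simp add: fun_eq_iff algebra_simps power2_eq_square)
  finally show ?thesis unfolding square_tower(1)[OF assms(1)] a_def .
qed

text \<open>
  The conditional second moment of \<open>X i\<close> given \<open>N\<close> dominates a positive multiple of the square
  of \<open>N\<close>.
\<close>

lemma square_integrable_count_of_component:
  assumes "i \<in> I" "0 < p i" "s \<ge> 1" "integrable M (\<lambda>\<omega>. (real (X i \<omega>))\<^sup>2)"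
  shows "integrable M (\<lambda>\<omega>. (real (N \<omega>))\<^sup>2)"
proof -
  define a where "a = p i / (1 - (\<Sum>i\<in>I. p i))"
  have a: "0 < a" using assms success_probsD(5)[OF probs] by (simp add: a_def)
  let ?k = "\<lambda>\<omega>. real (s * N \<omega>) * a * (1 + real (Suc (s * N \<omega>)) * a)"
  have "integrable M ?k"
    using assms(4) unfolding square_tower(1)[OF assms(1)] a_def .
  then have int: "integrable M (\<lambda>\<omega>. ?k \<omega> / (real s * a)\<^sup>2)" by (rule integrable_divide)
  show ?thesis
  proof (rule Bochner_Integration.integrable_bound[OF int])
    have le: "(real n)\<^sup>2 \<le> real (s * n) * a * (1 + real (Suc (s * n)) * a) / (real s * a)\<^sup>2" for n
    proof -
      have "real (s * n) * a * (1 + real (Suc (s * n)) * a)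
          = (real s * a)\<^sup>2 * (real n)\<^sup>2 + real (s * n) * a * (1 + a)"
        by (simp add: algebra_simps power2_eq_square)
      then have "(real s * a)\<^sup>2 * (real n)\<^sup>2 \<le> real (s * n) * a * (1 + real (Suc (s * n)) * a)"
        using a by simp
      then show ?thesis using a assms(3) by (simp add: pos_le_divide_eq mult.commute)
    qed
    show "AE \<omega> in M. norm ((real (N \<omega>))\<^sup>2) \<le> norm (?k \<omega> / (real s * a)\<^sup>2)"
      unfolding real_norm_def abs_power2 by (intro AE_I2 order_trans[OF le abs_ge_self])
  qed simp
qed

lemma var_eq:
  assumes "i \<in> I" "integrable M (\<lambda>\<omega>. (real (N \<omega>))\<^sup>2)"
  defines "a \<equiv> p i / (1 - (\<Sum>i\<in>I. p i))"
  shows "var M (X i) = real s * a * (real s * a * var M N + (1 + a) * mean M N)"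
proof -
  have intN: "integrable M (\<lambda>\<omega>. real (N \<omega>))" by (rule square_integrable_count[OF assms(2)])
  have [measurable]: "X i \<in> measurable M (count_space UNIV)" by (rule X[OF assms(1)])
  have int2: "integrable M (\<lambda>\<omega>. (real (X i \<omega>))\<^sup>2)" by (rule square_integrable_component[OF assms(1,2)])
  have int1: "integrable M (\<lambda>\<omega>. real (X i \<omega>))"
    by (rule square_integrable_imp_integrable[OF _ int2]) measurable
  have "expectation (\<lambda>\<omega>. (real (X i \<omega>))\<^sup>2)
      = expectation (\<lambda>\<omega>. real s * a * (1 + a) * real (N \<omega>) + (real s * a)\<^sup>2 * (real (N \<omega>))\<^sup>2)"
    unfolding square_tower(2)[OF assms(1)] a_def[symmetric]
    by (intro Bochner_Integration.integral_cong) (auto simp: algebra_simps power2_eq_square)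
  also have "\<dots> = real s * a * (1 + a) * mean M N + (real s * a)\<^sup>2 * expectation (\<lambda>\<omega>. (real (N \<omega>))\<^sup>2)"
    using intN assms(2) by (simp add: mean_def)
  finally have sq: "expectation (\<lambda>\<omega>. (real (X i \<omega>))\<^sup>2)
      = real s * a * (1 + a) * mean M N + (real s * a)\<^sup>2 * expectation (\<lambda>\<omega>. (real (N \<omega>))\<^sup>2)" .
  have vX: "var M (X i) = expectation (\<lambda>\<omega>. (real (X i \<omega>))\<^sup>2) - (mean M (X i))\<^sup>2"
    unfolding var_def mean_def by (rule variance_eq[OF int1 int2])
  have vN: "var M N = expectation (\<lambda>\<omega>. (real (N \<omega>))\<^sup>2) - (mean M N)\<^sup>2"
    unfolding var_def mean_def by (rule variance_eq[OF intN assms(2)])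
  show ?thesis
    unfolding vX vN sq mean_eq[OF assms(1)] a_def[symmetric] by algebra
qed

text \<open>
  Given \<open>N\<close>, the size-bias identity makes the mixed second moment
  \<open>a * b * (s N) * (s N + 1)\<close>, that is \<open>a * b\<close> times \<open>(s N)\<^sup>2 + s N\<close>. The square gives the
  covariance inherited from the common count \<open>N\<close>, the linear part the summand
  \<^term>\<open>mean M N\<close>.
\<close>

lemma cov_eq:
  assumes "i \<in> I" "j \<in> I" "i \<noteq> j" "integrable M (\<lambda>\<omega>. (real (N \<omega>))\<^sup>2)"
  defines "a \<equiv> p i / (1 - (\<Sum>i\<in>I. p i))" and "b \<equiv> p j / (1 - (\<Sum>i\<in>I. p i))"
  shows "cov M (X i) (X j) = real s * a * b * (real s * var M N + mean M N)"
proof -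
  note p = success_probsD[OF probs]
  have ab: "0 \<le> a" "0 \<le> b" using p assms by (auto simp: a_def b_def)
  have intN: "integrable M (\<lambda>\<omega>. real (N \<omega>))" by (rule square_integrable_count[OF assms(4)])
  have int1: "integrable M (\<lambda>\<omega>. real (X l \<omega>))" if "l \<in> I" for l
  proof -
    have [measurable]: "X l \<in> measurable M (count_space UNIV)" by (rule X[OF that])
    show ?thesis
      by (rule square_integrable_imp_integrable[OF _ square_integrable_component[OF that assms(4)]])
         measurable
  qed
  have X_eq: "real (X i \<omega>) * real (X j \<omega>) = real (rvec I X \<omega> i) * real (rvec I X \<omega> j)" for \<omega>
    using assms by (simp add: rvec_def)
  have prod: "(\<integral>\<^sup>+x. ennreal (real (x i) * real (x j)) \<partial>negmult I (s * n) p)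
      = ennreal (real (s * n) * a * (real (Suc (s * n)) * b))" for n
    unfolding a_def b_def by (rule nn_integral_negmult_product[OF probs assms(1-3)])
  have nonneg: "0 \<le> real (s * n) * a * (real (Suc (s * n)) * b)" for n
    using ab by (intro mult_nonneg_nonneg) auto
  have k_eq: "(\<lambda>\<omega>. real (s * N \<omega>) * a * (real (Suc (s * N \<omega>)) * b))
      = (\<lambda>\<omega>. real s * a * b * real (N \<omega>) + (real s)\<^sup>2 * a * b * (real (N \<omega>))\<^sup>2)"
    by (simp add: fun_eq_iff algebra_simps power2_eq_square)
  have intk: "integrable M (\<lambda>\<omega>. real (s * N \<omega>) * a * (real (Suc (s * N \<omega>)) * b))"
    unfolding k_eq using intN assms(4)
    by (intro Bochner_Integration.integrable_add integrable_mult_right)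
  have intXX: "integrable M (\<lambda>\<omega>. real (X i \<omega>) * real (X j \<omega>))"
    unfolding X_eq using integral_tower(1)[OF _ nonneg prod] intk by simp
  have "expectation (\<lambda>\<omega>. real (X i \<omega>) * real (X j \<omega>))
      = expectation (\<lambda>\<omega>. real (s * N \<omega>) * a * (real (Suc (s * N \<omega>)) * b))"
    unfolding X_eq by (rule integral_tower(2)[OF _ nonneg prod]) simp
  also have "\<dots> = real s * a * b * mean M N + (real s)\<^sup>2 * a * b * expectation (\<lambda>\<omega>. (real (N \<omega>))\<^sup>2)"
    unfolding k_eq using intN assms(4) by (simp add: mean_def)
  finally have XX: "expectation (\<lambda>\<omega>. real (X i \<omega>) * real (X j \<omega>))
      = real s * a * b * mean M N + (real s)\<^sup>2 * a * b * expectation (\<lambda>\<omega>. (real (N \<omega>))\<^sup>2)" .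
  have "cov M (X i) (X j) = expectation (\<lambda>\<omega>. real (X i \<omega>) * real (X j \<omega>)
      - mean M (X j) * real (X i \<omega>) - mean M (X i) * real (X j \<omega>) + mean M (X i) * mean M (X j))"
    unfolding cov_def by (intro Bochner_Integration.integral_cong) (auto simp: algebra_simps)
  also have "\<dots> = expectation (\<lambda>\<omega>. real (X i \<omega>) * real (X j \<omega>)) - mean M (X i) * mean M (X j)"
    using intXX int1 assms(1,2) by (simp add: mean_def prob_space)
  finally have c: "cov M (X i) (X j)
      = expectation (\<lambda>\<omega>. real (X i \<omega>) * real (X j \<omega>)) - mean M (X i) * mean M (X j)" .
  have vN: "var M N = expectation (\<lambda>\<omega>. (real (N \<omega>))\<^sup>2) - (mean M N)\<^sup>2"
    unfolding var_def mean_def by (rule variance_eq[OF intN assms(4)])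
  show ?thesis
    unfolding c XX vN mean_eq[OF assms(1)] mean_eq[OF assms(2)] a_def[symmetric] b_def[symmetric]
    by algebra
qed

lemma FI_eq:
  assumes "i \<in> I" "s \<ge> 1" "0 < p i" "integrable M (\<lambda>\<omega>. (real (N \<omega>))\<^sup>2)" "mean M N \<noteq> 0"
  shows "FI M (X i) = 1 + p i / (1 - (\<Sum>i\<in>I. p i)) * (real s * FI M N + 1)"
proof -
  define a where "a = p i / (1 - (\<Sum>i\<in>I. p i))"
  have a: "0 < a" using assms success_probsD(5)[OF probs] by (simp add: a_def)
  show ?thesis
    unfolding FI_def var_eq[OF assms(1,4)] mean_eq[OF assms(1)] a_def[symmetric]
    using a assms(2,5) by (simp add: field_simps)
qed

text \<open>
  With \<open>K = s * var M N + mean M N\<close>, the excess of each dispersion index over one is a multiple of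
  \<open>K / mean M N\<close>, and the covariance is a multiple of \<open>K\<close>; the multiples match after squaring.
\<close>

lemma cor_eq:
  assumes "i \<in> I" "j \<in> I" "i \<noteq> j" "s \<ge> 1" "0 < p i" "0 < p j"
    and "integrable M (\<lambda>\<omega>. (real (X i \<omega>))\<^sup>2)" "mean M (X i) \<noteq> 0"
  shows "cor M (X i) (X j)
    = sqrt ((FI M (X i) - 1) * (FI M (X j) - 1) / (FI M (X i) * FI M (X j)))"
proof -
  define p0 where "p0 = 1 - (\<Sum>i\<in>I. p i)"
  define a b where "a = p i / p0" and "b = p j / p0"
  have ab: "0 < a" "0 < b"
    using assms success_probsD(5)[OF probs] by (simp_all add: a_def b_def p0_def)
  have int: "integrable M (\<lambda>\<omega>. (real (N \<omega>))\<^sup>2)"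
    by (rule square_integrable_count_of_component[OF assms(1,5,4,7)])
  have mN: "mean M N \<noteq> 0" using assms(8) mean_eq[OF assms(1)] by auto
  define K where "K = real s * var M N + mean M N"
  have "0 \<le> mean M N" "0 \<le> var M N" unfolding mean_def var_def by simp_all
  then have K: "0 \<le> K" by (simp add: K_def)
  have FI': "FI M (X i) - 1 = a * K / mean M N" "FI M (X j) - 1 = b * K / mean M N"
    using mN unfolding FI_eq[OF assms(1,4,5) int mN] FI_eq[OF assms(2,4,6) int mN]
    by (simp_all add: a_def b_def p0_def K_def FI_def[of M N] field_simps)
  have m: "mean M (X i) = real s * a * mean M N" "mean M (X j) = real s * b * mean M N"
    by (simp_all add: mean_eq assms a_def b_def p0_def)
  have FI2: "FI M (X i) * FI M (X j)
      = (var M (X i) * var M (X j)) / ((real s * a * mean M N) * (real s * b * mean M N))"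
    by (simp add: FI_def m)
  have "(FI M (X i) - 1) * (FI M (X j) - 1) / (FI M (X i) * FI M (X j))
      = (real s * a * b * K)\<^sup>2 / (var M (X i) * var M (X j))"
    unfolding FI' FI2 using mN by (simp add: power2_eq_square)
  then have "sqrt ((FI M (X i) - 1) * (FI M (X j) - 1) / (FI M (X i) * FI M (X j)))
      = (real s * a * b * K) / sqrt (var M (X i) * var M (X j))"
    using K ab by (simp add: real_sqrt_divide)
  then show ?thesis
    unfolding cor_def cov_eq[OF assms(1-3) int] by (simp add: a_def b_def p0_def K_def)
qed

section \<open>Conditional means and conditional laws\<close>

text \<open>
  The size-bias identity restricted to an event about coordinate \<open>j\<close>. On the right-hand side the
  index \<open>i\<close> enters only through the factor \<open>p i\<close> and through the shift of coordinate \<open>i\<close>.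
\<close>

lemma nn_integral_size_bias_indicator:
  assumes "i \<in> I" "j \<in> I"
  shows "(\<integral>\<^sup>+\<omega>. of_nat (X i \<omega>) * indicator {b} (X j \<omega>) \<partial>M)
    = (\<integral>\<^sup>+\<omega>. ennreal (real (s * N \<omega>) * (p i / (1 - (\<Sum>i\<in>I. p i))))
        * (\<integral>\<^sup>+x. indicator {b} ((x(i := Suc (x i))) j) \<partial>negmult I (Suc (s * N \<omega>)) p) \<partial>M)"
proof -
  have "(\<integral>\<^sup>+\<omega>. of_nat (X i \<omega>) * indicator {b} (X j \<omega>) \<partial>M)
      = (\<integral>\<^sup>+\<omega>. of_nat (rvec I X \<omega> i) * indicator {b} (rvec I X \<omega> j) \<partial>M)"
    using assms by (simp add: rvec_def)
  also have "\<dots> = (\<integral>\<^sup>+\<omega>. \<integral>\<^sup>+x. of_nat (x i) * indicator {b} (x j) \<partial>negmult I (s * N \<omega>) p \<partial>M)"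
    by (rule tower)
  finally show ?thesis
    unfolding nn_integral_negmult_size_bias[OF probs assms(1)] .
qed

text \<open>
  For \<open>i \<noteq> j\<close> the shift of coordinate \<open>i\<close> does not affect the event \<open>x j = b\<close>, whereas the shift of
  coordinate \<open>j\<close> turns \<open>x j = b + 1\<close> into \<open>x j = b\<close>. So the expectations of \<open>X i\<close> on \<open>X j = b\<close> and of
  \<open>X j\<close> on \<open>X j = b + 1\<close> differ by the factor \<open>p i / p j\<close> only, and the latter is \<open>b + 1\<close> times a
  probability.
\<close>

lemma cond_mean_eq:
  assumes "i \<in> I" "j \<in> I" "i \<noteq> j" "0 < p j" "0 < \<P>(\<omega> in M. X j \<omega> = b)"
  shows "cond_mean M (X i) (\<lambda>\<omega>. X j \<omega> = b)
    = p i / p j * real (b + 1) * (\<P>(\<omega> in M. X j \<omega> = b + 1) / \<P>(\<omega> in M. X j \<omega> = b))"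
proof -
  note p = success_probsD[OF probs]
  have [measurable]: "X i \<in> measurable M (count_space UNIV)" "X j \<in> measurable M (count_space UNIV)"
    by (rule X, fact)+
  define p0 where "p0 = 1 - (\<Sum>i\<in>I. p i)"
  define A where "A = {\<omega>\<in>space M. X j \<omega> = b}"
  have A: "A \<in> sets M" unfolding A_def by measurable
  have p0: "0 < p0" using p by (simp add: p0_def)
  have ratio: "0 \<le> p i / p j" using p assms by simp
  define e where "e n = (\<integral>\<^sup>+x. indicator {b} (x j) \<partial>negmult I (Suc (s * n)) p)" for n
  have "(\<integral>\<^sup>+\<omega>. ennreal (real (X i \<omega>)) * indicator A \<omega> \<partial>M)
      = (\<integral>\<^sup>+\<omega>. of_nat (X i \<omega>) * indicator {b} (X j \<omega>) \<partial>M)"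
    by (intro nn_integral_cong) (auto simp: A_def indicator_def ennreal_of_nat_eq_real_of_nat)
  also have "\<dots> = (\<integral>\<^sup>+\<omega>. ennreal (real (s * N \<omega>) * (p i / p0)) * e (N \<omega>) \<partial>M)"
    unfolding nn_integral_size_bias_indicator[OF assms(1,2)] using assms(3)
    by (simp add: p0_def e_def)
  also have "\<dots> = (\<integral>\<^sup>+\<omega>. ennreal (p i / p j) * (ennreal (real (s * N \<omega>) * (p j / p0)) * e (N \<omega>)) \<partial>M)"
  proof (rule nn_integral_cong)
    fix \<omega>
    have "real (s * N \<omega>) * (p i / p0) = p i / p j * (real (s * N \<omega>) * (p j / p0))"
      using assms(4) p0 by (simp add: field_simps)
    then show "ennreal (real (s * N \<omega>) * (p i / p0)) * e (N \<omega>)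
        = ennreal (p i / p j) * (ennreal (real (s * N \<omega>) * (p j / p0)) * e (N \<omega>))"
      by (simp only: ennreal_mult'[OF ratio] mult.assoc)
  qed
  also have "\<dots> = ennreal (p i / p j) * (\<integral>\<^sup>+\<omega>. ennreal (real (s * N \<omega>) * (p j / p0)) * e (N \<omega>) \<partial>M)"
    by (rule nn_integral_cmult) (auto intro: measurable_compose[OF N])
  also have "(\<integral>\<^sup>+\<omega>. ennreal (real (s * N \<omega>) * (p j / p0)) * e (N \<omega>) \<partial>M)
      = (\<integral>\<^sup>+\<omega>. of_nat (X j \<omega>) * indicator {b + 1} (X j \<omega>) \<partial>M)"
  proof -
    have "(indicator {b + 1} (Suc m) :: ennreal) = indicator {b} m" for m
      by (simp add: indicator_def)
    then show ?thesis
      unfolding nn_integral_size_bias_indicator[OF assms(2,2)] by (simp add: p0_def e_def)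
  qed
  also have "\<dots> = (\<integral>\<^sup>+\<omega>. of_nat (b + 1) * indicator {\<omega>\<in>space M. X j \<omega> = b + 1} \<omega> \<partial>M)"
    by (intro nn_integral_cong) (auto simp: indicator_def)
  also have "\<dots> = of_nat (b + 1) * emeasure M {\<omega>\<in>space M. X j \<omega> = b + 1}"
    by (rule nn_integral_cmult_indicator) measurable
  also have "ennreal (p i / p j) * \<dots> = ennreal (p i / p j * real (b + 1) * \<P>(\<omega> in M. X j \<omega> = b + 1))"
    using ratio by (simp only: emeasure_eq_measure ennreal_of_nat_eq_real_of_nat[symmetric]
        ennreal_mult' mult_nonneg_nonneg of_nat_0_le_iff measure_nonneg mult.assoc)
  finally have *: "(\<integral>\<^sup>+\<omega>. ennreal (real (X i \<omega>)) * indicator A \<omega> \<partial>M)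
      = ennreal (p i / p j * real (b + 1) * \<P>(\<omega> in M. X j \<omega> = b + 1))" .
  have nonneg: "0 \<le> p i / p j * real (b + 1) * \<P>(\<omega> in M. X j \<omega> = b + 1)"
    using ratio by (intro mult_nonneg_nonneg) auto
  have "cond_mean M (X i) (\<lambda>\<omega>. X j \<omega> = b)
      = enn2real (\<integral>\<^sup>+\<omega>. ennreal (real (X i \<omega>)) \<partial>uniform_measure M A)"
    unfolding cond_mean_def mean_def A_def[symmetric]
    by (rule integral_eq_nn_integral) auto
  also have "\<dots> = enn2real (ennreal (p i / p j * real (b + 1) * \<P>(\<omega> in M. X j \<omega> = b + 1)) / emeasure M A)"
    using A by (subst nn_integral_uniform_measure) (auto simp only: *, measurable)
  also have "\<dots> = p i / p j * real (b + 1) * \<P>(\<omega> in M. X j \<omega> = b + 1) / \<P>(\<omega> in M. X j \<omega> = b)"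
    using assms(5)
    by (subst emeasure_eq_measure, subst divide_ennreal[OF nonneg])
       (simp_all only: A_def enn2real_ennreal divide_nonneg_pos[OF nonneg])
  finally show ?thesis by simp
qed

text \<open>
  Given \<open>N\<close> and the total, the coordinate is binomial with parameters that do not involve \<open>N\<close>, so
  the binomial probability comes out of the integral over \<open>N\<close>.
\<close>

lemma cond_law_eq:
  assumes "i \<in> I" "0 < (\<Sum>i\<in>I. p i)" "0 < \<P>(\<omega> in M. (\<Sum>i\<in>I. X i \<omega>) = j)"
  shows "cond_law M (X i) (\<lambda>\<omega>. (\<Sum>i\<in>I. X i \<omega>) = j)
    = measure_pmf (binomial_pmf j (p i / (\<Sum>i\<in>I. p i)))"
proof (rule measure_eqI_countable[where A = UNIV])
  have X' [measurable]: "X l \<in> measurable M (count_space UNIV)" if "l \<in> I" for l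
    by (rule X[OF that])
  have Xi [measurable]: "X i \<in> measurable M (count_space UNIV)" by (rule X[OF assms(1)])
  define B where "B = {\<omega>\<in>space M. (\<Sum>i\<in>I. X i \<omega>) = j}"
  have B: "B \<in> sets M" unfolding B_def by measurable
  let ?pmf = "pmf (binomial_pmf j (p i / (\<Sum>i\<in>I. p i)))"
  fix a
  have sum_eq: "(\<Sum>i\<in>I. X i \<omega>) = (\<Sum>i\<in>I. rvec I X \<omega> i)" for \<omega> by (simp add: rvec_def)
  have C: "B \<inter> (X i -` {a} \<inter> space M) \<in> sets M"
    using B measurable_sets[OF Xi, of "{a}"] by auto
  have "emeasure M (B \<inter> (X i -` {a} \<inter> space M))
      = (\<integral>\<^sup>+\<omega>. indicator (B \<inter> (X i -` {a} \<inter> space M)) \<omega> \<partial>M)"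
    using C by simp
  also have "\<dots> = (\<integral>\<^sup>+\<omega>. (if rvec I X \<omega> i = a \<and> (\<Sum>i\<in>I. rvec I X \<omega> i) = j then 1 else 0) \<partial>M)"
    using assms(1) by (intro nn_integral_cong) (auto simp: indicator_def B_def rvec_def)
  also have "\<dots> = (\<integral>\<^sup>+\<omega>. \<integral>\<^sup>+x. (if x i = a \<and> (\<Sum>i\<in>I. x i) = j then 1 else 0) \<partial>negmult I (s * N \<omega>) p \<partial>M)"
    by (rule tower)
  also have "\<dots> = (\<integral>\<^sup>+\<omega>. ennreal (?pmf a) *
      (\<integral>\<^sup>+x. (if (\<Sum>i\<in>I. x i) = j then 1 else 0) \<partial>negmult I (s * N \<omega>) p) \<partial>M)"
    by (simp only: nn_integral_negmult_coordinate_total[OF probs assms(1,2)])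
  also have "\<dots> = ennreal (?pmf a) *
      (\<integral>\<^sup>+\<omega>. \<integral>\<^sup>+x. (if (\<Sum>i\<in>I. x i) = j then 1 else 0) \<partial>negmult I (s * N \<omega>) p \<partial>M)"
    by (rule nn_integral_cmult) (rule measurable_compose[OF N], simp)
  also have "(\<integral>\<^sup>+\<omega>. \<integral>\<^sup>+x. (if (\<Sum>i\<in>I. x i) = j then 1 else 0) \<partial>negmult I (s * N \<omega>) p \<partial>M)
      = (\<integral>\<^sup>+\<omega>. (if (\<Sum>i\<in>I. rvec I X \<omega> i) = j then 1 else 0) \<partial>M)"
    by (rule tower[symmetric])
  also have "\<dots> = (\<integral>\<^sup>+\<omega>. indicator B \<omega> \<partial>M)"
    unfolding sum_eq[symmetric] by (intro nn_integral_cong) (auto simp: indicator_def B_def)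
  also have "\<dots> = emeasure M B" using B by simp
  finally have *: "emeasure M (B \<inter> (X i -` {a} \<inter> space M)) = ennreal (?pmf a) * emeasure M B" .
  have "emeasure (cond_law M (X i) (\<lambda>\<omega>. (\<Sum>i\<in>I. X i \<omega>) = j)) {a}
      = emeasure (uniform_measure M B) (X i -` {a} \<inter> space M)"
    unfolding cond_law_def B_def[symmetric] by (subst emeasure_distr) auto
  also have "\<dots> = emeasure M (B \<inter> (X i -` {a} \<inter> space M)) / emeasure M B"
    using B measurable_sets[OF Xi, of "{a}"] by (intro emeasure_uniform_measure) auto
  also have "\<dots> = ennreal (?pmf a)"
    unfolding * using assms(3)
    by (simp add: emeasure_eq_measure B_def divide_ennreal ennreal_mult'[symmetric])
  finally show "emeasure (cond_law M (X i) (\<lambda>\<omega>. (\<Sum>i\<in>I. X i \<omega>) = j)) {a}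
      = emeasure (measure_pmf (binomial_pmf j (p i / (\<Sum>i\<in>I. p i)))) {a}"
    by (simp add: emeasure_pmf_single)
qed (auto simp: cond_law_def)

end

section \<open>The compound negative multinomial distribution\<close>

theorem theorem3:
  fixes M :: "'a measure"
    and k s :: nat
    and p :: "nat \<Rightarrow> real" and p0 :: real
    and Y :: "nat \<Rightarrow> nat \<Rightarrow> 'a \<Rightarrow> nat"
    and N :: "'a \<Rightarrow> nat"
    and X :: "nat \<Rightarrow> 'a \<Rightarrow> nat"
  assumes "prob_space M"
    and "k \<ge> 1" and "s \<ge> 1"
    and "\<And>i. i \<in> {1..k} \<Longrightarrow> p i > 0"
    and "(\<Sum>i=1..k. p i) < 1"
    and "p0 = 1 - (\<Sum>i=1..k. p i)"
    and "\<And>t. t \<ge> 1 \<Longrightarrow>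
           rvec {1..k} (\<lambda>l. Y l t) \<in> measurable M (nat_vectors {1..k}) \<and>
           distr M (nat_vectors {1..k}) (rvec {1..k} (\<lambda>l. Y l t)) = NMn {1..k} s p"
    and "prob_space.indep_vars M (\<lambda>_. nat_vectors {1..k}) (\<lambda>t. rvec {1..k} (\<lambda>l. Y l t)) {1..}"
    and "N \<in> measurable M (count_space UNIV)"
    and "prob_space.indep_set M
           (sets (vimage_algebra (space M) N (count_space UNIV)))
           (sets (vimage_algebra (space M) (\<lambda>\<omega>. \<lambda>t\<in>{1..}. rvec {1..k} (\<lambda>l. Y l t) \<omega>)
              (\<Pi>\<^sub>M t\<in>{1..}. nat_vectors {1..k})))"
    and "\<And>l \<omega>. l \<in> {1..k} \<Longrightarrow> \<omega> \<in> space M \<Longrightarrow>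
           X l \<omega> = (if N \<omega> > 0 then \<Sum>t=1..N \<omega>. Y l t \<omega> else 0)"
  shows
    "distr M (nat_vectors {1..k}) (rvec {1..k} X)
       = CNNMn (distr M (count_space UNIV) N) {1..k} s p
   \<and>
     (\<forall>z. pgf_exists M {1..k} X z
        \<and> 1 - (\<Sum>i=1..k. p i * z i) \<noteq> 0
        \<and> pgf1_exists M (\<lambda>\<omega>. s * N \<omega>) (p0 / (1 - (\<Sum>i=1..k. p i * z i)))
        \<longrightarrow> pgf M {1..k} X z
              = pgf1 M (\<lambda>\<omega>. s * N \<omega>) (p0 / (1 - (\<Sum>i=1..k. p i * z i))))
   \<and>
     \<P>(\<omega> in M. \<forall>i\<in>{1..k}. X i \<omega> = 0) = pgf1 M (\<lambda>\<omega>. s * N \<omega>) p0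
   \<and>
     (\<forall>x. (\<exists>i\<in>{1..k}. x i \<noteq> 0) \<longrightarrow>
        \<P>(\<omega> in M. \<forall>i\<in>{1..k}. X i \<omega> = x i)
          = (\<Prod>i=1..k. p i ^ x i)
            * (\<Sum>\<^sub>\<infinity>n\<in>{1..}. multinom {1..k} x (s * n - 1) * p0 ^ (n * s) * \<P>(\<omega> in M. N \<omega> = n)))
   \<and>
     (\<forall>r\<in>{1..k}. \<forall>\<iota>. inj_on \<iota> {1..r} \<and> \<iota> ` {1..r} \<subseteq> {1..k} \<longrightarrow>
        (let \<rho> = (\<lambda>m. p (\<iota> m) / (p0 + (\<Sum>l=1..r. p (\<iota> l))));
             \<rho>0 = 1 - (\<Sum>m=1..r. \<rho> m)
         in
           (\<forall>z. pgf_exists M {1..r} (\<lambda>m. X (\<iota> m)) z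
              \<and> 1 - (\<Sum>m=1..r. \<rho> m * z m) \<noteq> 0
              \<and> pgf1_exists M (\<lambda>\<omega>. s * N \<omega>) (\<rho>0 / (1 - (\<Sum>m=1..r. \<rho> m * z m)))
              \<longrightarrow> pgf M {1..r} (\<lambda>m. X (\<iota> m)) z
                    = pgf1 M (\<lambda>\<omega>. s * N \<omega>) (\<rho>0 / (1 - (\<Sum>m=1..r. \<rho> m * z m))))
         \<and> distr M (nat_vectors {1..r}) (rvec {1..r} (\<lambda>m. X (\<iota> m)))
             = CNNMn (distr M (count_space UNIV) N) {1..r} s \<rho>
         \<and> \<P>(\<omega> in M. \<forall>m\<in>{1..r}. X (\<iota> m) \<omega> = 0) = pgf1 M (\<lambda>\<omega>. s * N \<omega>) \<rho>0
         \<and> (\<forall>x. (\<exists>m\<in>{1..r}. x m \<noteq> 0) \<longrightarrow>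
              \<P>(\<omega> in M. \<forall>m\<in>{1..r}. X (\<iota> m) \<omega> = x m)
                = (\<Prod>m=1..r. \<rho> m ^ x m)
                  * (\<Sum>\<^sub>\<infinity>n\<in>{1..}. multinom {1..r} x (s * n - 1) * \<rho>0 ^ (n * s)
                       * \<P>(\<omega> in M. N \<omega> = n)))))
   \<and>
     (\<forall>i\<in>{1..k}.
        (integrable M (\<lambda>\<omega>. real (N \<omega>)) \<longrightarrow>
           mean M (X i) = real s * (p i / p0) * mean M N)
      \<and> (integrable M (\<lambda>\<omega>. (real (N \<omega>))\<^sup>2) \<longrightarrow>
           var M (X i)
             = real s * ((p i)\<^sup>2 / p0\<^sup>2) * (real s * var M N + (1 + p0 / p i) * mean M N)
         \<and> (mean M N \<noteq> 0 \<longrightarrow>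
              FI M (X i) = 1 + p i / p0 * (real s * FI M N + 1))))
   \<and>
     (\<forall>i\<in>{1..k}. \<forall>j\<in>{1..k}. i \<noteq> j
        \<and> integrable M (\<lambda>\<omega>. (real (X i \<omega>))\<^sup>2) \<and> integrable M (\<lambda>\<omega>. (real (X j \<omega>))\<^sup>2)
        \<and> mean M (X i) \<noteq> 0 \<and> mean M (X j) \<noteq> 0
        \<and> var M (X i) \<noteq> 0 \<and> var M (X j) \<noteq> 0 \<longrightarrow>
        cor M (X i) (X j)
          = sqrt ((FI M (X i) - 1) * (FI M (X j) - 1) / (FI M (X i) * FI M (X j))))
   \<and>
     (\<forall>i\<in>{1..k}. \<forall>j\<in>{1..k}. i \<noteq> j \<longrightarrow>
        (\<forall>xi xj. xj \<ge> 1 \<and> \<P>(\<omega> in M. X j \<omega> = xj) > 0 \<longrightarrow>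
           \<P>(\<omega> in M. X i \<omega> = xi \<bar> X j \<omega> = xj)
             = 1 / fact xi * ((p0 + p j) / (p0 + p i + p j)) ^ xj
               * (p i / (p0 + p i + p j)) ^ xi
               * ((\<Sum>\<^sub>\<infinity>n\<in>{1..}. fact (s * n + xi + xj - 1) / fact (s * n - 1)
                     * (p0 / (p0 + p i + p j)) ^ (s * n) * \<P>(\<omega> in M. N \<omega> = n))
                / (\<Sum>\<^sub>\<infinity>n\<in>{1..}. fact (s * n + xj - 1) / fact (s * n - 1)
                     * (p0 / (p0 + p j)) ^ (s * n) * \<P>(\<omega> in M. N \<omega> = n))))
      \<and> (\<P>(\<omega> in M. X j \<omega> = 0) > 0 \<longrightarrow>
           (\<forall>xi\<ge>1.
              \<P>(\<omega> in M. X i \<omega> = xi \<bar> X j \<omega> = 0)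
                = (p i / (p0 + p i + p j)) ^ xi / pgf1 M (\<lambda>\<omega>. s * N \<omega>) (p0 / (p0 + p j))
                  * (\<Sum>\<^sub>\<infinity>n\<in>{1..}. fact (s * n + xi - 1) / (fact xi * fact (s * n - 1))
                       * (p0 / (p0 + p i + p j)) ^ (s * n) * \<P>(\<omega> in M. N \<omega> = n)))
         \<and> \<P>(\<omega> in M. X i \<omega> = 0 \<bar> X j \<omega> = 0)
             = pgf1 M (\<lambda>\<omega>. s * N \<omega>) (p0 / (p0 + p i + p j))
               / pgf1 M (\<lambda>\<omega>. s * N \<omega>) (p0 / (p0 + p j))))
   \<and>
     (\<forall>i\<in>{1..k}. \<forall>j\<in>{1..k}. i \<noteq> j \<longrightarrow>
        (\<forall>xj\<ge>1. \<P>(\<omega> in M. X j \<omega> = xj) > 0 \<longrightarrow>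
           cond_mean M (X i) (\<lambda>\<omega>. X j \<omega> = xj)
             = p i / p j * real (xj + 1) * (\<P>(\<omega> in M. X j \<omega> = xj + 1) / \<P>(\<omega> in M. X j \<omega> = xj))))
   \<and>
     distr M (nat_vectors {1::nat}) (rvec {1} (\<lambda>_ \<omega>. \<Sum>i=1..k. X i \<omega>))
       = CNNMn (distr M (count_space UNIV) N) {1} s (\<lambda>_. 1 - p0)
   \<and>
     (\<forall>j\<ge>1. \<forall>i\<in>{1..k}. \<P>(\<omega> in M. (\<Sum>l=1..k. X l \<omega>) = j) > 0 \<longrightarrow>
        cond_law M (X i) (\<lambda>\<omega>. (\<Sum>l=1..k. X l \<omega>) = j) = measure_pmf (binomial_pmf j (p i / (1 - p0))))"
proof -
  interpret prob_space M by fact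
  define I where "I = {1..k}"
  have p0: "p0 = 1 - (\<Sum>i\<in>I. p i)" using assms(6) by (simp add: I_def)
  have probs: "success_probs I p"
    using assms(4,5) by (auto simp: success_probs_def I_def intro: less_imp_le)
  have p_pos: "0 < p i" if "i \<in> I" for i using that assms(4) by (simp add: I_def)
  have p0_pos: "0 < p0" using success_probsD(5)[OF probs] by (simp add: p0)
  interpret compound_negmult M N I X s p
  proof (rule compound_negmultI[where V = "\<lambda>t. rvec {1..k} (\<lambda>l. Y l t)"])
    show "rvec I X \<omega> = (\<lambda>i\<in>I. \<Sum>t=1..N \<omega>. rvec {1..k} (\<lambda>l. Y l t) \<omega> i)" if "\<omega> \<in> space M" for \<omega>
      using that assms(11) by (auto simp: rvec_def I_def fun_eq_iff)
  qed (use assms probs in \<open>simp_all add: I_def NMn_eq_negmult\<close>)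
  have total_pos: "0 < (\<Sum>i\<in>I. p i)"
    using assms(2) p_pos finite_index by (intro sum_pos) (auto simp: I_def)
  show ?thesis
    unfolding I_def[symmetric]
  proof (intro conjI)
    show "distr M (nat_vectors I) (rvec I X) = CNNMn (distr M (count_space UNIV) N) I s p"
      by (rule law[OF assms(3)])
  next
    show "\<forall>z. pgf_exists M I X z
        \<and> 1 - (\<Sum>i\<in>I. p i * z i) \<noteq> 0
        \<and> pgf1_exists M (\<lambda>\<omega>. s * N \<omega>) (p0 / (1 - (\<Sum>i\<in>I. p i * z i)))
        \<longrightarrow> pgf M I X z
              = pgf1 M (\<lambda>\<omega>. s * N \<omega>) (p0 / (1 - (\<Sum>i\<in>I. p i * z i)))"
      using pgf_eq[OF assms(3)] by (simp add: p0)
  next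
    show "\<P>(\<omega> in M. \<forall>i\<in>I. X i \<omega> = 0) = pgf1 M (\<lambda>\<omega>. s * N \<omega>) p0"
      unfolding p0 by (rule prob_zero)
  next
    show "\<forall>x. (\<exists>i\<in>I. x i \<noteq> 0) \<longrightarrow>
        \<P>(\<omega> in M. \<forall>i\<in>I. X i \<omega> = x i)
          = (\<Prod>i\<in>I. p i ^ x i)
            * (\<Sum>\<^sub>\<infinity>n\<in>{1..}. multinom I x (s * n - 1) * p0 ^ (n * s) * \<P>(\<omega> in M. N \<omega> = n))"
      unfolding p0 using prob_nonzero[OF assms(3)] by blast
  next
    show "\<forall>r\<in>I. \<forall>\<iota>. inj_on \<iota> {1..r} \<and> \<iota> ` {1..r} \<subseteq> I \<longrightarrow>
        (let \<rho> = (\<lambda>m. p (\<iota> m) / (p0 + (\<Sum>l=1..r. p (\<iota> l))));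
             \<rho>0 = 1 - (\<Sum>m=1..r. \<rho> m)
         in
           (\<forall>z. pgf_exists M {1..r} (\<lambda>m. X (\<iota> m)) z
              \<and> 1 - (\<Sum>m=1..r. \<rho> m * z m) \<noteq> 0
              \<and> pgf1_exists M (\<lambda>\<omega>. s * N \<omega>) (\<rho>0 / (1 - (\<Sum>m=1..r. \<rho> m * z m)))
              \<longrightarrow> pgf M {1..r} (\<lambda>m. X (\<iota> m)) z
                    = pgf1 M (\<lambda>\<omega>. s * N \<omega>) (\<rho>0 / (1 - (\<Sum>m=1..r. \<rho> m * z m))))
         \<and> distr M (nat_vectors {1..r}) (rvec {1..r} (\<lambda>m. X (\<iota> m)))
             = CNNMn (distr M (count_space UNIV) N) {1..r} s \<rho>
         \<and> \<P>(\<omega> in M. \<forall>m\<in>{1..r}. X (\<iota> m) \<omega> = 0) = pgf1 M (\<lambda>\<omega>. s * N \<omega>) \<rho>0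
         \<and> (\<forall>x. (\<exists>m\<in>{1..r}. x m \<noteq> 0) \<longrightarrow>
              \<P>(\<omega> in M. \<forall>m\<in>{1..r}. X (\<iota> m) \<omega> = x m)
                = (\<Prod>m=1..r. \<rho> m ^ x m)
                  * (\<Sum>\<^sub>\<infinity>n\<in>{1..}. multinom {1..r} x (s * n - 1) * \<rho>0 ^ (n * s)
                       * \<P>(\<omega> in M. N \<omega> = n))))"
      (is "\<forall>r\<in>I. \<forall>\<iota>. _ \<longrightarrow> ?marginal r \<iota>")
    proof (intro ballI allI impI, elim conjE)
      fix r and \<iota> :: "nat \<Rightarrow> nat"
      assume \<iota>: "inj_on \<iota> {1..r}" "\<iota> ` {1..r} \<subseteq> I"
      define \<rho> where "\<rho> m = p (\<iota> m) / (p0 + (\<Sum>l=1..r. p (\<iota> l)))" for m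
      have "(\<lambda>m. p (\<iota> m) / (p0 + (\<Sum>l=1..r. p (\<iota> l)))) = \<rho>" by (simp add: fun_eq_iff \<rho>_def)
      then interpret sub: compound_negmult M N "{1..r}" "\<lambda>m. X (\<iota> m)" s \<rho>
        using marginal[OF \<iota>] by (simp only: p0)
      show "?marginal r \<iota>"
        unfolding Let_def \<rho>_def[symmetric]
        using sub.pgf_eq[OF assms(3)] sub.law[OF assms(3)] sub.prob_zero sub.prob_nonzero[OF assms(3)]
        by (intro conjI allI impI) simp_all
    qed
  next
    show "\<forall>i\<in>I.
        (integrable M (\<lambda>\<omega>. real (N \<omega>)) \<longrightarrow>
           mean M (X i) = real s * (p i / p0) * mean M N)
      \<and> (integrable M (\<lambda>\<omega>. (real (N \<omega>))\<^sup>2) \<longrightarrow>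
           var M (X i)
             = real s * ((p i)\<^sup>2 / p0\<^sup>2) * (real s * var M N + (1 + p0 / p i) * mean M N)
         \<and> (mean M N \<noteq> 0 \<longrightarrow>
              FI M (X i) = 1 + p i / p0 * (real s * FI M N + 1)))"
    proof (intro ballI conjI impI)
      fix i assume i: "i \<in> I"
      show "mean M (X i) = real s * (p i / p0) * mean M N"
        unfolding p0 by (rule mean_eq[OF i])
      assume int: "integrable M (\<lambda>\<omega>. (real (N \<omega>))\<^sup>2)"
      show "var M (X i) = real s * ((p i)\<^sup>2 / p0\<^sup>2) * (real s * var M N + (1 + p0 / p i) * mean M N)"
        unfolding var_eq[OF i int, folded p0] using p_pos[OF i] p0_pos
        by (simp add: field_simps power2_eq_square)
      assume "mean M N \<noteq> 0"
      then show "FI M (X i) = 1 + p i / p0 * (real s * FI M N + 1)"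
        unfolding p0 by (rule FI_eq[OF i assms(3) p_pos[OF i] int])
    qed
  next
    show "\<forall>i\<in>I. \<forall>j\<in>I. i \<noteq> j
        \<and> integrable M (\<lambda>\<omega>. (real (X i \<omega>))\<^sup>2) \<and> integrable M (\<lambda>\<omega>. (real (X j \<omega>))\<^sup>2)
        \<and> mean M (X i) \<noteq> 0 \<and> mean M (X j) \<noteq> 0
        \<and> var M (X i) \<noteq> 0 \<and> var M (X j) \<noteq> 0 \<longrightarrow>
        cor M (X i) (X j)
          = sqrt ((FI M (X i) - 1) * (FI M (X j) - 1) / (FI M (X i) * FI M (X j)))"
    proof (intro ballI impI, elim conjE)
      fix i j
      assume ij: "i \<in> I" "j \<in> I" "i \<noteq> j"
        and "integrable M (\<lambda>\<omega>. (real (X i \<omega>))\<^sup>2)" "mean M (X i) \<noteq> 0"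
      then show "cor M (X i) (X j)
          = sqrt ((FI M (X i) - 1) * (FI M (X j) - 1) / (FI M (X i) * FI M (X j)))"
        by (intro cor_eq assms(3) p_pos)
    qed
  next
    show "\<forall>i\<in>I. \<forall>j\<in>I. i \<noteq> j \<longrightarrow>
        (\<forall>xi xj. xj \<ge> 1 \<and> \<P>(\<omega> in M. X j \<omega> = xj) > 0 \<longrightarrow>
           \<P>(\<omega> in M. X i \<omega> = xi \<bar> X j \<omega> = xj)
             = 1 / fact xi * ((p0 + p j) / (p0 + p i + p j)) ^ xj
               * (p i / (p0 + p i + p j)) ^ xi
               * ((\<Sum>\<^sub>\<infinity>n\<in>{1..}. fact (s * n + xi + xj - 1) / fact (s * n - 1)
                     * (p0 / (p0 + p i + p j)) ^ (s * n) * \<P>(\<omega> in M. N \<omega> = n))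
                / (\<Sum>\<^sub>\<infinity>n\<in>{1..}. fact (s * n + xj - 1) / fact (s * n - 1)
                     * (p0 / (p0 + p j)) ^ (s * n) * \<P>(\<omega> in M. N \<omega> = n))))
      \<and> (\<P>(\<omega> in M. X j \<omega> = 0) > 0 \<longrightarrow>
           (\<forall>xi\<ge>1.
              \<P>(\<omega> in M. X i \<omega> = xi \<bar> X j \<omega> = 0)
                = (p i / (p0 + p i + p j)) ^ xi / pgf1 M (\<lambda>\<omega>. s * N \<omega>) (p0 / (p0 + p j))
                  * (\<Sum>\<^sub>\<infinity>n\<in>{1..}. fact (s * n + xi - 1) / (fact xi * fact (s * n - 1))
                       * (p0 / (p0 + p i + p j)) ^ (s * n) * \<P>(\<omega> in M. N \<omega> = n)))
         \<and> \<P>(\<omega> in M. X i \<omega> = 0 \<bar> X j \<omega> = 0)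
             = pgf1 M (\<lambda>\<omega>. s * N \<omega>) (p0 / (p0 + p i + p j))
               / pgf1 M (\<lambda>\<omega>. s * N \<omega>) (p0 / (p0 + p j)))"
    proof (intro ballI impI)
      fix i j assume ij: "i \<in> I" "j \<in> I" "i \<noteq> j"
      note pair = prob_pair[OF ij assms(3), folded p0] and single = prob_single[OF ij(2) assms(3), folded p0]
      define D E where "D = p0 + p i + p j" and "E = p0 + p j"
      have DE: "0 < D" "0 < E" "0 < p j"
        using p0_pos p_pos[OF ij(1)] p_pos[OF ij(2)] by (simp_all add: D_def E_def)
      define S where "S x y = (\<Sum>\<^sub>\<infinity>n\<in>{1..}. fact (s * n + x + y - 1) / fact (s * n - 1)
          * (p0 / D) ^ (s * n) * \<P>(\<omega> in M. N \<omega> = n))" for x y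
      define T where "T y = (\<Sum>\<^sub>\<infinity>n\<in>{1..}. fact (s * n + y - 1) / fact (s * n - 1)
          * (p0 / E) ^ (s * n) * \<P>(\<omega> in M. N \<omega> = n))" for y
      have both: "\<P>(\<omega> in M. X i \<omega> = x \<and> X j \<omega> = y)
          = (p i / D) ^ x * (p j / D) ^ y / (fact x * fact y) * S x y" if "x \<noteq> 0 \<or> y \<noteq> 0" for x y
        using pair(2)[OF that] by (simp only: S_def D_def)
      have one: "\<P>(\<omega> in M. X j \<omega> = y) = (p j / E) ^ y / fact y * T y" if "y \<noteq> 0" for y
        using single(2)[OF that] by (simp only: T_def E_def)
      have "\<P>(\<omega> in M. X i \<omega> = x \<bar> X j \<omega> = y)
          = 1 / fact x * (E / D) ^ y * (p i / D) ^ x * (S x y / T y)"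
        if "y \<ge> 1" "0 < \<P>(\<omega> in M. X j \<omega> = y)" for x y
        using that DE one[of y] both[of x y]
        by (simp add: cond_prob_def power_divide mult_ac)
      moreover have "\<P>(\<omega> in M. X i \<omega> = x \<bar> X j \<omega> = 0)
          = (p i / D) ^ x / pgf1 M (\<lambda>\<omega>. s * N \<omega>) (p0 / E)
            * (\<Sum>\<^sub>\<infinity>n\<in>{1..}. fact (s * n + x - 1) / (fact x * fact (s * n - 1))
                 * (p0 / D) ^ (s * n) * \<P>(\<omega> in M. N \<omega> = n))" if "x \<ge> 1" for x
      proof -
        have "(\<Sum>\<^sub>\<infinity>n\<in>{1..}. fact (s * n + x - 1) / (fact x * fact (s * n - 1))
                 * (p0 / D) ^ (s * n) * \<P>(\<omega> in M. N \<omega> = n))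
            = (\<Sum>\<^sub>\<infinity>n\<in>{1..}. 1 / fact x * (fact (s * n + x + 0 - 1) / fact (s * n - 1)
                 * (p0 / D) ^ (s * n) * \<P>(\<omega> in M. N \<omega> = n)))"
          by (rule infsum_cong) simp
        also have "\<dots> = 1 / fact x * S x 0"
          unfolding infsum_cmult_right' S_def ..
        finally show ?thesis
          using both[of x 0] that single(1) by (simp add: cond_prob_def E_def)
      qed
      moreover have "\<P>(\<omega> in M. X i \<omega> = 0 \<bar> X j \<omega> = 0)
          = pgf1 M (\<lambda>\<omega>. s * N \<omega>) (p0 / D) / pgf1 M (\<lambda>\<omega>. s * N \<omega>) (p0 / E)"
        unfolding cond_prob_def pair(1) single(1) D_def E_def ..
      ultimately show "(\<forall>xi xj. xj \<ge> 1 \<and> \<P>(\<omega> in M. X j \<omega> = xj) > 0 \<longrightarrow>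
           \<P>(\<omega> in M. X i \<omega> = xi \<bar> X j \<omega> = xj)
             = 1 / fact xi * ((p0 + p j) / (p0 + p i + p j)) ^ xj
               * (p i / (p0 + p i + p j)) ^ xi
               * ((\<Sum>\<^sub>\<infinity>n\<in>{1..}. fact (s * n + xi + xj - 1) / fact (s * n - 1)
                     * (p0 / (p0 + p i + p j)) ^ (s * n) * \<P>(\<omega> in M. N \<omega> = n))
                / (\<Sum>\<^sub>\<infinity>n\<in>{1..}. fact (s * n + xj - 1) / fact (s * n - 1)
                     * (p0 / (p0 + p j)) ^ (s * n) * \<P>(\<omega> in M. N \<omega> = n))))
      \<and> (\<P>(\<omega> in M. X j \<omega> = 0) > 0 \<longrightarrow>
           (\<forall>xi\<ge>1.
              \<P>(\<omega> in M. X i \<omega> = xi \<bar> X j \<omega> = 0)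
                = (p i / (p0 + p i + p j)) ^ xi / pgf1 M (\<lambda>\<omega>. s * N \<omega>) (p0 / (p0 + p j))
                  * (\<Sum>\<^sub>\<infinity>n\<in>{1..}. fact (s * n + xi - 1) / (fact xi * fact (s * n - 1))
                       * (p0 / (p0 + p i + p j)) ^ (s * n) * \<P>(\<omega> in M. N \<omega> = n)))
         \<and> \<P>(\<omega> in M. X i \<omega> = 0 \<bar> X j \<omega> = 0)
             = pgf1 M (\<lambda>\<omega>. s * N \<omega>) (p0 / (p0 + p i + p j))
               / pgf1 M (\<lambda>\<omega>. s * N \<omega>) (p0 / (p0 + p j)))"
        unfolding D_def[symmetric] E_def[symmetric] S_def[symmetric] T_def[symmetric] by blast
    qed
  next
    show "\<forall>i\<in>I. \<forall>j\<in>I. i \<noteq> j \<longrightarrow>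
        (\<forall>xj\<ge>1. \<P>(\<omega> in M. X j \<omega> = xj) > 0 \<longrightarrow>
           cond_mean M (X i) (\<lambda>\<omega>. X j \<omega> = xj)
             = p i / p j * real (xj + 1) * (\<P>(\<omega> in M. X j \<omega> = xj + 1) / \<P>(\<omega> in M. X j \<omega> = xj)))"
      using cond_mean_eq p_pos by blast
  next
    have "1 - p0 = (\<Sum>i\<in>I. p i)" by (simp add: p0)
    then show "distr M (nat_vectors {1::nat}) (rvec {1} (\<lambda>_ \<omega>. \<Sum>i\<in>I. X i \<omega>))
       = CNNMn (distr M (count_space UNIV) N) {1} s (\<lambda>_. 1 - p0)"
      using compound_negmult.law[OF total assms(3)] by simp
    show "\<forall>j\<ge>1. \<forall>i\<in>I. \<P>(\<omega> in M. (\<Sum>l\<in>I. X l \<omega>) = j) > 0 \<longrightarrow>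
        cond_law M (X i) (\<lambda>\<omega>. (\<Sum>l\<in>I. X l \<omega>) = j) = measure_pmf (binomial_pmf j (p i / (1 - p0)))"
      using cond_law_eq[OF _ total_pos] by (simp add: p0)
  qed
qed

end
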